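(* Suppose that, as $n\to\infty$, $W_n\to W$ in distribution for some random variable $W$, $\mathbf{E}[W_n]\to\mathbf{E}[W]\in(0,\infty)$ and $\mathbf{E}[W_n^2]\to\mathbf{E}[W^2]<\infty$. Fix $t>0$. Let $D_n^s=d_{o_n}(s)$ be the degree at time $s$ in $\mathrm{DRIG}^s_n(\mathbf w)$ of a uniformly chosen vertex $o_n$ (chosen once for all times). Then, as $n\to\infty$, $$\big(D_n^s\big)_{s\in[0,t]}\ \longrightarrow\ \Big(\sum_{k=2}^\infty (k-1)\,C^s_k(o)\Big)_{s\in[0,t]}$$ in distribution as processes (in $D[0,t]$ with the Skorokhod $J_1$ topology), where $C^s_k(o)$ is the number of groups of size $k$ containing the root $o$ at time $s$ in the limiting graph.
   Context: Notation. $[n]=\{1,\dots,n\}$; $[n]_k$ is the set of $k$-element subsets of $[n]$; elements $a\in\bigcup_{k\ge 2}[n]_k$ are called groups and $|a|$ is the size of $a$. For each $n$, $\mathbf{w}=(w_i)_{i\in[n]}$ are deterministic nonnegative vertex weights (possibly depending on $n$), $\ell_n=\sum_{i\in[n]}w_i>0$, and $W_n=w_{o_n}$ is the weight of a uniformly chosen vertex $o_n\in[n]$. $(p_k)_{k\ge2}$ is a probability mass function with $\mu=\sum_{k\ge2}kp_k<\infty$ and $\mu_{(2)}=\sum_{k\ge2}k^2p_k<\infty$; $f(k)=k!\,p_k$. Dynamic model. The groups evolve as independent right-continuous continuous-time Markov chains on $\{\mathrm{ON},\mathrm{OFF}\}$; group $a$ leaves ON at rate $1$ and leaves OFF at rate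 $\lambda^a_{\mathrm{OFF}}=f(|a|)\prod_{i\in a}w_i/\ell_n^{|a|-1}$, and starts from its stationary distribution $\pi^a_{\mathrm{ON}}=\lambda^a_{\mathrm{OFF}}/(1+\lambda^a_{\mathrm{OFF}})$. $\mathrm{DRIG}^s_n(\mathbf{w})$ is the multigraph on $[n]$ in which the number of edges between $i\ne j$ is the number of groups ON at time $s$ that contain both; thus $d_i(s)=\sum_{k\ge2}\sum_{a\in[n]_k:\,a\ni i}(|a|-1)\mathbf 1\{a\text{ is ON at time }s\}$. Limit. $D^{(l),[0,t]}$ is mixed Poisson with parameter $(1+t)\mu W$, i.e. $\mathbf P(D^{(l),[0,t]}=j)=\mathbf E[e^{-(1+t)\mu W}((1+t)\mu W)^j/j!]$. In the limiting marked branching tree, the root $o$ has $D^{(l),[0,t]}$ children (groups, also called right-vertices). Independently, each child $a$ of the root has size (number of adjacent left-vertices, including $o$) equal to $k$ with probability $kp_k/\mu$, and carries an independent mark $(t^a_{\mathrm{ON}},t^a_{\mathrm{OFF}})$ with joint distribution function $F_t(s_1,s_2)=\dfrac{1-e^{-s_2+s_1}+s_1}{1+t}$, $s_1\in[0,t]$, $s_2\ge s_1$; all of these are mutually independent and independent of the number of children. $C_k^s(o)$ is the number of children $a$ of $o$ of size $k$ with $s\in[t^a_{\mathrm{ON}},t^a_{\mathrm{OFF}})$. *)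

theory Defs
  imports "HOL-Probability.Probability"
begin

section \<open>The Skorokhod space and convergence in distribution\<close>

text \<open>Elements of \<open>D[0,t]\<close> are represented by functions on \<^typ>\<open>real\<close> that are
  \<open>undefined\<close> outside \<open>[0,t]\<close> (membership in \<^const>\<open>extensional\<close>), so that equality of functions
  is equality of paths.\<close>

definition cadlag_space :: "real \<Rightarrow> (real \<Rightarrow> real) set" where
  "cadlag_space t = {x \<in> extensional {0..t}.
     (\<forall>s\<in>{0..<t}. (x \<longlongrightarrow> x s) (at_right s)) \<and>
     (\<forall>s\<in>{0<..t}. \<exists>l. (x \<longlongrightarrow> l) (at_left s))}"

definition time_changes :: "real \<Rightarrow> (real \<Rightarrow> real) set" where
  "time_changes t = {h. strict_mono_on {0..t} h \<and> continuous_on {0..t} h \<and> h ` {0..t} = {0..t}}"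

definition skorokhod_dist :: "real \<Rightarrow> (real \<Rightarrow> real) \<Rightarrow> (real \<Rightarrow> real) \<Rightarrow> real" where
  "skorokhod_dist t x y = (if x \<in> cadlag_space t \<and> y \<in> cadlag_space t
     then Inf {e. e > 0 \<and>
       (\<exists>h\<in>time_changes t. \<forall>s\<in>{0..t}. \<bar>h s - s\<bar> \<le> e \<and> \<bar>x s - y (h s)\<bar> \<le> e)}
     else 0)"

definition skorokhod_topology :: "real \<Rightarrow> (real \<Rightarrow> real) topology" where
  "skorokhod_topology t = Metric_space.mtopology (cadlag_space t) (skorokhod_dist t)"

definition borel_sigma :: "'x topology \<Rightarrow> 'x measure" where
  "borel_sigma T = sigma (topspace T) {U. openin T U}"

text \<open>The \<open>n\<close>-th random element may live on its own probability space \<open>M n\<close>. Measurability is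
  part of the notion; it is required eventually because sequences here are indexed by \<open>n \<ge> 1\<close>.\<close>

definition converges_in_distribution ::
  "'x topology \<Rightarrow> (nat \<Rightarrow> 'a measure) \<Rightarrow> (nat \<Rightarrow> 'a \<Rightarrow> 'x) \<Rightarrow> 'b measure \<Rightarrow> ('b \<Rightarrow> 'x) \<Rightarrow> bool" where
  "converges_in_distribution T M X L Z \<longleftrightarrow>
     (\<forall>\<^sub>F n in sequentially. prob_space (M n) \<and> X n \<in> M n \<rightarrow>\<^sub>M borel_sigma T) \<and>
     prob_space L \<and> Z \<in> L \<rightarrow>\<^sub>M borel_sigma T \<and>
     (\<forall>f. continuous_map T euclideanreal f \<and> bounded (f ` topspace T) \<longrightarrow>
        (\<lambda>n. \<integral>\<omega>. f (X n \<omega>) \<partial>M n) \<longlonglongrightarrow> (\<integral>\<omega>. f (Z \<omega>) \<partial>L))"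

subsection \<open>The Skorokhod distance is a metric\<close>

lemma time_changes_id: "(\<lambda>s. s) \<in> time_changes t"
  by (auto simp: time_changes_def strict_mono_on_def)

lemma time_changes_comp:
  assumes "g \<in> time_changes t" "h \<in> time_changes t"
  shows "(\<lambda>s. g (h s)) \<in> time_changes t"
proof -
  have h: "h s \<in> {0..t}" if "s \<in> {0..t}" for s
    using assms(2) that by (auto simp: time_changes_def)
  have G: "strict_mono_on {0..t} g" "continuous_on {0..t} g" "g ` {0..t} = {0..t}"
    and H: "strict_mono_on {0..t} h" "continuous_on {0..t} h" "h ` {0..t} = {0..t}"
    using assms by (simp_all add: time_changes_def)
  have "(\<lambda>s. g (h s)) ` {0..t} = {0..t}"
    using G(3) H(3) by (metis image_image)
  moreover have "continuous_on {0..t} (\<lambda>s. g (h s))"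
    by (rule continuous_on_compose2[OF G(2) H(2)]) (simp add: H(3))
  moreover have "strict_mono_on {0..t} (\<lambda>s. g (h s))"
    by (rule strict_mono_onI) (intro strict_mono_onD[OF G(1)] strict_mono_onD[OF H(1)] h)
  ultimately show ?thesis by (simp add: time_changes_def)
qed

lemma time_changes_inverse:
  assumes "h \<in> time_changes t"
  obtains g where "g \<in> time_changes t" "\<And>s. s \<in> {0..t} \<Longrightarrow> h (g s) = s"
proof
  define g where "g = the_inv_into {0..t} h"
  have inj: "inj_on h {0..t}"
    using assms by (auto simp: time_changes_def intro: strict_mono_on_imp_inj_on)
  have im: "h ` {0..t} = {0..t}" and sm: "strict_mono_on {0..t} h" and co: "continuous_on {0..t} h"
    using assms by (auto simp: time_changes_def)
  show hg: "h (g s) = s" if "s \<in> {0..t}" for s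
    unfolding g_def using f_the_inv_into_f[OF inj] im that by simp
  have gi: "g s \<in> {0..t}" if "s \<in> {0..t}" for s
    unfolding g_def using the_inv_into_into[OF inj] im that by blast
  have "g ` {0..t} = {0..t}"
    unfolding g_def using the_inv_into_onto[OF inj] im by simp
  moreover have "strict_mono_on {0..t} g"
  proof (rule strict_mono_onI)
    fix r s assume rs: "r \<in> {0..t}" "s \<in> {0..t}" "r < s"
    show "g r < g s"
    proof (rule ccontr)
      assume "\<not> g r < g s"
      then have "g s = g r \<or> g s < g r" by linarith
      then have "h (g s) \<le> h (g r)"
        using strict_mono_onD[OF sm gi[OF rs(2)] gi[OF rs(1)]] by force
      then show False using hg rs by simp
    qed
  qed
  moreover have "continuous_on {0..t} g"
    using continuous_on_inv[OF co, of g] im the_inv_into_f_f[OF inj] by (simp add: g_def)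
  ultimately show "g \<in> time_changes t" by (simp add: time_changes_def)
qed

lemma time_changes_end:
  assumes "h \<in> time_changes t" "0 \<le> t"
  shows "h t = t"
proof -
  have im: "h ` {0..t} = {0..t}" and sm: "strict_mono_on {0..t} h"
    using assms by (auto simp: time_changes_def)
  obtain s where s: "s \<in> {0..t}" "h s = t"
    using im assms(2) by (metis atLeastAtMost_iff imageE order_refl)
  have "h t \<le> t" using im assms(2) by force
  moreover have "s < t \<Longrightarrow> h s < h t"
    using strict_mono_onD[OF sm] s assms(2) by auto
  ultimately show ?thesis using s by (cases "s < t") auto
qed

lemma cadlag_bounded:
  assumes "x \<in> cadlag_space t"
  shows "\<exists>B. \<forall>s\<in>{0..t}. \<bar>x s\<bar> \<le> B"
proof -
  have "\<exists>U B. open U \<and> s \<in> U \<and> (\<forall>u\<in>U \<inter> {0..t}. \<bar>x u\<bar> \<le> B)" if s: "s \<in> {0..t}" for s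
  proof -
    have "\<exists>b>s. \<exists>B. \<forall>u\<in>{s<..<b} \<inter> {0..t}. \<bar>x u\<bar> \<le> B"
    proof (cases "s < t")
      case True
      then have "(x \<longlongrightarrow> x s) (at_right s)" using assms s by (auto simp: cadlag_space_def)
      then have "\<forall>\<^sub>F u in at_right s. \<bar>x u - x s\<bar> < 1" by (simp add: tendsto_iff dist_real_def)
      then obtain b where b: "b > s" "\<And>u. s < u \<Longrightarrow> u < b \<Longrightarrow> \<bar>x u - x s\<bar> < 1"
        by (auto simp: eventually_at_right_field)
      have "\<bar>x u\<bar> \<le> \<bar>x s\<bar> + 1" if "u \<in> {s<..<b} \<inter> {0..t}" for u
        using b(2)[of u] that by auto
      then show ?thesis using b(1) by blast
    next
      case False
      then show ?thesis using s by (intro exI[of _ "s + 1"]) auto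
    qed
    then obtain b B where b: "b > s" "\<And>u. u \<in> {s<..<b} \<inter> {0..t} \<Longrightarrow> \<bar>x u\<bar> \<le> B" by blast
    have "\<exists>a<s. \<exists>A. \<forall>u\<in>{a<..<s} \<inter> {0..t}. \<bar>x u\<bar> \<le> A"
    proof (cases "0 < s")
      case True
      then have "\<exists>l. (x \<longlongrightarrow> l) (at_left s)" using assms s by (simp add: cadlag_space_def)
      then obtain l where "(x \<longlongrightarrow> l) (at_left s)" by blast
      then have "\<forall>\<^sub>F u in at_left s. \<bar>x u - l\<bar> < 1" by (simp add: tendsto_iff dist_real_def)
      then obtain a where a: "a < s" "\<And>u. a < u \<Longrightarrow> u < s \<Longrightarrow> \<bar>x u - l\<bar> < 1"
        by (auto simp: eventually_at_left_field)
      have "\<bar>x u\<bar> \<le> \<bar>l\<bar> + 1" if "u \<in> {a<..<s} \<inter> {0..t}" for u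
        using a(2)[of u] that by auto
      then show ?thesis using a(1) by blast
    next
      case False
      then show ?thesis using s by (intro exI[of _ "s - 1"]) auto
    qed
    then obtain a A where a: "a < s" "\<And>u. u \<in> {a<..<s} \<inter> {0..t} \<Longrightarrow> \<bar>x u\<bar> \<le> A" by blast
    have "\<bar>x u\<bar> \<le> max (max A B) \<bar>x s\<bar>" if "u \<in> {a<..<b} \<inter> {0..t}" for u
      using a(2)[of u] b(2)[of u] that by (cases u s rule: linorder_cases) auto
    moreover have "open {a<..<b}" "s \<in> {a<..<b}" using a(1) b(1) by auto
    ultimately show ?thesis by blast
  qed
  then have "\<forall>s\<in>{0..t}. \<exists>U B. open U \<and> s \<in> U \<and> (\<forall>u\<in>U \<inter> {0..t}. \<bar>x u\<bar> \<le> B)" by blast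
  from bchoice[OF this] obtain U where
    "\<forall>s\<in>{0..t}. \<exists>B. open (U s) \<and> s \<in> U s \<and> (\<forall>u\<in>U s \<inter> {0..t}. \<bar>x u\<bar> \<le> B)" ..
  from bchoice[OF this] obtain B where
    UB: "\<forall>s\<in>{0..t}. open (U s) \<and> s \<in> U s \<and> (\<forall>u\<in>U s \<inter> {0..t}. \<bar>x u\<bar> \<le> B s)" ..
  have B: "\<bar>x u\<bar> \<le> B s" if "s \<in> {0..t}" "u \<in> U s" "u \<in> {0..t}" for s u
    using UB that by blast
  have op: "open (U s)" if "s \<in> {0..t}" for s using UB that by blast
  have "{0..t} \<subseteq> (\<Union>s\<in>{0..t}. U s)" using UB by blast
  from compactE_image[OF compact_Icc op this]
  obtain F where F: "F \<subseteq> {0..t}" "finite F" "{0..t} \<subseteq> (\<Union>s\<in>F. U s)" .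
  have "\<bar>x u\<bar> \<le> (\<Sum>s\<in>F. \<bar>B s\<bar>)" if u: "u \<in> {0..t}" for u
  proof -
    obtain s where s: "s \<in> F" "u \<in> U s" using F u by blast
    have "\<bar>x u\<bar> \<le> B s" by (rule B) (use s F u in blast)+
    also have "\<dots> \<le> \<bar>B s\<bar>" by simp
    also have "\<dots> \<le> (\<Sum>s\<in>F. \<bar>B s\<bar>)"
      using member_le_sum[OF s(1), of "\<lambda>s. \<bar>B s\<bar>"] F(2) by simp
    finally show ?thesis .
  qed
  then show ?thesis by blast
qed

lemma skorokhod_dist_less_iff:
  assumes x: "x \<in> cadlag_space t" and y: "y \<in> cadlag_space t"
  shows "skorokhod_dist t x y < r \<longleftrightarrow>
    (\<exists>e>0. e < r \<and> (\<exists>h\<in>time_changes t. \<forall>s\<in>{0..t}. \<bar>h s - s\<bar> \<le> e \<and> \<bar>x s - y (h s)\<bar> \<le> e))"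
proof -
  obtain A B where A: "\<And>s. s \<in> {0..t} \<Longrightarrow> \<bar>x s\<bar> \<le> A" and B: "\<And>s. s \<in> {0..t} \<Longrightarrow> \<bar>y s\<bar> \<le> B"
    using cadlag_bounded[OF x] cadlag_bounded[OF y] by blast
  define E where "E = {e. e > 0 \<and>
     (\<exists>h\<in>time_changes t. \<forall>s\<in>{0..t}. \<bar>h s - s\<bar> \<le> e \<and> \<bar>x s - y (h s)\<bar> \<le> e)}"
  have "\<bar>x s - y s\<bar> \<le> \<bar>A\<bar> + \<bar>B\<bar> + 1" if "s \<in> {0..t}" for s
    using A[OF that] B[OF that] by linarith
  then have "\<bar>A\<bar> + \<bar>B\<bar> + 1 \<in> E"
    unfolding E_def by (intro CollectI conjI bexI[OF _ time_changes_id]) auto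
  moreover have "bdd_below E" unfolding E_def by (rule bdd_belowI[of _ 0]) simp
  ultimately have "Inf E < r \<longleftrightarrow> (\<exists>e\<in>E. e < r)" by (intro cInf_less_iff) auto
  then show ?thesis using x y by (auto simp: skorokhod_dist_def E_def)
qed

lemma skorokhod_dist_lessI:
  assumes x: "x \<in> cadlag_space t" and y: "y \<in> cadlag_space t"
    and "0 < e" "e < r" "h \<in> time_changes t"
    and "\<And>s. s \<in> {0..t} \<Longrightarrow> \<bar>h s - s\<bar> \<le> e \<and> \<bar>x s - y (h s)\<bar> \<le> e"
  shows "skorokhod_dist t x y < r"
  unfolding skorokhod_dist_less_iff[OF x y] using assms(3-) by blast

lemma skorokhod_dist_nonneg:
  assumes "x \<in> cadlag_space t" "y \<in> cadlag_space t"
  shows "0 \<le> skorokhod_dist t x y"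
  using skorokhod_dist_less_iff[OF assms, of 0] by (meson less_asym not_less)

lemma skorokhod_dist_commute_le:
  assumes x: "x \<in> cadlag_space t" and y: "y \<in> cadlag_space t"
  shows "skorokhod_dist t y x \<le> skorokhod_dist t x y"
proof (rule dense_ge)
  fix r assume "skorokhod_dist t x y < r"
  then obtain e h where e: "0 < e" "e < r" and h: "h \<in> time_changes t"
    and H: "\<And>s. s \<in> {0..t} \<Longrightarrow> \<bar>h s - s\<bar> \<le> e \<and> \<bar>x s - y (h s)\<bar> \<le> e"
    unfolding skorokhod_dist_less_iff[OF x y] by blast
  obtain g where g: "g \<in> time_changes t" and hg: "\<And>s. s \<in> {0..t} \<Longrightarrow> h (g s) = s"
    using time_changes_inverse[OF h] by blast
  have "\<bar>g s - s\<bar> \<le> e \<and> \<bar>y s - x (g s)\<bar> \<le> e" if s: "s \<in> {0..t}" for s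
  proof -
    have "g s \<in> {0..t}" using g s by (auto simp: time_changes_def)
    from H[OF this] show ?thesis using hg[OF s] by (simp add: abs_minus_commute)
  qed
  then have "skorokhod_dist t y x < r"
    unfolding skorokhod_dist_less_iff[OF y x] using e g by blast
  then show "skorokhod_dist t y x \<le> r" by simp
qed

lemma skorokhod_dist_triangle:
  assumes x: "x \<in> cadlag_space t" and y: "y \<in> cadlag_space t" and z: "z \<in> cadlag_space t"
  shows "skorokhod_dist t x z \<le> skorokhod_dist t x y + skorokhod_dist t y z"
proof (rule dense_ge)
  fix r assume r: "skorokhod_dist t x y + skorokhod_dist t y z < r"
  define q where "q = (r - skorokhod_dist t x y - skorokhod_dist t y z) / 2"
  have "skorokhod_dist t x y < skorokhod_dist t x y + q" using r by (simp add: q_def)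
  then obtain e h where e: "0 < e" "e < skorokhod_dist t x y + q" and h: "h \<in> time_changes t"
    and H: "\<And>s. s \<in> {0..t} \<Longrightarrow> \<bar>h s - s\<bar> \<le> e \<and> \<bar>x s - y (h s)\<bar> \<le> e"
    unfolding skorokhod_dist_less_iff[OF x y] by blast
  have "skorokhod_dist t y z < skorokhod_dist t y z + q" using r by (simp add: q_def)
  then obtain e' g where e': "0 < e'" "e' < skorokhod_dist t y z + q" and g: "g \<in> time_changes t"
    and G: "\<And>s. s \<in> {0..t} \<Longrightarrow> \<bar>g s - s\<bar> \<le> e' \<and> \<bar>y s - z (g s)\<bar> \<le> e'"
    unfolding skorokhod_dist_less_iff[OF y z] by blast
  have "\<bar>g (h s) - s\<bar> \<le> e + e' \<and> \<bar>x s - z (g (h s))\<bar> \<le> e + e'" if s: "s \<in> {0..t}" for s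
  proof -
    have "h s \<in> {0..t}" using h s by (auto simp: time_changes_def)
    from G[OF this] H[OF s] show ?thesis by linarith
  qed
  note le = this
  have "0 < e + e'" "e + e' < r" using e e' by (simp_all add: q_def field_simps)
  then have "skorokhod_dist t x z < r"
    by (rule skorokhod_dist_lessI[OF x z _ _ time_changes_comp[OF g h] le])
  then show "skorokhod_dist t x z \<le> r" by simp
qed

lemma skorokhod_dist_refl:
  assumes x: "x \<in> cadlag_space t"
  shows "skorokhod_dist t x x = 0"
proof -
  have "skorokhod_dist t x x \<le> 0"
  proof (rule dense_ge)
    fix r :: real assume r: "0 < r"
    have "skorokhod_dist t x x < r"
    proof (rule skorokhod_dist_lessI[OF x x])
      show "0 < r / 2" "r / 2 < r" using r by auto
      show "(\<lambda>s. s) \<in> time_changes t" by (rule time_changes_id)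
      show "\<bar>s - s\<bar> \<le> r / 2 \<and> \<bar>x s - x s\<bar> \<le> r / 2" for s using r by simp
    qed
    then show "skorokhod_dist t x x \<le> r" by simp
  qed
  then show ?thesis using skorokhod_dist_nonneg[OF x x] by simp
qed

lemma skorokhod_dist_eq_0_imp:
  assumes x: "x \<in> cadlag_space t" and y: "y \<in> cadlag_space t"
    and 0: "skorokhod_dist t x y = 0"
  shows "x = y"
proof (rule extensionalityI)
  show "x \<in> extensional {0..t}" "y \<in> extensional {0..t}"
    using x y by (auto simp: cadlag_space_def)
  fix s assume s: "s \<in> {0..t}"
  have ex: "\<exists>h\<in>time_changes t. \<forall>s\<in>{0..t}. \<bar>h s - s\<bar> < r \<and> \<bar>x s - y (h s)\<bar> < r" if "r > 0" for r
  proof -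
    have "skorokhod_dist t x y < r" using 0 that by simp
    then obtain e h where e: "e < r" and h: "h \<in> time_changes t"
      and H: "\<And>s. s \<in> {0..t} \<Longrightarrow> \<bar>h s - s\<bar> \<le> e \<and> \<bar>x s - y (h s)\<bar> \<le> e"
      unfolding skorokhod_dist_less_iff[OF x y] by blast
    have "\<bar>h s - s\<bar> < r \<and> \<bar>x s - y (h s)\<bar> < r" if "s \<in> {0..t}" for s
      using H[OF that] e by linarith
    then show ?thesis using h by blast
  qed
  have "\<bar>x s - y s\<bar> \<le> \<epsilon>" if \<epsilon>: "\<epsilon> > 0" for \<epsilon>
  proof (cases "s < t")
    case True
    define \<delta> where "\<delta> = \<epsilon> / 3"
    have \<delta>: "\<delta> > 0" "\<epsilon> = \<delta> + \<delta> + \<delta>" using \<epsilon> by (simp_all add: \<delta>_def)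
    have lim: "(x \<longlongrightarrow> x s) (at_right s)" "(y \<longlongrightarrow> y s) (at_right s)"
      using x y s True by (auto simp: cadlag_space_def)
    have "\<forall>\<^sub>F u in at_right s. \<bar>x u - x s\<bar> < \<delta> \<and> \<bar>y u - y s\<bar> < \<delta>"
      using tendstoD[OF lim(1) \<delta>(1)] tendstoD[OF lim(2) \<delta>(1)]
      by eventually_elim (simp add: dist_real_def)
    then obtain b where b: "b > s"
      "\<And>u. s < u \<Longrightarrow> u < b \<Longrightarrow> \<bar>x u - x s\<bar> < \<delta> \<and> \<bar>y u - y s\<bar> < \<delta>"
      unfolding eventually_at_right_field by blast
    define c where "c = min b t"
    define u where "u = (s + c) / 2"
    have c: "s < c" "c \<le> t" "c \<le> b" using b(1) True by (auto simp: c_def)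
    have u: "s < u" "u < c" "u \<in> {0..t}" using c s by (auto simp: u_def)
    define r where "r = min \<delta> ((c - s) / 2)"
    have r: "0 < r" "r \<le> \<delta>" "r \<le> (c - s) / 2" using \<delta>(1) c(1) unfolding r_def by (simp_all only: min.cobounded1 min.cobounded2 min_less_iff_conj half_gt_zero_iff diff_gt_0_iff_gt simp_thms)
    obtain h where h: "\<bar>h u - u\<bar> < r" "\<bar>x u - y (h u)\<bar> < r"
      using ex[OF r(1)] u(3) by blast
    have "u - s = (c - s) / 2" "c - u = (c - s) / 2" by (simp_all add: u_def field_simps)
    then have "s < h u" "h u < c" using h(1) r(3) by linarith+
    then have "\<bar>y (h u) - y s\<bar> < \<delta>" using b(2)[of "h u"] c by simp
    moreover have "\<bar>x u - x s\<bar> < \<delta>" using b(2)[of u] u c by simp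
    moreover have "\<bar>x u - y (h u)\<bar> < \<delta>" using h(2) r(2) by simp
    ultimately show ?thesis using \<delta>(2) by linarith
  next
    case False
    then have "s = t" "0 \<le> t" using s by auto
    moreover obtain h where "h \<in> time_changes t" "\<bar>x s - y (h s)\<bar> < \<epsilon>"
      using ex[OF \<epsilon>] s by blast
    ultimately show ?thesis using time_changes_end[of h t] by auto
  qed
  then have "\<bar>x s - y s\<bar> \<le> 0" by (rule dense_ge)
  then show "x s = y s" by simp
qed

lemma Metric_space_skorokhod: "Metric_space (cadlag_space t) (skorokhod_dist t)"
proof
  fix x y
  show "0 \<le> skorokhod_dist t x y"
    by (cases "x \<in> cadlag_space t \<and> y \<in> cadlag_space t")
      (auto simp: skorokhod_dist_nonneg, auto simp: skorokhod_dist_def)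
  show "skorokhod_dist t x y = skorokhod_dist t y x"
  proof (cases "x \<in> cadlag_space t \<and> y \<in> cadlag_space t")
    case True
    then show ?thesis by (auto intro!: antisym skorokhod_dist_commute_le)
  qed (auto simp: skorokhod_dist_def)
qed (auto simp: skorokhod_dist_refl skorokhod_dist_eq_0_imp skorokhod_dist_triangle)

section \<open>Markov chains on a finite state space\<close>

text \<open>Jump rates \<open>q x y\<close> matter only for \<open>x \<noteq> y\<close>: with \<open>Q\<close> the generator whose off-diagonal part is
  \<open>q\<close>, the equation below is the Kolmogorov backward equation \<open>P' = Q P\<close>, \<open>P(0) = I\<close>.\<close>

definition transition_function ::
  "('s::finite \<Rightarrow> 's \<Rightarrow> real) \<Rightarrow> (real \<Rightarrow> 's \<Rightarrow> 's \<Rightarrow> real) \<Rightarrow> bool" where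
  "transition_function q P \<longleftrightarrow>
     (\<forall>x y. P 0 x y = (if x = y then 1 else 0)) \<and>
     (\<forall>x y. \<forall>s\<ge>0. ((\<lambda>u. P u x y) has_real_derivative
        (\<Sum>z\<in>UNIV. q x z * (P s z y - P s x y))) (at s within {0..}))"

text \<open>All sample paths are right-continuous step functions with left limits, so that they
  have finitely many jumps in compact time intervals.\<close>

definition markov_chain ::
  "'a measure \<Rightarrow> (real \<Rightarrow> 'a \<Rightarrow> 's::finite) \<Rightarrow> ('s \<Rightarrow> real) \<Rightarrow> ('s \<Rightarrow> 's \<Rightarrow> real) \<Rightarrow> bool" where
  "markov_chain M X \<pi> q \<longleftrightarrow>
     (\<forall>s\<ge>0. X s \<in> M \<rightarrow>\<^sub>M count_space UNIV) \<and>
     (\<forall>\<omega>\<in>space M.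
        (\<forall>s\<ge>0. \<forall>\<^sub>F u in at_right s. X u \<omega> = X s \<omega>) \<and>
        (\<forall>s>0. \<exists>x. \<forall>\<^sub>F u in at_left s. X u \<omega> = x)) \<and>
     (\<exists>P. transition_function q P \<and>
        (\<forall>m (\<tau> :: nat \<Rightarrow> real) x. \<tau> 0 = 0 \<and> (\<forall>i<m. \<tau> i < \<tau> (Suc i)) \<longrightarrow>
           measure M {\<omega>\<in>space M. \<forall>i\<le>m. X (\<tau> i) \<omega> = x i} =
             \<pi> (x 0) * (\<Prod>i<m. P (\<tau> (Suc i) - \<tau> i) (x i) (x (Suc i)))))"

section \<open>The dynamic random intersection graph\<close>

datatype group_state = ON | OFF

lemma UNIV_group_state: "(UNIV :: group_state set) = {ON, OFF}"
  using group_state.exhaust by auto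

instance group_state :: finite
  by standard (simp add: UNIV_group_state)

definition groups :: "nat \<Rightarrow> nat set set" where
  "groups n = {a. a \<subseteq> {1..n} \<and> card a \<ge> 2}"

text \<open>The factor \<open>fact (card a) * pmf p (card a)\<close> is \<open>f(\<bar>a\<bar>)\<close>, and the sum is \<open>\<ell>\<^sub>n\<close>.\<close>

definition off_rate :: "nat \<Rightarrow> (nat \<Rightarrow> real) \<Rightarrow> nat pmf \<Rightarrow> nat set \<Rightarrow> real" where
  "off_rate n w p a =
     fact (card a) * pmf p (card a) * (\<Prod>i\<in>a. w i) / (\<Sum>i\<in>{1..n}. w i) ^ (card a - 1)"

fun group_rates :: "real \<Rightarrow> group_state \<Rightarrow> group_state \<Rightarrow> real" where
  "group_rates r ON OFF = 1"
| "group_rates r OFF ON = r"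
| "group_rates r ON ON = 0"
| "group_rates r OFF OFF = 0"

fun group_stationary :: "real \<Rightarrow> group_state \<Rightarrow> real" where
  "group_stationary r ON = r / (1 + r)"
| "group_stationary r OFF = 1 / (1 + r)"

text \<open>\<open>Y a s\<close> is the state of the group \<open>a\<close> at time \<open>s\<close>.\<close>

definition group_dynamics ::
  "nat \<Rightarrow> (nat \<Rightarrow> real) \<Rightarrow> nat pmf \<Rightarrow> 'a measure \<Rightarrow> (nat set \<Rightarrow> real \<Rightarrow> 'a \<Rightarrow> group_state) \<Rightarrow> bool" where
  "group_dynamics n w p M Y \<longleftrightarrow>
     prob_space M \<and>
     (\<forall>a\<in>groups n. markov_chain M (Y a)
        (group_stationary (off_rate n w p a)) (group_rates (off_rate n w p a))) \<and>
     prob_space.indep_vars M (\<lambda>_. \<Pi>\<^sub>M s\<in>{0..}. count_space UNIV) (\<lambda>a \<omega>. \<lambda>s\<in>{0..}. Y a s \<omega>) (groups n)"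

definition drig_edges ::
  "nat \<Rightarrow> (nat set \<Rightarrow> real \<Rightarrow> 'a \<Rightarrow> group_state) \<Rightarrow> real \<Rightarrow> 'a \<Rightarrow> nat \<Rightarrow> nat \<Rightarrow> nat" where
  "drig_edges n Y s \<omega> i j = card {a \<in> groups n. i \<in> a \<and> j \<in> a \<and> Y a s \<omega> = ON}"

definition drig_degree ::
  "nat \<Rightarrow> (nat set \<Rightarrow> real \<Rightarrow> 'a \<Rightarrow> group_state) \<Rightarrow> real \<Rightarrow> 'a \<Rightarrow> nat \<Rightarrow> nat" where
  "drig_degree n Y s \<omega> i = (\<Sum>j\<in>{1..n} - {i}. drig_edges n Y s \<omega> i j)"

lemma finite_groups: "finite (groups n)"
  by (rule finite_subset[of _ "Pow {1..n}"]) (auto simp: groups_def)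

lemma drig_degree_eq:
  "drig_degree n Y s \<omega> i =
     (\<Sum>a\<in>{a \<in> groups n. i \<in> a}. (card a - 1) * of_bool (Y a s \<omega> = ON))"
proof -
  let ?G = "{a \<in> groups n. i \<in> a}"
  have fin: "finite ?G" using finite_groups by simp
  have "drig_degree n Y s \<omega> i =
      (\<Sum>j\<in>{1..n} - {i}. \<Sum>a\<in>?G. of_bool (j \<in> a \<and> Y a s \<omega> = ON))"
    unfolding drig_degree_def drig_edges_def
  proof (intro sum.cong refl)
    fix j
    have "{a \<in> groups n. i \<in> a \<and> j \<in> a \<and> Y a s \<omega> = ON} = ?G \<inter> {a. j \<in> a \<and> Y a s \<omega> = ON}" by auto
    then show "card {a \<in> groups n. i \<in> a \<and> j \<in> a \<and> Y a s \<omega> = ON} =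
        (\<Sum>a\<in>?G. of_bool (j \<in> a \<and> Y a s \<omega> = ON))"
      using fin by (simp add: sum_of_bool_eq)
  qed
  also have "\<dots> = (\<Sum>a\<in>?G. \<Sum>j\<in>{1..n} - {i}. of_bool (j \<in> a \<and> Y a s \<omega> = ON))"
    by (rule sum.swap)
  also have "\<dots> = (\<Sum>a\<in>?G. (card a - 1) * of_bool (Y a s \<omega> = ON))"
  proof (intro sum.cong refl)
    fix a assume a: "a \<in> ?G"
    then have "({1..n} - {i}) \<inter> {j. j \<in> a} = a - {i}" by (auto simp: groups_def)
    moreover have "card (a - {i}) = card a - 1" using a by simp
    ultimately have "(\<Sum>j\<in>{1..n} - {i}. of_bool (j \<in> a)) = card a - 1"
      by (simp add: sum_of_bool_eq)
    then show "(\<Sum>j\<in>{1..n} - {i}. of_bool (j \<in> a \<and> Y a s \<omega> = ON)) =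
        (card a - 1) * of_bool (Y a s \<omega> = ON)"
      by (simp only: of_bool_conj sum_distrib_right[symmetric])
  qed
  finally show ?thesis .
qed

section \<open>The root neighbourhood of the limiting tree\<close>

text \<open>A law of marks \<open>(t\<^sub>O\<^sub>N, t\<^sub>O\<^sub>F\<^sub>F)\<close> is concentrated on \<open>0 \<le> t\<^sub>O\<^sub>N \<le> t\<close>, \<open>t\<^sub>O\<^sub>N \<le> t\<^sub>O\<^sub>F\<^sub>F\<close>,
  which is the domain on which the distribution function is given; together they determine the law.\<close>

definition mark_law :: "real \<Rightarrow> (real \<times> real) measure \<Rightarrow> bool" where
  "mark_law t \<nu> \<longleftrightarrow>
     prob_space \<nu> \<and> sets \<nu> = sets borel \<and>
     (AE (u, v) in \<nu>. 0 \<le> u \<and> u \<le> t \<and> u \<le> v) \<and>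
     (\<forall>s1\<in>{0..t}. \<forall>s2\<ge>s1. measure \<nu> ({..s1} \<times> {..s2}) = (1 - exp (- s2 + s1) + s1) / (1 + t))"

text \<open>An outcome \<open>(N, c)\<close> consists of the number \<open>N\<close> of children of the root and of the sizes and
  marks \<open>c i = (k, (t\<^sub>O\<^sub>N, t\<^sub>O\<^sub>F\<^sub>F))\<close> of an infinite supply of groups, of which those with \<open>i < N\<close>
  are the children. The count \<open>C\<^sub>k\<^sup>s(o)\<close> is \<open>root_groups k s\<close>.\<close>

definition root_law ::
  "nat pmf \<Rightarrow> nat pmf \<Rightarrow> (real \<times> real) measure \<Rightarrow> (nat \<times> (nat \<Rightarrow> nat \<times> real \<times> real)) measure" where
  "root_law D S \<nu> = measure_pmf D \<Otimes>\<^sub>M (\<Pi>\<^sub>M i\<in>UNIV. measure_pmf S \<Otimes>\<^sub>M \<nu>)"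

definition root_groups :: "nat \<Rightarrow> real \<Rightarrow> nat \<times> (nat \<Rightarrow> nat \<times> real \<times> real) \<Rightarrow> nat" where
  "root_groups k s = (\<lambda>(N, c). card {i. i < N \<and> fst (c i) = k \<and> s \<in> {fst (snd (c i))..<snd (snd (c i))}})"

end

theory Submission
  imports Defs "HOL-Combinatorics.Multiset_Permutations"
begin

text \<open>Only lower bounds are proved. If the limit inferior of \<open>E f(X\<^sub>n)\<close> is at least \<open>E f(Z)\<close> for all
  continuous \<open>f\<close> with \<open>0 \<le> f \<le> 1\<close>, then the same bound for \<open>1 - f\<close> turns it into convergence. A lower
  bound may ignore inconvenient outcomes of the graph: it keeps those in which at most \<open>K\<close> groups at
  the chosen vertex, all of size at most \<open>K\<close>, are ever ON, each during a single interval. The comparison is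
  made with the limit law itself and is uniform in \<open>f\<close>, which takes the place of a tightness argument.

  For a fixed vertex \<open>v\<close> the groups are independent. A group with rate \<open>r\<close> is OFF throughout \<open>[0,t]\<close>
  with probability at least \<open>exp (- (1 + t) r)\<close>, and the law of its ON-interval dominates
  \<open>exp (- (3 + t) r) (1 + t) r \<nu>\<close> (\<open>on_pattern_prob_ge\<close>). Multiplying over the groups gives the weight
  of a configuration of \<open>j\<close> distinct groups (\<open>configuration_prob_ge\<close>). Summed over the groups of given
  sizes, the rates are elementary symmetric polynomials in the vertex weights. For bounded \<open>k\<close> they
  equal \<open>k p\<^sub>k w\<^sub>v\<close> up to a relative error of the order of the largest share \<open>max w / \<ell>\<^sub>n\<close> of a vertex in the
  total weight, which vanishes since the second moments of the weights are bounded. The result is a Poisson weight with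
  parameter \<open>(1 + t) \<mu> w\<^sub>v\<close> times the size-biased law of the sizes times the law \<open>\<nu>\<close> of the marks
  (\<open>vertex_profile_expectation_ge\<close>). Averaging over \<open>v\<close> turns it into the mixed Poisson law.

  Path space enters only through sampling: a cadlag path that is sampled on a grid of mesh \<open>t / m\<close>
  converges to the path in the \<open>J\<^sub>1\<close> topology (\<open>sampled_path_tendsto\<close>). All comparisons are therefore
  made for the patterns of grid points at which a group is ON, which are finite objects with explicit
  probabilities. The error bounds depend on \<open>m\<close> only through a term of order \<open>1 / m\<close>, so that \<open>m\<close> is sent to infinity
  before \<open>n\<close>. Sampling also shows that the processes are Borel measurable
  (\<open>measurable_nat_process\<close>).\<close>

section \<open>Sampling a path on a grid\<close>

definition grid_point :: "real \<Rightarrow> nat \<Rightarrow> nat \<Rightarrow> real" where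
  "grid_point t m i = real i * t / real m"

definition grid_index :: "real \<Rightarrow> nat \<Rightarrow> real \<Rightarrow> nat" where
  "grid_index t m s = nat \<lfloor>real m * s / t\<rfloor>"

definition grid_ceiling :: "real \<Rightarrow> nat \<Rightarrow> real \<Rightarrow> real" where
  "grid_ceiling t m s = of_int \<lceil>real m * s / t\<rceil> * t / real m"

definition sampled_path :: "real \<Rightarrow> nat \<Rightarrow> (nat \<Rightarrow> real) \<Rightarrow> real \<Rightarrow> real" where
  "sampled_path t m c = (\<lambda>s\<in>{0..t}. c (grid_index t m s))"

lemma grid_index_le:
  assumes "0 < t" "s \<le> t"
  shows "grid_index t m s \<le> m"
proof -
  have "real m * s / t \<le> real m"
    using assms by (simp add: divide_le_eq mult_left_mono)
  then have "\<lfloor>real m * s / t\<rfloor> \<le> int m" by linarith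
  then show ?thesis by (simp add: grid_index_def)
qed

lemma grid_point_mem:
  assumes "0 < t" "i \<le> m"
  shows "grid_point t m i \<in> {0..t}"
  using assms by (cases "m = 0") (auto simp: grid_point_def divide_le_eq mult.commute)

lemma piecewise_constant_cadlag:
  fixes c :: "real \<Rightarrow> real"
  assumes "\<And>s. s \<in> {0..<t} \<Longrightarrow> \<forall>\<^sub>F u in at_right s. c u = c s"
    and "\<And>s. s \<in> {0<..t} \<Longrightarrow> \<exists>x. \<forall>\<^sub>F u in at_left s. c u = x"
  shows "(\<lambda>s\<in>{0..t}. c s) \<in> cadlag_space t"
  unfolding cadlag_space_def
proof (intro CollectI conjI ballI)
  fix s assume s: "s \<in> {0..<t}"
  have "\<forall>\<^sub>F u in at_right s. u \<in> {s<..<t}"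
    using s by (auto simp: eventually_at_right_field)
  then have "\<forall>\<^sub>F u in at_right s. restrict c {0..t} u = restrict c {0..t} s"
    using assms(1)[OF s] by eventually_elim (use s in auto)
  then show "(restrict c {0..t} \<longlongrightarrow> restrict c {0..t} s) (at_right s)"
    by (rule tendsto_eventually)
next
  fix s assume s: "s \<in> {0<..t}"
  then obtain x where x: "\<forall>\<^sub>F u in at_left s. c u = x" using assms(2) by blast
  have "\<forall>\<^sub>F u in at_left s. u \<in> {0<..<s}"
    using s by (auto simp: eventually_at_left_field)
  then have "\<forall>\<^sub>F u in at_left s. restrict c {0..t} u = x"
    using x by eventually_elim (use s in auto)
  then show "\<exists>l. (restrict c {0..t} \<longlongrightarrow> l) (at_left s)"
    by (blast intro: tendsto_eventually)
qed auto

lemma grid_index_right: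
  assumes t: "0 < t"
  shows "\<forall>\<^sub>F u in at_right s. grid_index t m u = grid_index t m s"
proof (cases "m = 0")
  case False
  define b where "b = (of_int \<lfloor>real m * s / t\<rfloor> + 1) * t / real m"
  have "real m * s / t < of_int \<lfloor>real m * s / t\<rfloor> + 1" by linarith
  then have "s < b" using False t by (simp add: b_def field_simps)
  moreover have "grid_index t m u = grid_index t m s" if "s < u" "u < b" for u
  proof -
    have "real m * s / t \<le> real m * u / t" using that t by (simp add: divide_right_mono mult_left_mono)
    moreover have "real m * u / t < of_int \<lfloor>real m * s / t\<rfloor> + 1"
      using that(2) False t by (simp add: b_def field_simps)
    ultimately have "\<lfloor>real m * u / t\<rfloor> = \<lfloor>real m * s / t\<rfloor>" by linarith
    then show ?thesis by (simp add: grid_index_def)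
  qed
  ultimately show ?thesis unfolding eventually_at_right_field by blast
qed (simp add: grid_index_def)

lemma grid_index_left:
  assumes t: "0 < t"
  shows "\<exists>i. \<forall>\<^sub>F u in at_left s. grid_index t m u = i"
proof (cases "m = 0")
  case False
  define k where "k = \<lceil>real m * s / t\<rceil> - 1"
  define b where "b = of_int k * t / real m"
  have "of_int k < real m * s / t" unfolding k_def by linarith
  then have "b < s" using False t by (simp add: b_def field_simps)
  moreover have "grid_index t m u = nat k" if "b < u" "u < s" for u
  proof -
    have "real m * u / t < real m * s / t" using that t False by (simp add: divide_strict_right_mono)
    moreover have "of_int k < real m * u / t"
      using that(1) False t by (simp add: b_def field_simps)
    ultimately have "\<lfloor>real m * u / t\<rfloor> = k" unfolding k_def by linarith
    then show ?thesis by (simp add: grid_index_def)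
  qed
  ultimately show ?thesis unfolding eventually_at_left_field by blast
qed (simp add: grid_index_def)

lemma sampled_path_cadlag:
  assumes "0 < t"
  shows "sampled_path t m c \<in> cadlag_space t"
  unfolding sampled_path_def
proof (rule piecewise_constant_cadlag)
  fix s show "\<forall>\<^sub>F u in at_right s. c (grid_index t m u) = c (grid_index t m s)"
    using grid_index_right[OF assms, of m s] by (rule eventually_mono) simp
  obtain i where "\<forall>\<^sub>F u in at_left s. grid_index t m u = i" using grid_index_left[OF assms] by blast
  then have "\<forall>\<^sub>F u in at_left s. c (grid_index t m u) = c i" by (rule eventually_mono) simp
  then show "\<exists>x. \<forall>\<^sub>F u in at_left s. c (grid_index t m u) = x" by blast
qed

lemma grid_ceiling_bounds:
  assumes "0 < t" "0 < m"
  shows "s \<le> grid_ceiling t m s" "grid_ceiling t m s \<le> s + t / real m"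
proof -
  define k where "k = \<lceil>real m * s / t\<rceil>"
  have "real m * s / t \<le> of_int k" "of_int k \<le> real m * s / t + 1"
    unfolding k_def by linarith+
  then show "s \<le> grid_ceiling t m s" "grid_ceiling t m s \<le> s + t / real m"
    using assms unfolding grid_ceiling_def k_def[symmetric] by (simp_all add: field_simps)
qed

lemma grid_ceiling_ends:
  assumes "0 < t" "0 < m"
  shows "grid_ceiling t m 0 = 0" "grid_ceiling t m t = t"
  using assms by (simp_all add: grid_ceiling_def)

text \<open>This is why interval ends are moved to the right: a grid point lies in \<open>[a,b)\<close> exactly if it lies
  between the rounded ends, so between these the sampled path shows only values that \<open>x\<close> takes on
  \<open>[a,b)\<close>.\<close>

lemma grid_point_grid_index_between:
  assumes t: "0 < t" and m: "0 < m" and a: "0 \<le> a"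
    and u: "grid_ceiling t m a \<le> u" "u < grid_ceiling t m b"
  shows "grid_point t m (grid_index t m u) \<in> {a..<b}"
proof -
  define k where "k = \<lfloor>real m * u / t\<rfloor>"
  have "of_int \<lceil>real m * a / t\<rceil> \<le> real m * u / t" "real m * u / t < of_int \<lceil>real m * b / t\<rceil>"
    using u t m by (simp_all add: grid_ceiling_def field_simps)
  then have k: "\<lceil>real m * a / t\<rceil> \<le> k" "k < \<lceil>real m * b / t\<rceil>" unfolding k_def by linarith+
  have "0 \<le> real m * a / t" using a t by simp
  then have "0 \<le> k" using k(1) by linarith
  then have eq: "grid_point t m (grid_index t m u) = of_int k * t / real m"
    by (simp add: grid_point_def grid_index_def k_def)
  have "real m * a / t \<le> of_int k" "of_int k < real m * b / t" using k by linarith+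
  then show ?thesis unfolding eq using t m by (simp add: field_simps)
qed

text \<open>A time change from \<open>[a,b]\<close> to the interval between the grid points that follow \<open>a\<close> and \<open>b\<close>, along
  which \<open>x\<close> is close to its sampled version. The last clause leaves out \<open>b\<close>, where \<open>x\<close> may jump: this
  point belongs to the next interval, to which the time change is glued.\<close>

definition grid_matching :: "real \<Rightarrow> nat \<Rightarrow> real \<Rightarrow> (real \<Rightarrow> real) \<Rightarrow> real \<Rightarrow> real \<Rightarrow> (real \<Rightarrow> real) \<Rightarrow> bool" where
  "grid_matching t m \<epsilon> x a b h \<longleftrightarrow>
     strict_mono_on {a..b} h \<and> continuous_on {a..b} h \<and>
     h a = grid_ceiling t m a \<and> h b = grid_ceiling t m b \<and>
     (\<forall>s\<in>{a..b}. \<bar>h s - s\<bar> \<le> t / real m) \<and>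
     (\<forall>s\<in>{a..<b}. \<bar>x s - x (grid_point t m (grid_index t m (h s)))\<bar> \<le> \<epsilon>)"

text \<open>An affine time change suffices. Its displacement is a convex combination of the displacements of
  the two ends, which are at most one mesh width.\<close>

lemma grid_matching_small_oscillation:
  assumes t: "0 < t" and m: "0 < m" and a: "0 \<le> a" and ab: "a \<le> b" and gap: "a < b \<Longrightarrow> t / real m < b - a"
    and osc: "\<And>s u. s \<in> {a..<b} \<Longrightarrow> u \<in> {a..<b} \<Longrightarrow> \<bar>x s - x u\<bar> \<le> \<epsilon>"
  shows "\<exists>h. grid_matching t m \<epsilon> x a b h"
proof (cases "a = b")
  case True
  have "strict_mono_on {b..b} (\<lambda>_. grid_ceiling t m b)" by (auto intro: strict_mono_onI)
  moreover have "\<bar>grid_ceiling t m b - b\<bar> \<le> t / real m" using grid_ceiling_bounds[OF t m, of b] by linarith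
  ultimately show ?thesis
    unfolding grid_matching_def using True by (intro exI[of _ "\<lambda>_. grid_ceiling t m b"]) auto
next
  case False
  then have ab: "a < b" using ab by simp
  define A B where "A = grid_ceiling t m a" and "B = grid_ceiling t m b"
  have AB: "a \<le> A" "A \<le> a + t / real m" "b \<le> B" "B \<le> b + t / real m"
    unfolding A_def B_def using grid_ceiling_bounds[OF t m] by auto
  have "A < B" using AB gap[OF ab] by linarith
  define h where "h s = A + (s - a) / (b - a) * (B - A)" for s
  have mono: "h s < h u" if "s < u" for s u
    using that \<open>A < B\<close> ab by (simp add: h_def divide_strict_right_mono)
  have h: "h a = A" "h b = B" using ab by (simp_all add: h_def)
  have "\<bar>h s - s\<bar> \<le> t / real m" if s: "s \<in> {a..b}" for s
  proof -
    define \<theta> where "\<theta> = (s - a) / (b - a)"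
    have \<theta>: "0 \<le> \<theta>" "\<theta> \<le> 1" using s ab by (auto simp: \<theta>_def)
    have "s = a + \<theta> * (b - a)" using ab by (simp add: \<theta>_def)
    then have "h s - s = (1 - \<theta>) * (A - a) + \<theta> * (B - b)"
      unfolding h_def \<theta>_def[symmetric] by (simp add: algebra_simps)
    moreover have "(1 - \<theta>) * (A - a) + \<theta> * (B - b) \<le> (1 - \<theta>) * (t / real m) + \<theta> * (t / real m)"
      using \<theta> AB by (intro add_mono mult_left_mono) auto
    moreover have "0 \<le> (1 - \<theta>) * (A - a) + \<theta> * (B - b)"
      using \<theta> AB by simp
    moreover have "(1 - \<theta>) * (t / real m) + \<theta> * (t / real m) = t / real m"
      by (metis diff_add_cancel distrib_right mult_1)
    ultimately show ?thesis by linarith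
  qed
  moreover have "\<bar>x s - x (grid_point t m (grid_index t m (h s)))\<bar> \<le> \<epsilon>" if s: "s \<in> {a..<b}" for s
  proof (rule osc[OF s], rule grid_point_grid_index_between[OF t m a])
    show "grid_ceiling t m a \<le> h s"
      using mono[of a s] s h A_def by (cases "a = s") auto
    show "h s < grid_ceiling t m b" using mono[of s b] s h B_def by auto
  qed
  moreover have "strict_mono_on {a..b} h" using mono by (auto intro: strict_mono_onI)
  moreover have "continuous_on {a..b} h" unfolding h_def by (intro continuous_intros) (use ab in auto)
  ultimately have "grid_matching t m \<epsilon> x a b h" unfolding grid_matching_def using h A_def B_def by auto
  then show ?thesis by blast
qed

lemma grid_matching_glue:
  assumes h1: "grid_matching t m \<epsilon> x a b h1" and h2: "grid_matching t m \<epsilon> x b c h2"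
    and ab: "a \<le> b" and bc: "b \<le> c"
  shows "\<exists>h. grid_matching t m \<epsilon> x a c h"
proof -
  define h where "h s = (if s \<le> b then h1 s else h2 s)" for s
  note m1 = h1[unfolded grid_matching_def] and m2 = h2[unfolded grid_matching_def]
  have eq: "h1 b = h2 b" using m1 m2 by simp
  have U: "{a..c} = {a..b} \<union> {b..c}" using ab bc by auto
  have "continuous_on ({a..b} \<union> {b..c}) h"
    unfolding h_def by (rule continuous_on_If) (use m1 m2 eq in auto)
  then have "continuous_on {a..c} h" by (simp only: U)
  moreover have "strict_mono_on {a..c} h"
  proof (rule strict_mono_onI)
    fix r s assume rs: "r \<in> {a..c}" "s \<in> {a..c}" "r < s"
    have s1: "strict_mono_on {a..b} h1" and s2: "strict_mono_on {b..c} h2" using m1 m2 by auto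
    consider "s \<le> b" | "b < r" | "r \<le> b" "b < s" by linarith
    then show "h r < h s"
    proof cases
      case 1 then show ?thesis using strict_mono_onD[OF s1, of r s] rs by (simp add: h_def)
    next
      case 2 then show ?thesis using strict_mono_onD[OF s2, of r s] rs by (simp add: h_def)
    next
      case 3
      then have "h1 r \<le> h1 b" using strict_mono_onD[OF s1, of r b] rs by (cases "r = b") auto
      moreover have "h2 b < h2 s" using strict_mono_onD[OF s2, of b s] rs 3 by auto
      ultimately show ?thesis using 3 eq by (simp add: h_def)
    qed
  qed
  moreover have "h a = grid_ceiling t m a" "h c = grid_ceiling t m c"
    using m1 m2 ab bc eq by (auto simp: h_def dest: antisym)
  moreover have "\<bar>h s - s\<bar> \<le> t / real m" if "s \<in> {a..c}" for s
    using m1 m2 that by (auto simp: h_def)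
  moreover have "\<bar>x s - x (grid_point t m (grid_index t m (h s)))\<bar> \<le> \<epsilon>" if "s \<in> {a..<c}" for s
  proof -
    have "h s = h2 s" if "b \<le> s" using eq that by (auto simp: h_def)
    moreover have "h s = h1 s" if "s < b" using that by (simp add: h_def)
    ultimately show ?thesis using m1 m2 that by (cases "s < b") auto
  qed
  ultimately have "grid_matching t m \<epsilon> x a c h" unfolding grid_matching_def by blast
  then show ?thesis by blast
qed

lemma eventually_grid_gap:
  fixes t d :: real
  assumes "0 < d"
  shows "\<forall>\<^sub>F m in sequentially. 0 < m \<and> t / real m < d"
proof -
  have "(\<lambda>m. t / real m) \<longlonglongrightarrow> 0" by (rule lim_const_over_n)
  then have "\<forall>\<^sub>F m in sequentially. t / real m < d" by (rule order_tendstoD) (use assms in simp)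
  then show ?thesis using eventually_gt_at_top[of 0] by eventually_elim simp
qed

text \<open>Bisection takes the place of a partition into finitely many intervals of small oscillation: the
  one-sided limits at a point \<open>y\<close> make the oscillation small on both sides of \<open>y\<close>, and the time changes
  of the two sides are glued at \<open>y\<close>.\<close>

lemma eventually_grid_matching:
  assumes t: "0 < t" and x: "x \<in> cadlag_space t" and \<epsilon>: "0 < \<epsilon>"
  shows "\<forall>\<^sub>F m in sequentially. \<exists>h. grid_matching t m \<epsilon> x 0 t h"
proof -
  define P where "P a b \<longleftrightarrow> (0 \<le> a \<and> a \<le> b \<and> b \<le> t \<longrightarrow>
    (\<forall>\<^sub>F m in sequentially. \<exists>h. grid_matching t m \<epsilon> x a b h))" for a b
  have base: "P a b" if osc: "0 \<le> a \<Longrightarrow> b \<le> t \<Longrightarrow>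
      \<forall>s\<in>{a..<b}. \<forall>u\<in>{a..<b}. \<bar>x s - x u\<bar> \<le> \<epsilon>" for a b
    unfolding P_def
  proof
    assume ab: "0 \<le> a \<and> a \<le> b \<and> b \<le> t"
    have "\<forall>\<^sub>F m in sequentially. 0 < m \<and> (a < b \<longrightarrow> t / real m < b - a)"
    proof (cases "a < b")
      case True then show ?thesis using eventually_grid_gap[of "b - a" t] by simp
    qed (simp add: eventually_gt_at_top)
    then show "\<forall>\<^sub>F m in sequentially. \<exists>h. grid_matching t m \<epsilon> x a b h"
      by eventually_elim (intro grid_matching_small_oscillation[OF t], use ab osc in auto)
  qed
  have trans: "P a c" if "P a b" "P b c" "a \<le> b" "b \<le> c" for a b c
    unfolding P_def
  proof
    assume "0 \<le> a \<and> a \<le> c \<and> c \<le> t"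
    then have "\<forall>\<^sub>F m in sequentially. \<exists>h. grid_matching t m \<epsilon> x a b h"
      "\<forall>\<^sub>F m in sequentially. \<exists>h. grid_matching t m \<epsilon> x b c h"
      using that by (auto simp: P_def)
    then show "\<forall>\<^sub>F m in sequentially. \<exists>h. grid_matching t m \<epsilon> x a c h"
      by eventually_elim (use grid_matching_glue that in blast)
  qed
  have "P 0 t"
  proof (rule Bolzano)
    show "0 \<le> t" using t by simp
    show "P a c" if "P a b" "P b c" "a \<le> b" "b \<le> c" for a b c using trans that .
    fix y assume y: "0 \<le> y" "y \<le> t"
    have "\<exists>d>0. \<forall>a\<ge>0. y - a < d \<longrightarrow> (\<forall>s\<in>{a..<y}. \<forall>u\<in>{a..<y}. \<bar>x s - x u\<bar> \<le> \<epsilon>)"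
    proof (cases "y = 0")
      case False
      then have "\<exists>l. (x \<longlongrightarrow> l) (at_left y)" using x y by (simp add: cadlag_space_def)
      then obtain l where l: "(x \<longlongrightarrow> l) (at_left y)" by blast
      have "\<forall>\<^sub>F u in at_left y. \<bar>x u - l\<bar> < \<epsilon> / 2"
        using tendstoD[OF l half_gt_zero[OF \<epsilon>]] by (simp only: dist_real_def)
      then obtain b where b: "b < y" "\<And>u. b < u \<Longrightarrow> u < y \<Longrightarrow> \<bar>x u - l\<bar> < \<epsilon> / 2"
        by (auto simp: eventually_at_left_field)
      have "\<bar>x s - x u\<bar> \<le> \<epsilon>" if "y - a < y - b" "s \<in> {a..<y}" "u \<in> {a..<y}" for a s u
      proof -
        have "\<bar>x s - l\<bar> < \<epsilon> / 2" "\<bar>x u - l\<bar> < \<epsilon> / 2" using b(2) that by simp_all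
        then show ?thesis by linarith
      qed
      then show ?thesis using b(1) by (intro exI[of _ "y - b"]) auto
    qed (auto intro: exI[of _ 1])
    then obtain d1 where d1: "d1 > 0" "\<And>a. 0 \<le> a \<Longrightarrow> y - a < d1 \<Longrightarrow> \<forall>s\<in>{a..<y}. \<forall>u\<in>{a..<y}. \<bar>x s - x u\<bar> \<le> \<epsilon>"
      by blast
    have "\<exists>d>0. \<forall>b\<le>t. b - y < d \<longrightarrow> (\<forall>s\<in>{y..<b}. \<forall>u\<in>{y..<b}. \<bar>x s - x u\<bar> \<le> \<epsilon>)"
    proof (cases "y = t")
      case False
      then have r: "(x \<longlongrightarrow> x y) (at_right y)" using x y by (auto simp: cadlag_space_def)
      have "\<forall>\<^sub>F u in at_right y. \<bar>x u - x y\<bar> < \<epsilon> / 2"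
        using tendstoD[OF r half_gt_zero[OF \<epsilon>]] by (simp only: dist_real_def)
      then obtain b where b: "y < b" "\<And>u. y < u \<Longrightarrow> u < b \<Longrightarrow> \<bar>x u - x y\<bar> < \<epsilon> / 2"
        by (auto simp: eventually_at_right_field)
      have b': "\<bar>x u - x y\<bar> < \<epsilon> / 2" if "y \<le> u" "u < b" for u
        using b(2)[of u] that \<epsilon> by (cases "u = y") auto
      have "\<bar>x s - x u\<bar> \<le> \<epsilon>" if "c - y < b - y" "s \<in> {y..<c}" "u \<in> {y..<c}" for c s u
      proof -
        have "\<bar>x s - x y\<bar> < \<epsilon> / 2" "\<bar>x u - x y\<bar> < \<epsilon> / 2" using b' that by simp_all
        then show ?thesis by linarith
      qed
      then show ?thesis using b(1) by (intro exI[of _ "b - y"]) auto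
    qed (auto intro: exI[of _ 1])
    then obtain d2 where d2: "d2 > 0" "\<And>b. b \<le> t \<Longrightarrow> b - y < d2 \<Longrightarrow> \<forall>s\<in>{y..<b}. \<forall>u\<in>{y..<b}. \<bar>x s - x u\<bar> \<le> \<epsilon>"
      by blast
    have "P a b" if "a \<le> y \<and> y \<le> b \<and> b - a < min d1 d2" for a b
      by (rule trans[of a y b]; (rule base)?) (use that d1(2)[of a] d2(2)[of b] in auto)
    then show "\<exists>d>0. \<forall>a b. a \<le> y \<and> y \<le> b \<and> b - a < d \<longrightarrow> P a b"
      using d1(1) d2(1) by (intro exI[of _ "min d1 d2"]) auto
  qed
  then show ?thesis using t by (simp add: P_def)
qed

text \<open>Sampling delays each jump to the next grid point. The convergence is not uniform, but the delay is
  undone by a time change that is uniformly close to the identity.\<close>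

lemma sampled_path_tendsto:
  assumes t: "0 < t" and x: "x \<in> cadlag_space t"
  shows "(\<lambda>m. skorokhod_dist t (sampled_path t m (\<lambda>i. x (grid_point t m i))) x) \<longlonglongrightarrow> 0"
proof (rule tendstoI)
  interpret Metric_space "cadlag_space t" "skorokhod_dist t" by (rule Metric_space_skorokhod)
  fix r :: real assume r: "0 < r"
  then have "0 < r / 2" by simp
  from eventually_grid_matching[OF t x this] eventually_grid_gap[OF this, of t]
  show "\<forall>\<^sub>F m in sequentially.
      dist (skorokhod_dist t (sampled_path t m (\<lambda>i. x (grid_point t m i))) x) 0 < r"
  proof eventually_elim
    case (elim m)
    define y where "y = sampled_path t m (\<lambda>i. x (grid_point t m i))"
    have y: "y \<in> cadlag_space t" unfolding y_def by (rule sampled_path_cadlag[OF t])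
    obtain h where h: "grid_matching t m (r / 2) x 0 t h" using elim by blast
    note H = h[unfolded grid_matching_def]
    have m: "0 < m" using elim by simp
    have ends: "h 0 = 0" "h t = t" using H grid_ceiling_ends[OF t m] by auto
    have im: "h ` {0..t} = {0..t}"
    proof
      show "h ` {0..t} \<subseteq> {0..t}"
      proof
        fix u assume "u \<in> h ` {0..t}"
        then obtain s where s: "s \<in> {0..t}" "u = h s" by blast
        have sm: "strict_mono_on {0..t} h" using H by simp
        have "h 0 \<le> h s" using strict_mono_onD[OF sm, of 0 s] s t by (cases "s = 0") auto
        moreover have "h s \<le> h t" using strict_mono_onD[OF sm, of s t] s t by (cases "s = t") auto
        ultimately show "u \<in> {0..t}" using ends s by auto
      qed
      show "{0..t} \<subseteq> h ` {0..t}"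
      proof
        fix u assume "u \<in> {0..t}"
        then show "u \<in> h ` {0..t}" using IVT'[of h 0 u t] ends t H by auto
      qed
    qed
    have "h \<in> time_changes t" using H im by (simp add: time_changes_def)
    moreover have "\<bar>h s - s\<bar> \<le> r / 2 \<and> \<bar>x s - y (h s)\<bar> \<le> r / 2" if s: "s \<in> {0..t}" for s
    proof -
      have "h s \<in> {0..t}" using im s by blast
      then have "y (h s) = x (grid_point t m (grid_index t m (h s)))"
        by (simp add: y_def sampled_path_def)
      moreover have "\<bar>x s - x (grid_point t m (grid_index t m (h s)))\<bar> \<le> r / 2"
      proof (cases "s = t")
        case True
        then show ?thesis using ends m t r by (simp add: grid_index_def grid_point_def)
      qed (use H s in auto)
      moreover have "\<bar>h s - s\<bar> \<le> t / real m" using H s by blast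
      moreover have "t / real m < r / 2" using elim by simp
      ultimately show ?thesis by linarith
    qed
    ultimately have "skorokhod_dist t x y < r"
      using r by (intro skorokhod_dist_lessI[OF x y, of "r / 2"]) auto
    then show ?case using nonneg[of x y] commute[of x y] by (simp add: y_def)
  qed
qed

lemma topspace_skorokhod: "topspace (skorokhod_topology t) = cadlag_space t"
  unfolding skorokhod_topology_def
  using Metric_space.topspace_mtopology[OF Metric_space_skorokhod] .

lemma sampled_path_limit:
  assumes t: "0 < t" and x: "x \<in> cadlag_space t"
    and f: "continuous_map (skorokhod_topology t) euclideanreal f"
  shows "(\<lambda>m. f (sampled_path t m (\<lambda>i. x (grid_point t m i)))) \<longlonglongrightarrow> f x"
proof -
  interpret Metric_space "cadlag_space t" "skorokhod_dist t" by (rule Metric_space_skorokhod)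
  have "limitin mtopology (\<lambda>m. sampled_path t m (\<lambda>i. x (grid_point t m i))) x sequentially"
    unfolding limitin_metric_dist_null
    using sampled_path_tendsto[OF t x] x sampled_path_cadlag[OF t] by simp
  from continuous_map_limit[OF f[unfolded skorokhod_topology_def] this]
  show ?thesis by (simp add: o_def)
qed

lemma continuous_map_borel_sigma:
  assumes "continuous_map T euclideanreal f"
  shows "f \<in> borel_sigma T \<rightarrow>\<^sub>M borel"
proof (rule borel_measurableI)
  fix S :: "real set" assume "open S"
  then have "openin T {x \<in> topspace T. f x \<in> S}"
    using assms by (auto simp: continuous_map_def)
  moreover have "f -` S \<inter> space (borel_sigma T) = {x \<in> topspace T. f x \<in> S}"
    using openin_subset[of T] by (auto simp: borel_sigma_def space_measure_of_conv)
  ultimately show "f -` S \<inter> space (borel_sigma T) \<in> sets (borel_sigma T)"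
    unfolding borel_sigma_def using openin_subset[of T]
    by (subst sets_measure_of) auto
qed

text \<open>A sampled path of a process with natural values has countably many possible values, so that every
  set of paths has a measurable preimage under it. A path lies in a closed set exactly if its
  sampled versions finally enter each neighbourhood of that set.\<close>

lemma measurable_nat_process:
  assumes t: "0 < t"
    and C: "\<And>s. s \<in> {0..t} \<Longrightarrow> C s \<in> M \<rightarrow>\<^sub>M count_space (UNIV :: nat set)"
    and path: "\<And>\<omega>. \<omega> \<in> space M \<Longrightarrow> (\<lambda>s\<in>{0..t}. real (C s \<omega>)) \<in> cadlag_space t"
  shows "(\<lambda>\<omega>. \<lambda>s\<in>{0..t}. real (C s \<omega>)) \<in> M \<rightarrow>\<^sub>M borel_sigma (skorokhod_topology t)"
proof -
  interpret Metric_space "cadlag_space t" "skorokhod_dist t" by (rule Metric_space_skorokhod)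
  define X where "X \<omega> = (\<lambda>s\<in>{0..t}. real (C s \<omega>))" for \<omega>
  define Y where "Y m \<omega> = sampled_path t m (\<lambda>i. X \<omega> (grid_point t m i))" for m \<omega>
  have Xc: "X \<omega> \<in> cadlag_space t" if "\<omega> \<in> space M" for \<omega> using path that by (simp add: X_def)
  have Yc: "Y m \<omega> \<in> cadlag_space t" for m \<omega> unfolding Y_def by (rule sampled_path_cadlag[OF t])
  have YX: "(\<lambda>m. skorokhod_dist t (Y m \<omega>) (X \<omega>)) \<longlonglongrightarrow> 0" if "\<omega> \<in> space M" for \<omega>
    unfolding Y_def using sampled_path_tendsto[OF t Xc[OF that]] .
  \<comment> \<open>A sampled path is determined by finitely many natural numbers.\<close>
  have Ymeas: "{\<omega> \<in> space M. Y m \<omega> \<in> A} \<in> sets M" for m A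
  proof -
    define L where "L \<omega> = map (\<lambda>i. C (grid_point t m i) \<omega>) [0..<Suc m]" for \<omega>
    have L: "length (L \<omega>) = Suc m" "\<And>i. i \<le> m \<Longrightarrow> L \<omega> ! i = C (grid_point t m i) \<omega>" for \<omega>
      unfolding L_def by (simp_all del: upt_Suc add: nth_map_upt)
    have "L \<in> M \<rightarrow>\<^sub>M count_space UNIV"
      unfolding measurable_count_space_eq_countable[OF countableI_type]
    proof (intro conjI ballI)
      fix l :: "nat list"
      have "L -` {l} \<inter> space M =
          (if length l = Suc m then {\<omega> \<in> space M. \<forall>i\<in>{..m}. C (grid_point t m i) \<omega> = l ! i} else {})"
        using L by (auto simp: list_eq_iff_nth_eq less_Suc_eq_le)
      moreover have "{\<omega> \<in> space M. \<forall>i\<in>{..m}. C (grid_point t m i) \<omega> = l ! i} \<in> sets M"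
      proof (rule sets.sets_Collect_finite_All)
        fix i assume "i \<in> {..m}"
        then have [measurable]: "C (grid_point t m i) \<in> M \<rightarrow>\<^sub>M count_space UNIV"
          using C grid_point_mem[OF t] by simp
        show "{\<omega> \<in> space M. C (grid_point t m i) \<omega> = l ! i} \<in> sets M" by measurable
      qed simp
      ultimately show "L -` {l} \<inter> space M \<in> sets M" by simp
    qed simp
    then have "L -` {l. sampled_path t m (\<lambda>i. real (l ! i)) \<in> A} \<inter> space M \<in> sets M"
      by (rule measurable_sets) simp
    moreover have "sampled_path t m (\<lambda>i. real (L \<omega> ! i)) = Y m \<omega>" for \<omega>
    proof (rule ext)
      fix s
      have "L \<omega> ! grid_index t m s = C (grid_point t m (grid_index t m s)) \<omega>" if "s \<le> t"
        using L(2)[OF grid_index_le[OF t that]] .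
      then show "sampled_path t m (\<lambda>i. real (L \<omega> ! i)) s = Y m \<omega> s"
        using grid_point_mem[OF t grid_index_le[OF t, of s m]]
        by (auto simp: sampled_path_def Y_def X_def)
    qed
    ultimately show ?thesis by (simp add: vimage_def Int_def conj_commute)
  qed
  have "X \<in> M \<rightarrow>\<^sub>M borel_sigma (skorokhod_topology t)"
    unfolding borel_sigma_def
  proof (rule measurable_measure_of)
    show "{U. openin (skorokhod_topology t) U} \<subseteq> Pow (topspace (skorokhod_topology t))"
      using openin_subset by auto
    show "X \<in> space M \<rightarrow> topspace (skorokhod_topology t)" using Xc by (simp add: topspace_skorokhod)
    fix U assume "U \<in> {U. openin (skorokhod_topology t) U}"
    then have U: "openin mtopology U" by (simp add: skorokhod_topology_def)
    \<comment> \<open>the open neighbourhoods of the closed set that is the complement of \<open>U\<close>\<close>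
    define V where "V k = {y \<in> cadlag_space t. \<exists>z\<in>cadlag_space t - U. skorokhod_dist t y z < 1 / real (Suc k)}" for k
    have iff: "X \<omega> \<notin> U \<longleftrightarrow> (\<forall>k. \<exists>N. \<forall>m\<ge>N. Y m \<omega> \<in> V k)" if \<omega>: "\<omega> \<in> space M" for \<omega>
    proof
      assume n: "X \<omega> \<notin> U"
      show "\<forall>k. \<exists>N. \<forall>m\<ge>N. Y m \<omega> \<in> V k"
      proof
        fix k
        have "\<forall>\<^sub>F m in sequentially. skorokhod_dist t (Y m \<omega>) (X \<omega>) < 1 / real (Suc k)"
          using order_tendstoD(2)[OF YX[OF \<omega>], of "1 / real (Suc k)"] by simp
        then show "\<exists>N. \<forall>m\<ge>N. Y m \<omega> \<in> V k"
          unfolding eventually_sequentially V_def using Yc Xc[OF \<omega>] n by blast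
      qed
    next
      assume all: "\<forall>k. \<exists>N. \<forall>m\<ge>N. Y m \<omega> \<in> V k"
      show "X \<omega> \<notin> U"
      proof
        assume "X \<omega> \<in> U"
        then obtain r where r: "r > 0" "mball (X \<omega>) r \<subseteq> U" using U openin_mtopology by blast
        obtain k where k: "1 / real (Suc k) < r / 2"
          using reals_Archimedean[of "r / 2"] r by (auto simp: inverse_eq_divide)
        obtain N where N: "\<And>m. m \<ge> N \<Longrightarrow> Y m \<omega> \<in> V k" using all by blast
        have "\<forall>\<^sub>F m in sequentially. skorokhod_dist t (Y m \<omega>) (X \<omega>) < r / 2"
          using order_tendstoD(2)[OF YX[OF \<omega>], of "r / 2"] r by simp
        then have "\<forall>\<^sub>F m in sequentially. skorokhod_dist t (Y m \<omega>) (X \<omega>) < r / 2 \<and> m \<ge> N"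
          using eventually_ge_at_top[of N] by eventually_elim simp
        then obtain m where m: "skorokhod_dist t (Y m \<omega>) (X \<omega>) < r / 2" "m \<ge> N"
          using eventually_happens'[OF sequentially_bot] by blast
        obtain z where z: "z \<in> cadlag_space t - U" "skorokhod_dist t (Y m \<omega>) z < 1 / real (Suc k)"
          using N[OF m(2)] by (auto simp: V_def)
        have "skorokhod_dist t (X \<omega>) z \<le> skorokhod_dist t (X \<omega>) (Y m \<omega>) + skorokhod_dist t (Y m \<omega>) z"
          using triangle Xc[OF \<omega>] Yc z by blast
        then have "skorokhod_dist t (X \<omega>) z < r" using m z(2) k commute[of "X \<omega>" "Y m \<omega>"] by linarith
        then have "z \<in> mball (X \<omega>) r" using Xc[OF \<omega>] z by simp
        then show False using r z by blast
      qed
    qed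
    have "{\<omega> \<in> space M. \<forall>k. \<exists>N. \<forall>m\<ge>N. Y m \<omega> \<in> V k} \<in> sets M"
    proof (intro sets.sets_Collect_countable_All sets.sets_Collect_countable_Ex)
      fix k N m
      have "{\<omega> \<in> space M. m \<ge> N \<longrightarrow> Y m \<omega> \<in> V k} =
          (if m \<ge> N then {\<omega> \<in> space M. Y m \<omega> \<in> V k} else space M)" by auto
      then show "{\<omega> \<in> space M. m \<ge> N \<longrightarrow> Y m \<omega> \<in> V k} \<in> sets M" using Ymeas by simp
    qed
    then have "space M - {\<omega> \<in> space M. \<forall>k. \<exists>N. \<forall>m\<ge>N. Y m \<omega> \<in> V k} \<in> sets M" by blast
    also have "space M - {\<omega> \<in> space M. \<forall>k. \<exists>N. \<forall>m\<ge>N. Y m \<omega> \<in> V k} = X -` U \<inter> space M"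
      using iff by blast
    finally show "X -` U \<inter> space M \<in> sets M" .
  qed
  then show ?thesis by (simp add: X_def[abs_def])
qed

section \<open>Patterns of grid points\<close>

lemma measurable_finite_pattern:
  fixes Q :: "nat \<Rightarrow> 'a \<Rightarrow> bool"
  assumes "\<And>i. i \<le> m \<Longrightarrow> {\<omega> \<in> space M. Q i \<omega>} \<in> sets M"
  shows "(\<lambda>\<omega>. {i \<in> {..m}. Q i \<omega>}) \<in> M \<rightarrow>\<^sub>M count_space UNIV"
proof (rule measurableI)
  fix A :: "nat set set"
  have "(\<lambda>\<omega>. {i \<in> {..m}. Q i \<omega>}) -` A \<inter> space M =
      (\<Union>I\<in>A \<inter> Pow {..m}. {\<omega> \<in> space M. \<forall>i\<in>{..m}. i \<in> I \<longleftrightarrow> Q i \<omega>})"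
    by auto
  moreover have "{\<omega> \<in> space M. \<forall>i\<in>{..m}. i \<in> I \<longleftrightarrow> Q i \<omega>} \<in> sets M" for I
  proof (rule sets.sets_Collect_finite_All)
    fix i assume "i \<in> {..m}"
    then have "{\<omega> \<in> space M. Q i \<omega>} \<in> sets M" using assms by simp
    moreover from this have "{\<omega> \<in> space M. \<not> Q i \<omega>} \<in> sets M" by (rule sets.sets_Collect_neg)
    ultimately show "{\<omega> \<in> space M. i \<in> I \<longleftrightarrow> Q i \<omega>} \<in> sets M" by (cases "i \<in> I") auto
  qed simp
  ultimately show "(\<lambda>\<omega>. {i \<in> {..m}. Q i \<omega>}) -` A \<inter> space M \<in> sets M"
    by (auto intro!: sets.finite_UN)
qed simp

lemma sets_borel_pair_Collect:
  fixes P :: "real \<times> real \<Rightarrow> bool"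
  assumes "Measurable.pred (borel \<Otimes>\<^sub>M borel) P"
  shows "{z. P z} \<in> sets borel"
  using assms by (simp add: pred_def space_pair_measure borel_prod)

definition mark_pattern :: "real \<Rightarrow> nat \<Rightarrow> real \<times> real \<Rightarrow> nat set" where
  "mark_pattern t m z = {i \<in> {..m}. fst z \<le> grid_point t m i \<and> grid_point t m i < snd z}"

definition on_pattern :: "real \<Rightarrow> nat \<Rightarrow> (real \<Rightarrow> group_state) \<Rightarrow> nat set" where
  "on_pattern t m y = {i \<in> {..m}. y (grid_point t m i) = ON}"

lemma measurable_mark_pattern:
  assumes "sets \<nu> = sets (borel :: (real \<times> real) measure)"
  shows "mark_pattern t m \<in> \<nu> \<rightarrow>\<^sub>M count_space UNIV"
  unfolding mark_pattern_def[abs_def]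
proof (rule measurable_finite_pattern)
  fix i
  have "{z. fst z \<le> grid_point t m i \<and> grid_point t m i < snd z} \<in> sets (borel :: (real \<times> real) measure)"
    by (rule sets_borel_pair_Collect) measurable
  then show "{z \<in> space \<nu>. fst z \<le> grid_point t m i \<and> grid_point t m i < snd z} \<in> sets \<nu>"
    using sets_eq_imp_space_eq[OF assms] assms by simp
qed

section \<open>The law of the marks\<close>

text \<open>The tails of the mark law have the product form \<open>exp s1 * exp (- s2)\<close>, which matches the product
  form of the probability of a path of a Markov chain.\<close>

lemma mark_law_tail:
  assumes \<nu>: "mark_law t \<nu>" and s: "0 \<le> s1" "s1 \<le> t" "s1 \<le> s2"
  shows "measure \<nu> {z. fst z \<le> s1 \<and> s2 < snd z} = exp (s1 - s2) / (1 + t)"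
proof -
  interpret prob_space \<nu> using \<nu> by (simp add: mark_law_def)
  have sets: "sets \<nu> = sets borel" using \<nu> by (simp add: mark_law_def)
  have F: "measure \<nu> ({..s1} \<times> {..b}) = (1 - exp (- b + s1) + s1) / (1 + t)" if "s1 \<le> b" for b
    using \<nu> s that by (simp add: mark_law_def)
  have rect: "{..s1} \<times> {..b} \<in> sets \<nu>" for b
    unfolding sets by (intro borel_closed closed_Times closed_atMost)
  have half: "{..s1} \<times> UNIV \<in> sets \<nu>"
    unfolding sets by (intro borel_closed closed_Times closed_atMost closed_UNIV)
  have "(\<lambda>n. measure \<nu> ({..s1} \<times> {..s1 + real n})) \<longlonglongrightarrow> measure \<nu> (\<Union>n. {..s1} \<times> {..s1 + real n})"
    using rect by (intro finite_Lim_measure_incseq) (auto simp: incseq_def)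
  also have "(\<Union>n. {..s1} \<times> {..s1 + real n}) = {..s1} \<times> UNIV"
  proof -
    have "\<exists>n. v \<le> s1 + real n" for v using real_arch_simple[of "v - s1"] by (auto simp: algebra_simps)
    then show ?thesis by auto
  qed
  also have "(\<lambda>n. measure \<nu> ({..s1} \<times> {..s1 + real n})) = (\<lambda>n. (1 - exp (- real n) + s1) / (1 + t))"
    by (simp add: F)
  finally have "(\<lambda>n. (1 - exp (- real n) + s1) / (1 + t)) \<longlonglongrightarrow> measure \<nu> ({..s1} \<times> UNIV)" .
  moreover have "(\<lambda>n. exp (- real n)) \<longlonglongrightarrow> 0"
    by (rule filterlim_compose[OF exp_at_bot])
       (simp add: filterlim_uminus_at_bot filterlim_real_sequentially)
  then have "(\<lambda>n. (1 - exp (- real n) + s1) / (1 + t)) \<longlonglongrightarrow> (1 - 0 + s1) / (1 + t)"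
    by (intro tendsto_intros) (use s in auto)
  ultimately have H: "measure \<nu> ({..s1} \<times> UNIV) = (1 + s1) / (1 + t)"
    using LIMSEQ_unique by fastforce
  have "{z. fst z \<le> s1 \<and> s2 < snd z} = ({..s1} \<times> UNIV) - ({..s1} \<times> {..s2})" by auto
  then have "measure \<nu> {z. fst z \<le> s1 \<and> s2 < snd z} =
      measure \<nu> ({..s1} \<times> UNIV) - measure \<nu> ({..s1} \<times> {..s2})"
    using finite_measure_Diff[OF half rect] by auto
  also have "\<dots> = exp (s1 - s2) / (1 + t)"
    by (simp add: H F s diff_divide_distrib[symmetric] add_ac)
  finally show ?thesis .
qed

lemma mark_law_box:
  assumes \<nu>: "mark_law t \<nu>" and s: "0 \<le> r1" "r1 \<le> s1" "s1 \<le> t" "s1 \<le> s2"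
  shows "measure \<nu> {z. r1 < fst z \<and> fst z \<le> s1 \<and> s2 < snd z} = (exp s1 - exp r1) * exp (- s2) / (1 + t)"
proof -
  interpret prob_space \<nu> using \<nu> by (simp add: mark_law_def)
  have sets: "sets \<nu> = sets borel" using \<nu> by (simp add: mark_law_def)
  have meas: "{z. fst z \<le> a \<and> s2 < snd z} \<in> sets \<nu>" for a unfolding sets by (rule sets_borel_pair_Collect) measurable
  have "{z. r1 < fst z \<and> fst z \<le> s1 \<and> s2 < snd z} =
      {z. fst z \<le> s1 \<and> s2 < snd z} - {z. fst z \<le> r1 \<and> s2 < snd z}" by auto
  moreover have "{z. fst z \<le> r1 \<and> s2 < snd z} \<subseteq> {z. fst z \<le> s1 \<and> s2 < snd z}" using s by auto
  ultimately have "measure \<nu> {z. r1 < fst z \<and> fst z \<le> s1 \<and> s2 < snd z} =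
      measure \<nu> {z. fst z \<le> s1 \<and> s2 < snd z} - measure \<nu> {z. fst z \<le> r1 \<and> s2 < snd z}"
    by (simp only: finite_measure_Diff[OF meas meas])
  also have "\<dots> = (exp s1 - exp r1) * exp (- s2) / (1 + t)"
    using s by (simp add: mark_law_tail[OF \<nu>] diff_divide_distrib[symmetric] exp_diff exp_minus field_simps)
  finally show ?thesis .
qed

lemma mark_pattern_interval:
  assumes "mark_pattern t m z = I" "I \<noteq> {}" "0 < t" "0 < m"
  shows "I = {Min I..Max I}" "Max I \<le> m"
proof -
  have fin: "finite I" using assms(1) by (auto simp: mark_pattern_def)
  have mono: "grid_point t m i \<le> grid_point t m j" if "i \<le> j" for i j
    using that assms by (simp add: grid_point_def divide_right_mono)
  have a: "Min I \<in> I" "Max I \<in> I" using fin assms(2) by auto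
  have I: "i \<in> I \<longleftrightarrow> i \<le> m \<and> fst z \<le> grid_point t m i \<and> grid_point t m i < snd z" for i
    unfolding assms(1)[symmetric] by (simp add: mark_pattern_def)
  show max: "Max I \<le> m" using a(2) I[of "Max I"] by blast
  have "i \<in> I" if "Min I \<le> i" "i \<le> Max I" for i
    unfolding I[of i]
    using a[unfolded I[of "Min I"] I[of "Max I"]] mono[OF that(1)] mono[OF that(2)] that(2) by linarith
  then have "{Min I..Max I} \<subseteq> I" by (meson atLeastAtMost_iff subsetI)
  moreover have "I \<subseteq> {Min I..Max I}" using fin by (simp add: subset_iff)
  ultimately show "I = {Min I..Max I}" by (rule antisym[rotated])
qed

text \<open>The factors belong to the appearance in the cell that ends at the grid point \<open>j\<close> (for \<open>j = 0\<close>, to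
  the atom of the appearance time at \<open>0\<close>), to the survival of \<open>l - j\<close> steps, and to the disappearance
  within the following step, if there is one.\<close>

lemma mark_pattern_prob_le:
  assumes \<nu>: "mark_law t \<nu>" and t: "0 < t" and m: "0 < m" and jl: "j \<le> l" "l \<le> m"
  defines "h \<equiv> t / real m"
  shows "(1 + t) * measure \<nu> {z. mark_pattern t m z = {j..l}} \<le>
    (if j = 0 then 1 else 1 - exp (- h)) * exp (- (real (l - j) * h)) * (if l < m then 1 - exp (- h) else 1)"
proof -
  interpret prob_space \<nu> using \<nu> by (simp add: mark_law_def)
  have sets: "sets \<nu> = sets borel" using \<nu> by (simp add: mark_law_def)
  have h: "0 < h" "real m * h = t" using t m by (simp_all add: h_def)
  have gp: "grid_point t m i = real i * h" for i by (simp add: grid_point_def h_def)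
  have le_t: "real i * h \<le> t" if "i \<le> m" for i
    using mult_right_mono[of "real i" "real m" h] that h by simp
  define R where "R c = {z::real\<times>real. (j > 0 \<longrightarrow> real (j - 1) * h < fst z) \<and> fst z \<le> real j * h \<and> c < snd z}" for c
  have R_sets: "R c \<in> sets \<nu>" for c unfolding sets R_def by (rule sets_borel_pair_Collect) measurable
  have R: "measure \<nu> (R c) = (if j = 0 then 1 else 1 - exp (- h)) * exp (real j * h - c) / (1 + t)"
    if c: "real j * h \<le> c" for c
  proof (cases "j = 0")
    case True
    then show ?thesis using mark_law_tail[OF \<nu>, of 0 c] c t by (simp add: R_def)
  next
    case False
    have jm: "real (j - 1) * h \<le> real j * h" "0 \<le> real (j - 1) * h" using h by (simp_all add: mult_right_mono)
    have "R c = {z. real (j - 1) * h < fst z \<and> fst z \<le> real j * h \<and> c < snd z}"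
      using False by (simp add: R_def)
    then have "measure \<nu> (R c) = (exp (real j * h) - exp (real (j - 1) * h)) * exp (- c) / (1 + t)"
      using mark_law_box[OF \<nu> jm(2) jm(1) le_t[of j] c] jl by simp
    also have "exp (real (j - 1) * h) = exp (real j * h) * exp (- h)"
      using False by (simp add: of_nat_diff exp_add[symmetric] algebra_simps)
    also have "(exp (real j * h) - exp (real j * h) * exp (- h)) * exp (- c) =
        (1 - exp (- h)) * exp (real j * h - c)"
      by (simp add: algebra_simps exp_diff exp_minus divide_inverse)
    finally show ?thesis using False by simp
  qed
  have jlh: "real j * h \<le> real l * h" "real j * h \<le> real (Suc l) * h" "real l * h \<le> real (Suc l) * h"
    using jl h by (simp_all add: mult_right_mono)
  have dist: "exp (real j * h - real l * h) = exp (- (real (l - j) * h))"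
    using jl by (simp add: of_nat_diff algebra_simps)
  let ?P = "{z. mark_pattern t m z = {j..l}}"
  have sub: "?P \<subseteq> R (real l * h)"
  proof
    fix z assume "z \<in> ?P"
    then have z: "i \<in> {j..l} \<longleftrightarrow> i \<le> m \<and> fst z \<le> real i * h \<and> real i * h < snd z" for i
      by (auto simp: mark_pattern_def gp set_eq_iff)
    have "real (j - 1) * h < fst z" if "j > 0"
    proof -
      have "j - 1 \<notin> {j..l}" "j - 1 \<le> m" using that jl by auto
      moreover have "real (j - 1) * h \<le> real j * h" using h by (intro mult_right_mono) auto
      then have "real (j - 1) * h < snd z" using z[of j] jl by auto
      ultimately show ?thesis using z[of "j - 1"] by auto
    qed
    then show "z \<in> R (real l * h)" using z[of j] z[of l] jl by (auto simp: R_def)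
  qed
  show ?thesis
  proof (cases "l < m")
    case False
    have "(1 + t) * measure \<nu> ?P \<le> (1 + t) * measure \<nu> (R (real l * h))"
      using t sub R_sets by (intro mult_left_mono finite_measure_mono) auto
    then show ?thesis using False t by (simp add: R[OF jlh(1)] dist)
  next
    case True
    have "?P \<subseteq> R (real l * h) - R (real (Suc l) * h)"
    proof
      fix z assume zP: "z \<in> ?P"
      then have z: "i \<in> {j..l} \<longleftrightarrow> i \<le> m \<and> fst z \<le> real i * h \<and> real i * h < snd z" for i
        by (auto simp: mark_pattern_def gp set_eq_iff)
      have "fst z \<le> real (Suc l) * h" using z[of l] jl jlh by auto
      then have "\<not> real (Suc l) * h < snd z" using z[of "Suc l"] True by auto
      then show "z \<in> R (real l * h) - R (real (Suc l) * h)" using sub zP by (auto simp: R_def)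
    qed
    then have "measure \<nu> ?P \<le> measure \<nu> (R (real l * h) - R (real (Suc l) * h))"
      using R_sets by (intro finite_measure_mono) auto
    also have "\<dots> = measure \<nu> (R (real l * h)) - measure \<nu> (R (real (Suc l) * h))"
      using jlh by (intro finite_measure_Diff R_sets) (auto simp: R_def)
    also have "\<dots> = (if j = 0 then 1 else 1 - exp (- h)) *
        (exp (real j * h - real l * h) - exp (real j * h - real (Suc l) * h)) / (1 + t)"
      unfolding R[OF jlh(1)] R[OF jlh(2)] by (simp add: diff_divide_distrib right_diff_distrib)
    also have "exp (real j * h - real (Suc l) * h) = exp (real j * h - real l * h) * exp (- h)"
      by (simp add: exp_add[symmetric] algebra_simps)
    also note dist
    finally have "(1 + t) * measure \<nu> ?P \<le> (if j = 0 then 1 else 1 - exp (- h)) *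
        (exp (- (real (l - j) * h)) - exp (- (real (l - j) * h)) * exp (- h))"
      using t by (simp only: pos_le_divide_eq mult.commute add_pos_pos zero_less_one)
    also have "\<dots> = (if j = 0 then 1 else 1 - exp (- h)) * exp (- (real (l - j) * h)) * (1 - exp (- h))"
      by (simp only: right_diff_distrib mult_1_right mult.assoc)
    finally show ?thesis by (simp only: True if_True)
  qed
qed

text \<open>An interval is overlooked by the grid only if both of its ends lie in the same cell, which has
  probability of order \<open>1 / m\<^sup>2\<close> for each of the \<open>m\<close> cells.\<close>

lemma mark_pattern_empty_prob_le:
  assumes \<nu>: "mark_law t \<nu>" and t: "0 < t" and m: "0 < m"
  shows "measure \<nu> {z. mark_pattern t m z = {}} \<le> t\<^sup>2 / real m"
proof -
  interpret prob_space \<nu> using \<nu> by (simp add: mark_law_def)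
  have sets: "sets \<nu> = sets borel" using \<nu> by (simp add: mark_law_def)
  have ae: "AE z in \<nu>. 0 \<le> fst z \<and> fst z \<le> t \<and> fst z \<le> snd z"
    using \<nu> by (simp add: mark_law_def case_prod_beta)
  have F: "measure \<nu> ({..s1} \<times> {..s2}) = (1 - exp (- s2 + s1) + s1) / (1 + t)"
    if "0 \<le> s1" "s1 \<le> t" "s1 \<le> s2" for s1 s2
    using \<nu> that by (simp add: mark_law_def)
  have rect: "{..a} \<times> {..b} \<in> sets \<nu>" for a b
    unfolding sets by (intro borel_closed closed_Times closed_atMost)
  define h where "h = t / real m"
  have h: "0 < h" "real m * h = t" using t m by (simp_all add: h_def)
  have gp: "grid_point t m i = real i * h" for i by (simp add: grid_point_def h_def)
  define Q where "Q i = ({..real (Suc i) * h} \<times> {..real (Suc i) * h}) - ({..real i * h} \<times> {..real (Suc i) * h})" for i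
  have Q_sets: "Q i \<in> sets \<nu>" for i unfolding Q_def using rect by auto
  have Q: "measure \<nu> (Q i) \<le> h\<^sup>2" if "i < m" for i
  proof -
    have le: "real (Suc i) * h \<le> t" "real i * h \<le> real (Suc i) * h"
      using mult_right_mono[of "real (Suc i)" "real m" h] that h by (simp_all add: mult_right_mono)
    have "measure \<nu> (Q i) = measure \<nu> ({..real (Suc i) * h} \<times> {..real (Suc i) * h}) -
        measure \<nu> ({..real i * h} \<times> {..real (Suc i) * h})"
      unfolding Q_def using le by (intro finite_measure_Diff rect) auto
    also have "\<dots> = (real (Suc i) * h) / (1 + t) - (1 - exp (- h) + real i * h) / (1 + t)"
      using le h t by (subst (1 2) F) (auto simp: algebra_simps)
    also have "\<dots> = (h - 1 + exp (- h)) / (1 + t)"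
      by (simp add: diff_divide_distrib[symmetric] algebra_simps)
    also have "\<dots> \<le> h - 1 + exp (- h)"
      using exp_ge_add_one_self[of "- h"] t divide_left_mono[of 1 "1 + t" "h - 1 + exp (- h)"] by simp
    also have "\<dots> \<le> h\<^sup>2"
    proof -
      have "exp (- h) = 1 / exp h" by (simp add: exp_minus inverse_eq_divide)
      also have "\<dots> \<le> 1 / (1 + h)" using exp_ge_add_one_self[of h] h by (intro divide_left_mono) auto
      finally have "h - 1 + exp (- h) \<le> h - 1 + 1 / (1 + h)" by simp
      also have "\<dots> = h\<^sup>2 / (1 + h)" using h by (simp add: field_simps power2_eq_square)
      also have "\<dots> \<le> h\<^sup>2" using h by (simp add: divide_le_eq mult_left_le algebra_simps)
      finally show ?thesis .
    qed
    finally show ?thesis .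
  qed
  have "measure \<nu> ({..0} \<times> {..0}) = 0" using F[of 0 0] t by simp
  then have null: "{..0} \<times> {..0} \<in> null_sets \<nu>" using rect by (simp add: null_sets_def emeasure_eq_measure)
  have "measure \<nu> {z. mark_pattern t m z = {}} \<le> measure \<nu> (\<Union>i\<in>{..<m}. Q i)"
  proof (rule finite_measure_mono_AE)
    show "AE z in \<nu>. z \<in> {z. mark_pattern t m z = {}} \<longrightarrow> z \<in> (\<Union>i\<in>{..<m}. Q i)"
      using ae AE_not_in[OF null]
    proof eventually_elim
      case (elim z)
      show ?case
      proof
        assume "z \<in> {z. mark_pattern t m z = {}}"
        then have none: "\<not> (fst z \<le> real i * h \<and> real i * h < snd z)" if "i \<le> m" for i
          using that by (auto simp: mark_pattern_def gp)
        define i where "i = (LEAST i. fst z \<le> real i * h)"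
        have top: "fst z \<le> real m * h" using elim h by simp
        then have i: "fst z \<le> real i * h" "i \<le> m"
          unfolding i_def by (rule LeastI, rule Least_le)
        have "i \<noteq> 0"
        proof
          assume "i = 0"
          then have "fst z \<le> 0" "snd z \<le> 0" using i none[of 0] by auto
          then show False using elim by (cases z) auto
        qed
        then obtain k where k: "i = Suc k" by (cases i) auto
        then have "\<not> fst z \<le> real k * h" unfolding i_def by (metis lessI not_less_Least)
        then have "z \<in> Q k" using i none[of i] k by (cases z) (auto simp: Q_def)
        then show "z \<in> (\<Union>i\<in>{..<m}. Q i)" using k i by auto
      qed
    qed
  qed (use Q_sets in auto)
  also have "\<dots> \<le> (\<Sum>i<m. measure \<nu> (Q i))"
    using Q_sets by (intro finite_measure_subadditive_finite) auto
  also have "\<dots> \<le> (\<Sum>i<m. h\<^sup>2)" using Q by (intro sum_mono) auto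
  also have "\<dots> = t\<^sup>2 / real m" using m by (simp add: h_def power2_eq_square)
  finally show ?thesis .
qed

section \<open>A single group\<close>

text \<open>The difference of the two rows of the transition matrix decays at rate \<open>1 + r\<close>, and the mean of
  the rows with respect to the stationary weights \<open>r\<close> and \<open>1\<close> is constant in time.\<close>

lemma group_transition:
  assumes P: "transition_function (group_rates r) P" and r: "0 \<le> r" and s: "0 \<le> s"
  defines "e \<equiv> exp (- ((1 + r) * s))"
  shows "P s ON ON = (r + e) / (1 + r)" "P s ON OFF = (1 - e) / (1 + r)"
    "P s OFF ON = r * (1 - e) / (1 + r)" "P s OFF OFF = (1 + r * e) / (1 + r)"
proof -
  have init: "P 0 x y = (if x = y then 1 else 0)" for x y
    using P by (simp add: transition_function_def)
  have deriv: "((\<lambda>u. P u x y) has_real_derivative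
      (\<Sum>z\<in>UNIV. group_rates r x z * (P u z y - P u x y))) (at u within {0..})" if "0 \<le> u" for u x y
    using P that by (simp add: transition_function_def)
  have on: "((\<lambda>u. P u ON y) has_real_derivative (P u OFF y - P u ON y)) (at u within {0..})" if "0 \<le> u" for u y
    using deriv[OF that, of ON y] by (simp add: UNIV_group_state)
  have off: "((\<lambda>u. P u OFF y) has_real_derivative r * (P u ON y - P u OFF y)) (at u within {0..})"
    if "0 \<le> u" for u y
    using deriv[OF that, of OFF y] by (simp add: UNIV_group_state)
  have diff: "P s ON y - P s OFF y = (P 0 ON y - P 0 OFF y) * e" for y
  proof -
    have "((\<lambda>u. (P u ON y - P u OFF y) * exp ((1 + r) * u)) has_field_derivative 0) (at u within {0..})"
      if "u \<in> {0..}" for u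
    proof -
      have "0 \<le> u" using that by simp
      note [derivative_intros] = on[OF this] off[OF this]
      show ?thesis by (auto intro!: derivative_eq_intros simp: algebra_simps)
    qed
    then obtain c where c: "\<And>u. u \<in> {0..} \<Longrightarrow> (P u ON y - P u OFF y) * exp ((1 + r) * u) = c"
      using has_field_derivative_zero_constant[of "{0..}" "\<lambda>u. (P u ON y - P u OFF y) * exp ((1 + r) * u)"]
      by auto
    have "(P s ON y - P s OFF y) * exp ((1 + r) * s) = P 0 ON y - P 0 OFF y"
      using c[of s] c[of 0] s by simp
    then have "P s ON y - P s OFF y = (P 0 ON y - P 0 OFF y) / exp ((1 + r) * s)"
      by (simp add: eq_divide_eq)
    then show ?thesis by (simp add: e_def exp_minus divide_inverse)
  qed
  have sum: "r * P s ON y + P s OFF y = r * P 0 ON y + P 0 OFF y" for y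
  proof -
    have "((\<lambda>u. r * P u ON y + P u OFF y) has_field_derivative 0) (at u within {0..})"
      if "u \<in> {0..}" for u
    proof -
      have "0 \<le> u" using that by simp
      note [derivative_intros] = on[OF this] off[OF this]
      show ?thesis by (auto intro!: derivative_eq_intros simp: algebra_simps)
    qed
    then obtain c where c: "\<And>u. u \<in> {0..} \<Longrightarrow> r * P u ON y + P u OFF y = c"
      using has_field_derivative_zero_constant[of "{0..}" "\<lambda>u. r * P u ON y + P u OFF y"] by auto
    then show ?thesis using c[of s] c[of 0] s by simp
  qed
  have a_eq: "(1 + r) * P s ON y = (r * P 0 ON y + P 0 OFF y) + (P 0 ON y - P 0 OFF y) * e" for y
    unfolding sum[symmetric] diff[symmetric] by (simp add: algebra_simps)
  have b_eq: "(1 + r) * P s OFF y = (r * P 0 ON y + P 0 OFF y) - r * ((P 0 ON y - P 0 OFF y) * e)" for y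
    unfolding sum[symmetric] diff[symmetric] by (simp add: algebra_simps)
  have r1: "1 + r \<noteq> 0" using r by simp
  have "(1 + r) * P s ON ON = r + e" "(1 + r) * P s ON OFF = 1 - e"
    "(1 + r) * P s OFF ON = r * (1 - e)" "(1 + r) * P s OFF OFF = 1 + r * e"
    using a_eq[of ON] a_eq[of OFF] b_eq[of ON] b_eq[of OFF] by (simp_all add: init algebra_simps)
  then show "P s ON ON = (r + e) / (1 + r)" "P s ON OFF = (1 - e) / (1 + r)"
    "P s OFF ON = r * (1 - e) / (1 + r)" "P s OFF OFF = (1 + r * e) / (1 + r)"
    using r1 by (simp_all add: field_simps)
qed

text \<open>Convexity of the exponential function on two points with weights \<open>r\<close> and \<open>1\<close>. In terms of the chain:
  not to jump at all is only one of the ways to be back in the initial state.\<close>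

lemma exp_mixture_ge:
  fixes r x :: real assumes "0 \<le> r"
  shows "exp (- (x / (1 + r))) \<le> (r + exp (- x)) / (1 + r)"
    and "exp (- (r * x / (1 + r))) \<le> (1 + r * exp (- x)) / (1 + r)"
proof -
  have tangent: "exp c + exp c * (y - c) \<le> exp y" for c y :: real
    using mult_left_mono[OF exp_ge_add_one_self[of "y - c"], of "exp c"]
    by (simp add: exp_diff algebra_simps)
  have convex: "exp ((r * a + b) / (1 + r)) \<le> (r * exp a + exp b) / (1 + r)" for a b :: real
  proof -
    define c where "c = (r * a + b) / (1 + r)"
    have c: "r * (a - c) + (b - c) = 0" using assms by (simp add: c_def field_simps)
    have "r * (exp c + exp c * (a - c)) + (exp c + exp c * (b - c)) \<le> r * exp a + exp b"
      using assms by (intro add_mono mult_left_mono tangent) auto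
    also have "r * (exp c + exp c * (a - c)) + (exp c + exp c * (b - c)) =
        (1 + r) * exp c + exp c * (r * (a - c) + (b - c))" by (simp add: algebra_simps)
    finally have "exp c \<le> (r * exp a + exp b) / (1 + r)"
      using assms c by (simp add: pos_le_divide_eq mult.commute)
    then show ?thesis by (simp add: c_def)
  qed
  show "exp (- (x / (1 + r))) \<le> (r + exp (- x)) / (1 + r)" using convex[of 0 "- x"] by simp
  show "exp (- (r * x / (1 + r))) \<le> (1 + r * exp (- x)) / (1 + r)" using convex[of "- x" 0] by (simp add: add.commute)
qed

lemma group_transition_ge:
  assumes P: "transition_function (group_rates r) P" and r: "0 \<le> r" and h: "0 \<le> h"
  shows "exp (- h) \<le> P h ON ON" "(1 - exp (- h)) / (1 + r) \<le> P h ON OFF"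
    "r * (1 - exp (- h)) / (1 + r) \<le> P h OFF ON" "exp (- (r * h)) \<le> P h OFF OFF"
proof -
  have e: "exp (- ((1 + r) * h)) \<le> exp (- h)" using r h by (simp add: mult_le_cancel_right1 distrib_right)
  note T = group_transition[OF P r h]
  have r1: "(1 + r) * h / (1 + r) = h" "r * ((1 + r) * h) / (1 + r) = r * h" using r by simp_all
  show "exp (- h) \<le> P h ON ON" "exp (- (r * h)) \<le> P h OFF OFF"
    using exp_mixture_ge[OF r, of "(1 + r) * h"] unfolding T r1 by simp_all
  show "(1 - exp (- h)) / (1 + r) \<le> P h ON OFF" "r * (1 - exp (- h)) / (1 + r) \<le> P h OFF ON"
    using e r unfolding T by (auto intro!: divide_right_mono mult_left_mono)
qed

lemma inverse_one_plus_ge_exp: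
  fixes r :: real assumes "0 \<le> r" shows "exp (- r) \<le> 1 / (1 + r)"
proof -
  have "exp (- r) = 1 / exp r" by (simp add: exp_minus inverse_eq_divide)
  also have "\<dots> \<le> 1 / (1 + r)" using exp_ge_add_one_self[of r] assms by (intro divide_left_mono) auto
  finally show ?thesis .
qed

lemma on_pattern_prob:
  assumes Y: "markov_chain M Y \<pi> q" and t: "0 < t" and m: "0 < m"
  obtains P where "transition_function q P"
    "\<And>I. I \<subseteq> {..m} \<Longrightarrow> measure M {\<omega> \<in> space M. on_pattern t m (\<lambda>s. Y s \<omega>) = I} =
      \<pi> (if 0 \<in> I then ON else OFF) *
      (\<Prod>i<m. P (t / real m) (if i \<in> I then ON else OFF) (if Suc i \<in> I then ON else OFF))"
proof -
  obtain P where P: "transition_function q P"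
    "\<And>m (\<tau> :: nat \<Rightarrow> real) x. \<tau> 0 = 0 \<Longrightarrow> (\<And>i. i < m \<Longrightarrow> \<tau> i < \<tau> (Suc i)) \<Longrightarrow>
           measure M {\<omega>\<in>space M. \<forall>i\<le>m. Y (\<tau> i) \<omega> = x i} =
             \<pi> (x 0) * (\<Prod>i<m. P (\<tau> (Suc i) - \<tau> i) (x i) (x (Suc i)))"
  proof -
    obtain P where P: "transition_function q P" and
      fdd: "\<forall>m (\<tau> :: nat \<Rightarrow> real) x. \<tau> 0 = 0 \<and> (\<forall>i<m. \<tau> i < \<tau> (Suc i)) \<longrightarrow>
           measure M {\<omega>\<in>space M. \<forall>i\<le>m. Y (\<tau> i) \<omega> = x i} =
             \<pi> (x 0) * (\<Prod>i<m. P (\<tau> (Suc i) - \<tau> i) (x i) (x (Suc i)))"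
      using Y unfolding markov_chain_def by blast
    show thesis using P fdd by (intro that[of P]) blast+
  qed
  show thesis
  proof (rule that[OF P(1)])
    fix I assume I: "I \<subseteq> {..m}"
    define x where "x i = (if i \<in> I then ON else OFF)" for i
    have "on_pattern t m (\<lambda>s. Y s \<omega>) = I \<longleftrightarrow> (\<forall>i\<le>m. Y (grid_point t m i) \<omega> = x i)" for \<omega>
    proof -
      have "on_pattern t m (\<lambda>s. Y s \<omega>) = I \<longleftrightarrow> (\<forall>i\<le>m. Y (grid_point t m i) \<omega> = ON \<longleftrightarrow> i \<in> I)"
        using I by (auto simp: on_pattern_def)
      also have "\<dots> \<longleftrightarrow> (\<forall>i\<le>m. Y (grid_point t m i) \<omega> = x i)"
        unfolding x_def by (metis group_state.distinct(1) group_state.exhaust)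
      finally show ?thesis .
    qed
    then have "measure M {\<omega> \<in> space M. on_pattern t m (\<lambda>s. Y s \<omega>) = I} =
        \<pi> (x 0) * (\<Prod>i<m. P (grid_point t m (Suc i) - grid_point t m i) (x i) (x (Suc i)))"
      using P(2)[of "grid_point t m" m x] t m by (simp add: grid_point_def divide_strict_right_mono)
    moreover have "grid_point t m (Suc i) - grid_point t m i = t / real m" for i
      by (simp add: grid_point_def diff_divide_distrib[symmetric] algebra_simps)
    ultimately show "measure M {\<omega> \<in> space M. on_pattern t m (\<lambda>s. Y s \<omega>) = I} =
      \<pi> (if 0 \<in> I then ON else OFF) *
      (\<Prod>i<m. P (t / real m) (if i \<in> I then ON else OFF) (if Suc i \<in> I then ON else OFF))"
      by (simp add: x_def)
  qed
qed

lemma on_pattern_empty_prob_ge: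
  assumes Y: "markov_chain M Y (group_stationary r) (group_rates r)" and r: "0 \<le> r"
    and t: "0 < t" and m: "0 < m"
  shows "exp (- ((1 + t) * r)) \<le> measure M {\<omega> \<in> space M. on_pattern t m (\<lambda>s. Y s \<omega>) = {}}"
proof -
  obtain P where P: "transition_function (group_rates r) P"
    "\<And>I. I \<subseteq> {..m} \<Longrightarrow> measure M {\<omega> \<in> space M. on_pattern t m (\<lambda>s. Y s \<omega>) = I} =
      group_stationary r (if 0 \<in> I then ON else OFF) *
      (\<Prod>i<m. P (t / real m) (if i \<in> I then ON else OFF) (if Suc i \<in> I then ON else OFF))"
    using on_pattern_prob[OF Y t m] by blast
  have "exp (- ((1 + t) * r)) = exp (- r) * exp (- (r * (t / real m))) ^ m"
    using m by (simp add: exp_of_nat_mult[symmetric] exp_add[symmetric] algebra_simps)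
  also have "\<dots> \<le> 1 / (1 + r) * P (t / real m) OFF OFF ^ m"
    using r t by (intro mult_mono power_mono group_transition_ge(4)[OF P(1) r] inverse_one_plus_ge_exp) auto
  also have "\<dots> = measure M {\<omega> \<in> space M. on_pattern t m (\<lambda>s. Y s \<omega>) = {}}"
    using P(2)[of "{}"] by simp
  finally show ?thesis .
qed

text \<open>Each step of the chain is compared with the corresponding factor of \<open>mark_pattern_prob_le\<close>. The
  OFF periods cost \<open>exp (- r t)\<close> in total, and the factors \<open>1 / (1 + r)\<close>, of which the initial law and
  the two jumps have one each, cost at most \<open>exp (- 3 r)\<close>.\<close>

lemma on_pattern_interval_prob_ge:
  assumes Y: "markov_chain M Y (group_stationary r) (group_rates r)" and r: "0 \<le> r"
    and t: "0 < t" and m: "0 < m" and jl: "j \<le> l" "l \<le> m"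
  defines "h \<equiv> t / real m"
  shows "exp (- ((3 + t) * r)) * r * ((if j = 0 then 1 else 1 - exp (- h)) *
      exp (- (real (l - j) * h)) * (if l < m then 1 - exp (- h) else 1))
    \<le> measure M {\<omega> \<in> space M. on_pattern t m (\<lambda>s. Y s \<omega>) = {j..l}}"
proof -
  define x where "x i = (if i \<in> {j..l} then ON else OFF)" for i
  obtain P where P: "transition_function (group_rates r) P"
    "\<And>I. I \<subseteq> {..m} \<Longrightarrow> measure M {\<omega> \<in> space M. on_pattern t m (\<lambda>s. Y s \<omega>) = I} =
      group_stationary r (if 0 \<in> I then ON else OFF) *
      (\<Prod>i<m. P h (if i \<in> I then ON else OFF) (if Suc i \<in> I then ON else OFF))"
    using on_pattern_prob[OF Y t m] unfolding h_def by blast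
  have h: "0 < h" "real m * h = t" using t m by (simp_all add: h_def)
  define A where "A = 1 - exp (- h)"
  have A: "0 \<le> A" using h by (simp add: A_def)
  define q where "q = 1 / (1 + r)"
  have q: "0 < q" "q \<le> 1" using r by (simp_all add: q_def)
  have qe: "exp (- r) \<le> q" unfolding q_def by (rule inverse_one_plus_ge_exp[OF r])
  \<comment> \<open>The three cases are the jump to ON, a step inside the ON period, and the jump to OFF; the last factor bounds steps in the OFF period and is granted to all steps.\<close>
  define \<phi> where "\<phi> i = (if Suc i = j then r * A * q else 1) * (if i \<in> {j..<l} then exp (- h) else 1) *
      (if i = l then A * q else 1) * exp (- (r * h))" for i
  have er: "exp (- (r * h)) \<le> 1" "0 \<le> exp (- (r * h))" using r h by simp_all
  have Ph: "exp (- h) \<le> P h ON ON" "A * q \<le> P h ON OFF" "r * A * q \<le> P h OFF ON" "exp (- (r * h)) \<le> P h OFF OFF"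
    using group_transition_ge[OF P(1) r, of h] h by (simp_all add: A_def q_def)
  have small: "c * exp (- (r * h)) \<le> p" if "0 \<le> c" "c \<le> p" for c p
    using mult_left_mono[OF er(1) that(1)] that(2) by simp
  have step: "0 \<le> \<phi> i \<and> \<phi> i \<le> P h (x i) (x (Suc i))" for i
  proof
    show "0 \<le> \<phi> i" using r A q by (auto simp: \<phi>_def)
    consider "i \<in> {j..l}" "Suc i \<in> {j..l}" | "i \<in> {j..l}" "Suc i \<notin> {j..l}"
      | "i \<notin> {j..l}" "Suc i \<in> {j..l}" | "i \<notin> {j..l}" "Suc i \<notin> {j..l}" by blast
    then show "\<phi> i \<le> P h (x i) (x (Suc i))"
    proof cases
      case 1
      then have "\<phi> i = exp (- h) * exp (- (r * h))" by (auto simp: \<phi>_def)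
      then show ?thesis using 1 small[OF _ Ph(1)] by (simp add: x_def)
    next
      case 2
      then have "\<phi> i = A * q * exp (- (r * h))" by (auto simp: \<phi>_def)
      then show ?thesis using 2 small[OF _ Ph(2)] A q by (simp add: x_def)
    next
      case 3
      then have "\<phi> i = r * A * q * exp (- (r * h))" using jl by (auto simp: \<phi>_def)
      then show ?thesis using 3 small[OF _ Ph(3)] A q r by (simp add: x_def)
    next
      case 4
      then have "\<phi> i = exp (- (r * h))" using jl by (auto simp: \<phi>_def)
      moreover have "x i = OFF" "x (Suc i) = OFF" using 4 by (simp_all add: x_def)
      ultimately show ?thesis using Ph(4) by simp
    qed
  qed
  have "(\<Prod>i<m. \<phi> i) = (\<Prod>i<m. if Suc i = j then r * A * q else 1) *
      (\<Prod>i<m. if i \<in> {j..<l} then exp (- h) else 1) * (\<Prod>i<m. if i = l then A * q else 1) *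
      (\<Prod>i<m. exp (- (r * h)))"
    unfolding \<phi>_def by (simp only: prod.distrib)
  also have "(\<Prod>i<m. if Suc i = j then r * A * q else 1) = (if j = 0 then 1 else r * A * q)"
  proof (cases j)
    case (Suc k)
    then have "k < m" using jl by simp
    then show ?thesis using Suc by (simp add: prod.delta)
  qed simp
  also have "(\<Prod>i<m. if i \<in> {j..<l} then exp (- h) else 1) = exp (- (real (l - j) * h))"
  proof -
    have "{..<m} \<inter> {j..<l} = {j..<l}" using jl by auto
    then have "(\<Prod>i<m. if i \<in> {j..<l} then exp (- h) else 1) = (\<Prod>i\<in>{j..<l}. exp (- h))"
      by (subst prod.inter_restrict[symmetric]) auto
    then show ?thesis by (simp add: exp_of_nat_mult[symmetric])
  qed
  also have "(\<Prod>i<m. if i = l then A * q else 1) = (if l < m then A * q else 1)"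
    by (simp add: prod.delta)
  also have "(\<Prod>i<m. exp (- (r * h))) = exp (- (r * t))"
    using h by (simp add: exp_of_nat_mult[symmetric] algebra_simps)
  finally have prod: "(\<Prod>i<m. \<phi> i) = (if j = 0 then 1 else r * A * q) * exp (- (real (l - j) * h)) *
      (if l < m then A * q else 1) * exp (- (r * t))" .
  have "exp (- ((3 + t) * r)) = exp (- r) ^ 3 * exp (- (r * t))"
    by (simp add: exp_of_nat_mult[symmetric] exp_add[symmetric] algebra_simps)
  also have "\<dots> \<le> q ^ 3 * exp (- (r * t))" using qe by (intro mult_right_mono power_mono) auto
  finally have e3: "exp (- ((3 + t) * r)) \<le> q ^ 3 * exp (- (r * t))" .
  have pw: "q ^ 3 \<le> q ^ k" if "k \<le> 3" for k using q that by (intro power_decreasing) auto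
  define B where "B = (if j = 0 then 1 else A) * exp (- (real (l - j) * h)) * (if l < m then A else 1)"
  have B: "0 \<le> B" using A by (simp add: B_def)
  define k where "k = 1 + (if j = 0 then 0 else 1) + (if l < m then 1 else 0 :: nat)"
  have "exp (- ((3 + t) * r)) * r * B \<le> q ^ 3 * exp (- (r * t)) * r * B"
    using e3 B r by (intro mult_right_mono) auto
  also have "\<dots> \<le> q ^ k * exp (- (r * t)) * r * B"
    using B r pw[of k] by (intro mult_right_mono) (auto simp: k_def)
  also have "\<dots> = group_stationary r (x 0) * (\<Prod>i<m. \<phi> i)"
    unfolding prod by (simp add: B_def k_def x_def q_def)
  also have "\<dots> \<le> group_stationary r (x 0) * (\<Prod>i<m. P h (x i) (x (Suc i)))"
    using step r by (intro mult_left_mono prod_mono) (auto simp: x_def)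
  also have "\<dots> = measure M {\<omega> \<in> space M. on_pattern t m (\<lambda>s. Y s \<omega>) = {j..l}}"
    using P(2)[of "{j..l}"] jl by (auto simp: x_def)
  finally show ?thesis unfolding B_def A_def .
qed

text \<open>To first order in the rate \<open>r\<close>, the ON-interval of a group has the law \<open>(1 + t) r \<nu>\<close>. A pattern that is
  not an interval of indices has mark probability \<open>0\<close>, so that only intervals require a computation.\<close>

lemma on_pattern_prob_ge:
  assumes Y: "markov_chain M Y (group_stationary r) (group_rates r)" and r: "0 \<le> r"
    and t: "0 < t" and m: "0 < m" and \<nu>: "mark_law t \<nu>" and I: "I \<noteq> {}"
  shows "exp (- ((1 + t) * r)) * ((1 + t) * r * exp (- (2 * r)) * measure \<nu> {z. mark_pattern t m z = I})
    \<le> measure M {\<omega> \<in> space M. on_pattern t m (\<lambda>s. Y s \<omega>) = I}"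
proof (cases "\<exists>z. mark_pattern t m z = I")
  case False
  then have "{z. mark_pattern t m z = I} = {}" by blast
  then have "measure \<nu> {z. mark_pattern t m z = I} = 0" by (simp only: measure_empty)
  then show ?thesis by simp
next
  case True
  then obtain z where z: "mark_pattern t m z = I" by blast
  define j l where "j = Min I" and "l = Max I"
  have I': "I = {j..l}" "l \<le> m" using mark_pattern_interval[OF z I t m] by (simp_all add: j_def l_def)
  then have jl: "j \<le> l" using I by auto
  have "exp (- ((1 + t) * r)) * ((1 + t) * r * exp (- (2 * r)) * measure \<nu> {z. mark_pattern t m z = I}) =
      exp (- ((3 + t) * r)) * r * ((1 + t) * measure \<nu> {z. mark_pattern t m z = {j..l}})"
  proof -
    have "exp (- ((3 + t) * r)) = exp (- ((1 + t) * r)) * exp (- (2 * r))"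
      by (simp add: exp_add[symmetric] algebra_simps)
    then show ?thesis unfolding I'(1)[symmetric] by (simp only: mult_ac)
  qed
  also have "\<dots> \<le> exp (- ((3 + t) * r)) * r * ((if j = 0 then 1 else 1 - exp (- (t / real m))) *
      exp (- (real (l - j) * (t / real m))) * (if l < m then 1 - exp (- (t / real m)) else 1))"
    using r by (intro mult_left_mono mark_pattern_prob_le[OF \<nu> t m jl I'(2)]) auto
  also have "\<dots> \<le> measure M {\<omega> \<in> space M. on_pattern t m (\<lambda>s. Y s \<omega>) = I}"
    unfolding I'(1) by (rule on_pattern_interval_prob_ge[OF Y r t m jl I'(2)])
  finally show ?thesis .
qed

section \<open>Sums over lists of distinct elements\<close>

definition lists_of :: "'a set \<Rightarrow> nat \<Rightarrow> 'a list set" where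
  "lists_of A j = {xs. set xs \<subseteq> A \<and> length xs = j}"

lemma finite_lists_of: "finite A \<Longrightarrow> finite (lists_of A j)"
  unfolding lists_of_def by (rule finite_lists_length_eq)

definition distinct_lists :: "'a set \<Rightarrow> nat \<Rightarrow> 'a list set" where
  "distinct_lists G j = {as. set as \<subseteq> G \<and> distinct as \<and> length as = j}"

lemma finite_distinct_lists:
  assumes "finite G" shows "finite (distinct_lists G j)"
  by (rule finite_subset[OF _ finite_lists_length_eq[OF assms, of j]]) (auto simp: distinct_lists_def)

definition distinct_choices :: "('k \<Rightarrow> 'a set) \<Rightarrow> 'k list \<Rightarrow> 'a list set" where
  "distinct_choices G ks = {as. list_all2 (\<lambda>a k. a \<in> G k) as ks \<and> distinct as}"

lemma distinct_choices_Nil: "distinct_choices G [] = {[]}"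
  by (auto simp: distinct_choices_def)

lemma distinct_choices_Cons:
  "distinct_choices G (k # ks) = (\<lambda>(as, a). a # as) ` (SIGMA as:distinct_choices G ks. G k - set as)"
  by (auto simp: distinct_choices_def list_all2_Cons2 image_iff)

lemma finite_distinct_choices:
  assumes "\<And>k. k \<in> set ks \<Longrightarrow> finite (G k)"
  shows "finite (distinct_choices G ks)"
  using assms by (induction ks) (auto simp: distinct_choices_Nil distinct_choices_Cons)

lemma distinct_choices_set:
  assumes "as \<in> distinct_choices G ks"
  shows "set as \<subseteq> (\<Union>k\<in>set ks. G k)" "length as = length ks" "distinct as"
proof -
  have as: "list_all2 (\<lambda>a k. a \<in> G k) as ks" "distinct as" using assms by (simp_all add: distinct_choices_def)
  from as(1) show "set as \<subseteq> (\<Union>k\<in>set ks. G k)" by (induction rule: list_all2_induct) auto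
  show "length as = length ks" "distinct as" using as list_all2_lengthD by auto
qed

lemma sum_distinct_choices_Cons:
  fixes c :: "'a \<Rightarrow> real"
  assumes "\<And>k'. k' \<in> set (k # ks) \<Longrightarrow> finite (G k')"
  shows "(\<Sum>as\<in>distinct_choices G (k # ks). \<Prod>a\<leftarrow>as. c a) =
    (\<Sum>as\<in>distinct_choices G ks. (\<Prod>a\<leftarrow>as. c a) * (\<Sum>a\<in>G k - set as. c a))"
proof -
  have "inj_on (\<lambda>(as, a). a # as) (SIGMA as:distinct_choices G ks. G k - set as)"
    by (auto simp: inj_on_def)
  then have "(\<Sum>as\<in>distinct_choices G (k # ks). \<Prod>a\<leftarrow>as. c a) =
      (\<Sum>(as, a)\<in>(SIGMA as:distinct_choices G ks. G k - set as). c a * (\<Prod>a\<leftarrow>as. c a))"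
    unfolding distinct_choices_Cons by (subst sum.reindex) (auto simp: case_prod_beta intro!: sum.cong)
  also have "\<dots> = (\<Sum>as\<in>distinct_choices G ks. \<Sum>a\<in>G k - set as. c a * (\<Prod>a\<leftarrow>as. c a))"
    using assms by (intro sum.Sigma[symmetric] finite_distinct_choices) auto
  finally show ?thesis by (simp add: sum_distrib_left mult.commute)
qed

text \<open>The entries are chosen one after the other. Each choice loses only the elements that have been used
  before, at most \<open>J\<close> in number.\<close>

lemma sum_distinct_choices_ge:
  fixes b :: "'k \<Rightarrow> real" and c :: "'a \<Rightarrow> real"
  assumes "\<And>k. k \<in> set ks \<Longrightarrow> finite (G k)" and c: "\<And>a. 0 \<le> c a"
    and b: "\<And>k X. k \<in> set ks \<Longrightarrow> finite X \<Longrightarrow> card X \<le> J \<Longrightarrow> b k \<le> (\<Sum>a\<in>G k - X. c a)"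
    and "\<And>k. k \<in> set ks \<Longrightarrow> 0 \<le> b k" and "length ks \<le> Suc J"
  shows "(\<Prod>k\<leftarrow>ks. b k) \<le> (\<Sum>as\<in>distinct_choices G ks. \<Prod>a\<leftarrow>as. c a)"
  using assms(1,3-)
proof (induction ks)
  case (Cons k ks)
  have pos: "0 \<le> (\<Prod>a\<leftarrow>as. c a)" for as using c by (induction as) auto
  have "(\<Prod>k\<leftarrow>k # ks. b k) = (\<Prod>k\<leftarrow>ks. b k) * b k" by (simp add: mult.commute)
  also have "\<dots> \<le> (\<Sum>as\<in>distinct_choices G ks. \<Prod>a\<leftarrow>as. c a) * b k"
    using Cons by (intro mult_right_mono) auto
  also have "\<dots> = (\<Sum>as\<in>distinct_choices G ks. (\<Prod>a\<leftarrow>as. c a) * b k)" by (rule sum_distrib_right)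
  also have "\<dots> \<le> (\<Sum>as\<in>distinct_choices G ks. (\<Prod>a\<leftarrow>as. c a) * (\<Sum>a\<in>G k - set as. c a))"
  proof (intro sum_mono mult_left_mono pos)
    fix as assume "as \<in> distinct_choices G ks"
    then have "length as = length ks" using distinct_choices_set by blast
    then have "card (set as) \<le> J" using card_length[of as] Cons.prems by simp
    then show "b k \<le> (\<Sum>a\<in>G k - set as. c a)" using Cons.prems(2) by simp
  qed
  also have "\<dots> = (\<Sum>as\<in>distinct_choices G (k # ks). \<Prod>a\<leftarrow>as. c a)"
    by (rule sum_distinct_choices_Cons[symmetric]) (use Cons.prems in auto)
  finally show ?case .
qed (simp add: distinct_choices_Nil)

lemma sum_distinct_choices_le:
  fixes c :: "'a \<Rightarrow> real"
  assumes "\<And>k. k \<in> set ks \<Longrightarrow> finite (G k)" and c: "\<And>a. 0 \<le> c a"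
  shows "(\<Sum>as\<in>distinct_choices G ks. \<Prod>a\<leftarrow>as. c a) \<le> (\<Prod>k\<leftarrow>ks. \<Sum>a\<in>G k. c a)"
  using assms(1)
proof (induction ks)
  case (Cons k ks)
  have pos: "0 \<le> (\<Prod>a\<leftarrow>as. c a)" for as using c by (induction as) auto
  have "(\<Sum>as\<in>distinct_choices G (k # ks). \<Prod>a\<leftarrow>as. c a) =
      (\<Sum>as\<in>distinct_choices G ks. (\<Prod>a\<leftarrow>as. c a) * (\<Sum>a\<in>G k - set as. c a))"
    by (rule sum_distinct_choices_Cons) (use Cons.prems in auto)
  also have "\<dots> \<le> (\<Sum>as\<in>distinct_choices G ks. (\<Prod>a\<leftarrow>as. c a) * (\<Sum>a\<in>G k. c a))"
    using c Cons.prems by (intro sum_mono mult_left_mono sum_mono2 pos) auto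
  also have "\<dots> = (\<Sum>as\<in>distinct_choices G ks. \<Prod>a\<leftarrow>as. c a) * (\<Sum>a\<in>G k. c a)"
    by (rule sum_distrib_right[symmetric])
  also have "\<dots> \<le> (\<Prod>k\<leftarrow>ks. \<Sum>a\<in>G k. c a) * (\<Sum>a\<in>G k. c a)"
    using Cons c by (intro mult_right_mono sum_nonneg) auto
  finally show ?case by (simp add: mult.commute)
qed (simp add: distinct_choices_Nil)

lemma sum_over_distinct_lists:
  fixes g :: "'a set \<Rightarrow> real"
  assumes V: "finite V"
  shows "(\<Sum>as\<in>distinct_lists V j. g (set as)) =
    fact j * (\<Sum>B\<in>{B. B \<subseteq> V \<and> card B = j}. g B)"
proof -
  let ?S = "{B. B \<subseteq> V \<and> card B = j}"
  have fin: "finite ?S" using V by auto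
  have finB: "finite B" if "B \<in> ?S" for B using that V finite_subset by blast
  have Un: "distinct_lists V j = (\<Union>B\<in>?S. permutations_of_set B)"
    by (auto simp: distinct_lists_def permutations_of_set_def distinct_card)
  have "(\<Sum>as\<in>distinct_lists V j. g (set as)) =
      (\<Sum>B\<in>?S. \<Sum>as\<in>permutations_of_set B. g (set as))"
    unfolding Un
  proof (rule sum.UNION_disjoint[OF fin])
    show "\<forall>B\<in>?S. finite (permutations_of_set B)" by simp
    show "\<forall>B\<in>?S. \<forall>C\<in>?S. B \<noteq> C \<longrightarrow> permutations_of_set B \<inter> permutations_of_set C = {}"
      by (auto simp: permutations_of_set_def)
  qed
  also have "\<dots> = (\<Sum>B\<in>?S. fact j * g B)"
  proof (intro sum.cong refl)
    fix B assume B: "B \<in> ?S"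
    have "(\<Sum>as\<in>permutations_of_set B. g (set as)) = (\<Sum>as\<in>permutations_of_set B. g B)"
      by (intro sum.cong) (auto simp: permutations_of_set_def)
    then show "(\<Sum>as\<in>permutations_of_set B. g (set as)) = fact j * g B" using B finB[OF B] by simp
  qed
  finally show ?thesis by (simp add: sum_distrib_left)
qed

lemma distinct_choices_const:
  "distinct_choices (\<lambda>_. V) ks = distinct_lists V (length ks)"
  by (auto simp: distinct_choices_def distinct_lists_def list_all2_conv_all_nth in_set_conv_nth) (metis nth_mem subsetD)

lemma prod_list_distinct_eq: "distinct as \<Longrightarrow> (\<Prod>a\<leftarrow>as. c a) = (\<Prod>a\<in>set as. c a :: real)"
  by (simp add: prod.distinct_set_conv_list)

lemma elementary_symmetric_eq:
  fixes w :: "'a \<Rightarrow> real"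
  assumes "finite V"
  shows "fact j * (\<Sum>B\<in>{B. B \<subseteq> V \<and> card B = j}. \<Prod>i\<in>B. w i) =
    (\<Sum>as\<in>distinct_choices (\<lambda>_. V) (replicate j ()). \<Prod>a\<leftarrow>as. w a)"
  unfolding sum_over_distinct_lists[OF assms, symmetric] distinct_choices_const
  by (intro sum.cong) (auto simp: prod_list_distinct_eq distinct_lists_def)

text \<open>The elementary symmetric polynomial of degree \<open>j\<close> is the sum over lists of distinct indices divided
  by \<open>j!\<close>. Allowing repetitions gives a power of the sum of the weights.\<close>

lemma elementary_symmetric_le:
  fixes w :: "'a \<Rightarrow> real"
  assumes V: "finite V" and w: "\<And>i. 0 \<le> w i"
  shows "fact j * (\<Sum>B\<in>{B. B \<subseteq> V \<and> card B = j}. \<Prod>i\<in>B. w i) \<le> (\<Sum>i\<in>V. w i) ^ j"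
  unfolding elementary_symmetric_eq[OF V]
  using sum_distinct_choices_le[of "replicate j ()" "\<lambda>_. V" w] V w by (simp add: prod_list_replicate)

lemma elementary_symmetric_ge:
  fixes w :: "'a \<Rightarrow> real"
  assumes V: "finite V" and w: "\<And>i. 0 \<le> w i" and b: "0 \<le> b"
    and X: "\<And>X. finite X \<Longrightarrow> card X \<le> j - 1 \<Longrightarrow> b \<le> (\<Sum>i\<in>V - X. w i)"
  shows "b ^ j \<le> fact j * (\<Sum>B\<in>{B. B \<subseteq> V \<and> card B = j}. \<Prod>i\<in>B. w i)"
  unfolding elementary_symmetric_eq[OF V]
  using sum_distinct_choices_ge[of "replicate j ()" "\<lambda>_. V" w "j - 1" "\<lambda>_. b"] V w b X
  by (simp add: prod_list_replicate)

section \<open>Rates of the groups at a vertex\<close>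

definition vertex_groups :: "nat \<Rightarrow> nat \<Rightarrow> nat set set" where
  "vertex_groups n v = {a \<in> groups n. v \<in> a}"

lemma finite_vertex_groups: "finite (vertex_groups n v)"
  using finite_groups by (simp add: vertex_groups_def)

lemma vertex_groups_card: "a \<in> vertex_groups n v \<Longrightarrow> card a \<in> {2..n}"
  using card_mono[of "{1..n}" a] by (auto simp: vertex_groups_def groups_def)

lemma vertex_groups_of_card:
  assumes v: "v \<in> {1..n}" and k: "2 \<le> k"
  shows "bij_betw (insert v) {B. B \<subseteq> {1..n} - {v} \<and> card B = k - 1} {a \<in> vertex_groups n v. card a = k}"
proof (rule bij_betw_byWitness[where f' = "\<lambda>a. a - {v}"])
  show "insert v ` {B. B \<subseteq> {1..n} - {v} \<and> card B = k - 1} \<subseteq> {a \<in> vertex_groups n v. card a = k}"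
  proof
    fix a assume "a \<in> insert v ` {B. B \<subseteq> {1..n} - {v} \<and> card B = k - 1}"
    then obtain B where B: "a = insert v B" "B \<subseteq> {1..n} - {v}" "card B = k - 1" by blast
    moreover have "finite B" "v \<notin> B" using B(2) finite_subset by auto
    ultimately show "a \<in> {a \<in> vertex_groups n v. card a = k}"
      using v k by (auto simp: vertex_groups_def groups_def)
  qed
  show "(\<lambda>a. a - {v}) ` {a \<in> vertex_groups n v. card a = k} \<subseteq> {B. B \<subseteq> {1..n} - {v} \<and> card B = k - 1}"
    by (auto simp: vertex_groups_def groups_def)
qed (auto simp: vertex_groups_def)

context
  fixes n :: nat and w :: "nat \<Rightarrow> real" and p :: "nat pmf" and v :: nat
  assumes w_nonneg: "\<And>i. i \<in> {1..n} \<Longrightarrow> 0 \<le> w i" and total: "0 < (\<Sum>i\<in>{1..n}. w i)"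
    and v: "v \<in> {1..n}"
begin

lemma off_rate_nonneg: "a \<in> vertex_groups n v \<Longrightarrow> 0 \<le> off_rate n w p a"
  unfolding off_rate_def using total w_nonneg
  by (intro divide_nonneg_nonneg mult_nonneg_nonneg prod_nonneg) (auto simp: vertex_groups_def groups_def)

lemma off_rate_insert:
  assumes "B \<subseteq> {1..n} - {v}" "card B = k - 1" "2 \<le> k"
  shows "off_rate n w p (insert v B) =
    fact k * pmf p k * w v * (\<Prod>i\<in>B. w i) / (\<Sum>i\<in>{1..n}. w i) ^ (k - 1)"
proof -
  have "finite B" "v \<notin> B" using assms(1) finite_subset by auto
  then show ?thesis using assms(2,3) by (simp add: off_rate_def mult.assoc)
qed

text \<open>The factor \<open>k!\<close> of the rates is split as \<open>k * (k - 1)!\<close>: the factorial completes the elementary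
  symmetric polynomial of the weights of the other members, and the size-biased weight \<open>k p\<^sub>k\<close> is left.\<close>

lemma sum_off_rate_of_card:
  assumes k: "2 \<le> k"
  shows "(\<Sum>a\<in>{a \<in> vertex_groups n v. card a = k}. off_rate n w p a) =
    real k * pmf p k * w v / (\<Sum>i\<in>{1..n}. w i) ^ (k - 1) *
    (fact (k - 1) * (\<Sum>B\<in>{B. B \<subseteq> {1..n} - {v} \<and> card B = k - 1}. \<Prod>i\<in>B. w i))"
proof -
  have "fact k = real k * fact (k - 1)" using k by (simp add: fact_reduce)
  moreover have "(\<Sum>a\<in>{a \<in> vertex_groups n v. card a = k}. off_rate n w p a) =
      (\<Sum>B\<in>{B. B \<subseteq> {1..n} - {v} \<and> card B = k - 1}. off_rate n w p (insert v B))"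
    by (rule sum.reindex_bij_betw[OF vertex_groups_of_card[OF v k], symmetric])
  moreover have "\<dots> = (\<Sum>B\<in>{B. B \<subseteq> {1..n} - {v} \<and> card B = k - 1}.
      fact k * pmf p k * w v * (\<Prod>i\<in>B. w i) / (\<Sum>i\<in>{1..n}. w i) ^ (k - 1))"
    using k by (intro sum.cong refl off_rate_insert) auto
  ultimately show ?thesis by (simp add: sum_distrib_left sum_divide_distrib[symmetric] algebra_simps)
qed

lemma sum_off_rate_of_card_le:
  assumes k: "2 \<le> k"
  shows "(\<Sum>a\<in>{a \<in> vertex_groups n v. card a = k}. off_rate n w p a) \<le> real k * pmf p k * w v"
proof -
  let ?V = "{1..n} - {v}" and ?l = "\<Sum>i\<in>{1..n}. w i"
  define w' where "w' i = (if i \<in> {1..n} then w i else 0)" for i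
  have w': "0 \<le> w' i" for i using w_nonneg by (simp add: w'_def)
  have "fact (k - 1) * (\<Sum>B\<in>{B. B \<subseteq> ?V \<and> card B = k - 1}. \<Prod>i\<in>B. w i) =
      fact (k - 1) * (\<Sum>B\<in>{B. B \<subseteq> ?V \<and> card B = k - 1}. \<Prod>i\<in>B. w' i)"
    by (intro arg_cong2[where f = "(*)"] refl sum.cong prod.cong) (auto simp: w'_def)
  also have "\<dots> \<le> (\<Sum>i\<in>?V. w' i) ^ (k - 1)" by (rule elementary_symmetric_le) (use w' in auto)
  also have "\<dots> \<le> ?l ^ (k - 1)"
  proof (intro power_mono sum_nonneg w')
    have "(\<Sum>i\<in>?V. w' i) \<le> (\<Sum>i\<in>{1..n}. w' i)" by (intro sum_mono2) (use w' in auto)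
    then show "(\<Sum>i\<in>?V. w' i) \<le> ?l" by (simp add: w'_def)
  qed
  finally have le: "fact (k - 1) * (\<Sum>B\<in>{B. B \<subseteq> ?V \<and> card B = k - 1}. \<Prod>i\<in>B. w i) \<le> ?l ^ (k - 1)" .
  have "real k * pmf p k * w v / ?l ^ (k - 1) *
      (fact (k - 1) * (\<Sum>B\<in>{B. B \<subseteq> ?V \<and> card B = k - 1}. \<Prod>i\<in>B. w i)) \<le>
      real k * pmf p k * w v / ?l ^ (k - 1) * ?l ^ (k - 1)"
    using w_nonneg[OF v] total by (intro mult_left_mono le) auto
  then show ?thesis unfolding sum_off_rate_of_card[OF k] using total by simp
qed

lemma sum_off_rate_le:
  assumes "integrable (measure_pmf p) real"
  shows "(\<Sum>a\<in>vertex_groups n v. off_rate n w p a) \<le> measure_pmf.expectation p real * w v"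
proof -
  have "(\<Sum>a\<in>vertex_groups n v. off_rate n w p a) =
      (\<Sum>k\<in>{2..n}. \<Sum>a\<in>{a \<in> vertex_groups n v. card a = k}. off_rate n w p a)"
    using vertex_groups_card by (intro sum.group[symmetric] finite_vertex_groups) auto
  also have "\<dots> \<le> (\<Sum>k\<in>{2..n}. real k * pmf p k * w v)"
    by (intro sum_mono sum_off_rate_of_card_le) simp
  also have "\<dots> = (\<Sum>k\<in>{2..n}. real k * pmf p k) * w v" by (rule sum_distrib_right[symmetric])
  also have "\<dots> \<le> measure_pmf.expectation p real * w v"
  proof (intro mult_right_mono w_nonneg[OF v])
    have "(\<Sum>k\<in>{2..n}. real k * pmf p k) = measure_pmf.expectation p (\<lambda>k. real k * indicator {2..n} k)"
      by (subst integral_measure_pmf_real[of "{2..n}"]) (auto simp: indicator_def)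
    also have "\<dots> \<le> measure_pmf.expectation p real"
      by (rule integral_mono') (use assms in \<open>auto simp: indicator_def\<close>)
    finally show "(\<Sum>k\<in>{2..n}. real k * pmf p k) \<le> measure_pmf.expectation p real" .
  qed
  finally show ?thesis .
qed

text \<open>From here on \<open>\<delta>\<close> bounds the share of a single vertex in the total weight. The rates of the groups
  at a vertex then almost attain the upper bound \<open>k p\<^sub>k w\<^sub>v\<close>.\<close>

context
  fixes \<delta> :: real
  assumes \<delta>: "\<And>i. i \<in> {1..n} \<Longrightarrow> w i \<le> \<delta> * (\<Sum>i\<in>{1..n}. w i)"
begin

lemma weight_ratio_nonneg: "0 \<le> \<delta>"
  using w_nonneg[OF v] \<delta>[OF v] total by (smt (verit) zero_le_mult_iff)

lemma sum_off_rate_of_card_ge: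
  assumes k: "2 \<le> k" and k\<delta>: "real k * \<delta> \<le> 1"
  shows "real k * pmf p k * w v * (1 - real k ^ 2 * \<delta>) \<le>
    (\<Sum>a\<in>{a \<in> vertex_groups n v. card a = k}. off_rate n w p a)"
proof -
  let ?V = "{1..n} - {v}" and ?l = "\<Sum>i\<in>{1..n}. w i"
  define w' where "w' i = (if i \<in> {1..n} then w i else 0)" for i
  have w': "0 \<le> w' i" "w' i \<le> \<delta> * ?l" for i
    using w_nonneg \<delta> weight_ratio_nonneg total by (auto simp: w'_def)
  have "(?l * (1 - real k * \<delta>)) ^ (k - 1) \<le>
      fact (k - 1) * (\<Sum>B\<in>{B. B \<subseteq> ?V \<and> card B = k - 1}. \<Prod>i\<in>B. w' i)"
  proof (rule elementary_symmetric_ge)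
    fix X :: "nat set" assume X: "finite X" "card X \<le> k - 1 - 1"
    have "card (insert v X) \<le> k" using X k card_insert_le_m1[of k X v] by simp
    have "?l = (\<Sum>i\<in>{1..n}. w' i)" by (simp add: w'_def)
    also have "\<dots> \<le> (\<Sum>i\<in>(?V - X) \<union> insert v X. w' i)" using X w' by (intro sum_mono2) auto
    also have "\<dots> \<le> (\<Sum>i\<in>?V - X. w' i) + (\<Sum>i\<in>insert v X. w' i)"
      using X(1) sum.union_inter[of "?V - X" "insert v X" w'] sum_nonneg[of "(?V - X) \<inter> insert v X" w'] w'(1)
      by simp
    also have "(\<Sum>i\<in>insert v X. w' i) \<le> real (card (insert v X)) * (\<delta> * ?l)"
      using sum_bounded_above[of "insert v X" w' "\<delta> * ?l"] w' by simp
    also have "\<dots> \<le> real k * (\<delta> * ?l)"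
      using \<open>card (insert v X) \<le> k\<close> weight_ratio_nonneg total by (intro mult_right_mono) auto
    finally show "?l * (1 - real k * \<delta>) \<le> (\<Sum>i\<in>?V - X. w' i)" by (simp add: algebra_simps)
  qed (use w' total k\<delta> in auto)
  also have "\<dots> = fact (k - 1) * (\<Sum>B\<in>{B. B \<subseteq> ?V \<and> card B = k - 1}. \<Prod>i\<in>B. w i)"
    by (intro arg_cong2[where f = "(*)"] refl sum.cong prod.cong) (auto simp: w'_def)
  finally have ge: "(?l * (1 - real k * \<delta>)) ^ (k - 1) \<le>
      fact (k - 1) * (\<Sum>B\<in>{B. B \<subseteq> ?V \<and> card B = k - 1}. \<Prod>i\<in>B. w i)" .
  have "1 - real k ^ 2 * \<delta> \<le> 1 + real (k - 1) * (- (real k * \<delta>))"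
    using k weight_ratio_nonneg by (simp add: power2_eq_square of_nat_diff algebra_simps)
  also have "\<dots> \<le> (1 + (- (real k * \<delta>))) ^ (k - 1)" by (rule Bernoulli_inequality) (use k\<delta> in simp)
  finally have "real k * pmf p k * w v * (1 - real k ^ 2 * \<delta>) \<le>
      real k * pmf p k * w v * (1 - real k * \<delta>) ^ (k - 1)"
    using w_nonneg[OF v] by (intro mult_left_mono) auto
  also have "\<dots> = real k * pmf p k * w v / ?l ^ (k - 1) * (?l * (1 - real k * \<delta>)) ^ (k - 1)"
    using total by (simp add: power_mult_distrib)
  also have "\<dots> \<le> real k * pmf p k * w v / ?l ^ (k - 1) *
      (fact (k - 1) * (\<Sum>B\<in>{B. B \<subseteq> ?V \<and> card B = k - 1}. \<Prod>i\<in>B. w i))"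
    using w_nonneg[OF v] total by (intro mult_left_mono ge) auto
  finally show ?thesis unfolding sum_off_rate_of_card[OF k] .
qed

lemma off_rate_le:
  assumes a: "a \<in> vertex_groups n v" and \<delta>1: "\<delta> \<le> 1"
  shows "off_rate n w p a \<le> fact (card a) * pmf p (card a) * w v * \<delta>"
proof -
  let ?l = "\<Sum>i\<in>{1..n}. w i"
  define k B where "k = card a" and "B = a - {v}"
  have k: "2 \<le> k" using vertex_groups_card[OF a] by (simp add: k_def)
  have fin: "finite a" using a finite_subset by (auto simp: vertex_groups_def groups_def)
  have B: "B \<subseteq> {1..n} - {v}" "card B = k - 1" "a = insert v B"
    using a fin by (auto simp: B_def k_def vertex_groups_def groups_def)
  have "(\<Prod>i\<in>B. w i) \<le> (\<Prod>i\<in>B. \<delta> * ?l)"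
    using B w_nonneg \<delta> by (intro prod_mono) auto
  also have "\<dots> = \<delta> ^ (k - 1) * ?l ^ (k - 1)" by (simp add: B power_mult_distrib)
  also have "\<dots> \<le> \<delta> ^ 1 * ?l ^ (k - 1)"
    using weight_ratio_nonneg \<delta>1 k total by (intro mult_right_mono power_decreasing) auto
  finally have le: "(\<Prod>i\<in>B. w i) / ?l ^ (k - 1) \<le> \<delta>" using total by (simp add: divide_le_eq)
  have "off_rate n w p a = fact k * pmf p k * w v * ((\<Prod>i\<in>B. w i) / ?l ^ (k - 1))"
    unfolding B(3) off_rate_insert[OF B(1,2) k] by simp
  also have "\<dots> \<le> fact k * pmf p k * w v * \<delta>"
    using w_nonneg[OF v] by (intro mult_left_mono le) auto
  finally show ?thesis by (simp add: k_def)
qed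

text \<open>Each rate is at most \<open>k! p\<^sub>k w\<^sub>v \<delta>\<close>. Hence both the damping \<open>exp (- 2 r)\<close>, which stems from
  \<open>on_pattern_prob_ge\<close>, and the removal of \<open>J\<close> groups cost a relative error of order \<open>\<delta> (1 + w\<^sub>v)\<close>. Linear
  growth of the error in \<open>w\<^sub>v\<close> is harmless, since the mean weight of a vertex stays bounded.\<close>

lemma sum_damped_rates_ge:
  assumes k: "2 \<le> k" "k \<le> K" and K\<delta>: "real K * \<delta> \<le> 1" and X: "finite X" "card X \<le> J"
  shows "real k * pmf p k * w v * (1 - (2 * fact K + real K ^ 2 + real J * fact K) * \<delta> * (1 + w v)) \<le>
    (\<Sum>a\<in>{a \<in> vertex_groups n v. card a = k} - X. off_rate n w p a * exp (- (2 * off_rate n w p a)))"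
proof -
  let ?G = "{a \<in> vertex_groups n v. card a = k}" and ?r = "off_rate n w p"
  define q where "q = real k * pmf p k * w v"
  define R where "R = q * fact (k - 1) * \<delta>"
  have wv: "0 \<le> w v" by (rule w_nonneg[OF v])
  have q: "0 \<le> q" using wv by (simp add: q_def)
  have k\<delta>: "real k * \<delta> \<le> 1"
    using mult_right_mono[of "real k" "real K" \<delta>] k K\<delta> weight_ratio_nonneg by simp
  have "1 * \<delta> \<le> real k * \<delta>" using k weight_ratio_nonneg by (intro mult_right_mono) auto
  then have \<delta>1: "\<delta> \<le> 1" using k\<delta> by simp
  have fact_k: "fact k = real k * fact (k - 1)" using k by (simp add: fact_reduce)
  have fin: "finite ?G" using finite_vertex_groups by simp
  have R: "0 \<le> R" using q weight_ratio_nonneg by (simp add: R_def)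
  have r: "0 \<le> ?r a" "?r a \<le> R" if "a \<in> ?G" for a
    using that off_rate_nonneg off_rate_le[of a, OF _ \<delta>1] by (auto simp: R_def q_def fact_k mult_ac)
  have sum_le: "(\<Sum>a\<in>?G. ?r a) \<le> q" unfolding q_def by (rule sum_off_rate_of_card_le[OF k(1)])
  have damped: "?r a - 2 * R * ?r a \<le> ?r a * exp (- (2 * ?r a))" if "a \<in> ?G" for a
  proof -
    have "1 - 2 * R \<le> 1 - 2 * ?r a" using r[OF that] by simp
    also have "\<dots> \<le> exp (- (2 * ?r a))" using exp_ge_add_one_self[of "- (2 * ?r a)"] by simp
    finally have "?r a * (1 - 2 * R) \<le> ?r a * exp (- (2 * ?r a))"
      using r[OF that] by (intro mult_left_mono) auto
    then show ?thesis by (simp add: algebra_simps)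
  qed
  have "(\<Sum>a\<in>?G. ?r a) = (\<Sum>a\<in>?G \<inter> X. ?r a) + (\<Sum>a\<in>?G - X. ?r a)"
    by (rule sum.Int_Diff[OF fin])
  moreover have "(\<Sum>a\<in>?G \<inter> X. ?r a) \<le> real (card (?G \<inter> X)) * R"
    using sum_bounded_above[of "?G \<inter> X" ?r R] r by simp
  moreover have "real (card (?G \<inter> X)) * R \<le> real J * R"
  proof -
    have "card (?G \<inter> X) \<le> card X" using X by (intro card_mono) auto
    then show ?thesis using X R by (intro mult_right_mono) auto
  qed
  moreover have "(\<Sum>a\<in>?G - X. ?r a) \<le> (\<Sum>a\<in>?G. ?r a)" using fin r by (intro sum_mono2) auto
  then have "2 * R * (\<Sum>a\<in>?G - X. ?r a) \<le> 2 * R * q"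
    using R sum_le by (intro mult_left_mono) auto
  moreover have "q * (1 - real k ^ 2 * \<delta>) \<le> (\<Sum>a\<in>?G. ?r a)"
    unfolding q_def by (rule sum_off_rate_of_card_ge[OF k(1) k\<delta>])
  moreover have "(\<Sum>a\<in>?G - X. ?r a) - 2 * R * (\<Sum>a\<in>?G - X. ?r a) \<le>
      (\<Sum>a\<in>?G - X. ?r a * exp (- (2 * ?r a)))"
    unfolding sum_distrib_left sum_subtractf[symmetric] by (intro sum_mono damped) auto
  ultimately have main: "q * (1 - real k ^ 2 * \<delta>) - real J * R - 2 * R * q \<le>
      (\<Sum>a\<in>?G - X. ?r a * exp (- (2 * ?r a)))" by linarith
  have "real k ^ 2 \<le> real K ^ 2" using k by (intro power_mono) auto
  moreover have f: "fact (k - 1) \<le> (fact K :: real)" using k by (intro fact_mono) auto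
  then have "real J * fact (k - 1) \<le> real J * fact K" by (intro mult_left_mono) auto
  moreover have "fact (k - 1) * q \<le> fact K * w v"
  proof -
    have "fact (k - 1) * q = fact k * (pmf p k * w v)" by (simp add: q_def fact_k mult_ac)
    also have "\<dots> \<le> fact K * (1 * w v)"
      using k wv pmf_le_1[of p k] by (intro mult_mono fact_mono) auto
    finally show ?thesis by simp
  qed
  ultimately have "real k ^ 2 + real J * fact (k - 1) + 2 * (fact (k - 1) * q) \<le>
      real K ^ 2 + real J * fact K + 2 * (fact K * w v)" by linarith
  also have "\<dots> \<le> (2 * fact K + real K ^ 2 + real J * fact K) * (1 + w v)"
  proof -
    have "0 \<le> (real K ^ 2 + real J * fact K) * w v" "0 \<le> (2 * fact K :: real)" using wv by auto
    then show ?thesis by (simp add: algebra_simps)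
  qed
  finally have "(real k ^ 2 + real J * fact (k - 1) + 2 * (fact (k - 1) * q)) * \<delta> \<le>
      (2 * fact K + real K ^ 2 + real J * fact K) * (1 + w v) * \<delta>"
    using weight_ratio_nonneg by (rule mult_right_mono)
  then have "q * (1 - (2 * fact K + real K ^ 2 + real J * fact K) * (1 + w v) * \<delta>) \<le>
      q * (1 - (real k ^ 2 + real J * fact (k - 1) + 2 * (fact (k - 1) * q)) * \<delta>)"
    using q by (intro mult_left_mono) auto
  also have "\<dots> = q * (1 - real k ^ 2 * \<delta>) - real J * R - 2 * R * q"
    by (simp add: R_def algebra_simps)
  finally show ?thesis using main by (simp add: q_def mult_ac)
qed

lemma sum_distinct_groups_ge:
  assumes ks: "set ks \<subseteq> {2..K}" "length ks \<le> Suc J" and K\<delta>: "real K * \<delta> \<le> 1"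
  shows "(\<Prod>k\<leftarrow>ks. real k * pmf p k * w v *
      max 0 (1 - (2 * fact K + real K ^ 2 + real J * fact K) * \<delta> * (1 + w v))) \<le>
    (\<Sum>as\<in>distinct_choices (\<lambda>k. {a \<in> vertex_groups n v. card a = k}) ks.
      \<Prod>a\<leftarrow>as. off_rate n w p a * exp (- (2 * off_rate n w p a)))"
proof -
  let ?G = "\<lambda>k. {a \<in> vertex_groups n v. card a = k}"
  let ?z = "1 - (2 * fact K + real K ^ 2 + real J * fact K) * \<delta> * (1 + w v)"
  define c where "c a = (if a \<in> vertex_groups n v then off_rate n w p a * exp (- (2 * off_rate n w p a)) else 0)" for a
  have c: "0 \<le> c a" for a using off_rate_nonneg by (simp add: c_def)
  have "(\<Prod>k\<leftarrow>ks. real k * pmf p k * w v * max 0 ?z) \<le> (\<Sum>as\<in>distinct_choices ?G ks. \<Prod>a\<leftarrow>as. c a)"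
  proof (rule sum_distinct_choices_ge[where J = J])
    fix k and X :: "nat set set" assume k: "k \<in> set ks" and X: "finite X" "card X \<le> J"
    have "real k * pmf p k * w v * ?z \<le> (\<Sum>a\<in>?G k - X. off_rate n w p a * exp (- (2 * off_rate n w p a)))"
      using k ks K\<delta> X by (intro sum_damped_rates_ge) auto
    also have "\<dots> = (\<Sum>a\<in>?G k - X. c a)" by (intro sum.cong) (auto simp: c_def)
    finally show "real k * pmf p k * w v * max 0 ?z \<le> (\<Sum>a\<in>?G k - X. c a)"
      using c by (cases "0 \<le> ?z") (auto intro: sum_nonneg simp: max_def)
  qed (use c w_nonneg[OF v] ks finite_vertex_groups in auto)
  also have "\<dots> = (\<Sum>as\<in>distinct_choices ?G ks. \<Prod>a\<leftarrow>as. off_rate n w p a * exp (- (2 * off_rate n w p a)))"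
  proof (intro sum.cong refl arg_cong[where f = prod_list] map_cong)
    fix as a assume "as \<in> distinct_choices ?G ks" "a \<in> set as"
    then have "a \<in> vertex_groups n v" using distinct_choices_set by blast
    then show "c a = off_rate n w p a * exp (- (2 * off_rate n w p a))" by (simp add: c_def)
  qed
  finally show ?thesis .
qed

end

end

section \<open>Configurations of the groups at a vertex\<close>

text \<open>The sizes and the patterns of the groups that are seen on the grid determine the degree at all grid
  points. Both the graph and the limit are compared through this function.\<close>

definition profile :: "(nat \<times> nat set) list \<Rightarrow> nat \<Rightarrow> nat" where
  "profile zs i = (\<Sum>(k, I)\<leftarrow>zs. (k - 1) * of_bool (i \<in> I))"

lemma measurable_on_pattern:
  assumes "0 < t"
  shows "on_pattern t m \<in> (\<Pi>\<^sub>M s\<in>{0..}. count_space UNIV) \<rightarrow>\<^sub>M count_space UNIV"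
  unfolding on_pattern_def[abs_def]
proof (rule measurable_finite_pattern)
  fix i assume "i \<le> m"
  have "grid_point t m i \<in> {0..}" using assms by (simp add: grid_point_def)
  then have "(\<lambda>y. y (grid_point t m i)) \<in> (\<Pi>\<^sub>M s\<in>{0..}. count_space (UNIV :: group_state set)) \<rightarrow>\<^sub>M count_space UNIV"
    by (rule measurable_component_singleton)
  from measurable_sets[OF this, of "{ON}"]
  show "{y \<in> space (\<Pi>\<^sub>M s\<in>{0..}. count_space UNIV). y (grid_point t m i) = ON} \<in>
      sets (\<Pi>\<^sub>M s\<in>{0..}. count_space (UNIV :: group_state set))"
    by (simp add: vimage_def Int_def conj_commute)
qed

context
  fixes n :: nat and w :: "nat \<Rightarrow> real" and p :: "nat pmf" and M :: "'a measure"
    and Y :: "nat set \<Rightarrow> real \<Rightarrow> 'a \<Rightarrow> group_state" and t :: real and m :: nat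
  assumes dyn: "group_dynamics n w p M Y" and t: "0 < t" and m: "0 < m"
begin

interpretation prob_space M using dyn by (simp add: group_dynamics_def)

abbreviation "pat a \<omega> \<equiv> on_pattern t m (\<lambda>s. Y a s \<omega>)"

lemma indep_on_pattern: "indep_vars (\<lambda>_. count_space UNIV) pat (groups n)"
proof -
  have "indep_vars (\<lambda>_. \<Pi>\<^sub>M s\<in>{0..}. count_space UNIV) (\<lambda>a \<omega>. \<lambda>s\<in>{0..}. Y a s \<omega>) (groups n)"
    using dyn by (simp add: group_dynamics_def)
  from indep_vars_compose2[OF this, of "\<lambda>_. on_pattern t m" "\<lambda>_. count_space UNIV"]
  have "indep_vars (\<lambda>_. count_space UNIV) (\<lambda>a \<omega>. on_pattern t m (\<lambda>s\<in>{0..}. Y a s \<omega>)) (groups n)"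
    using measurable_on_pattern[OF t] by blast
  moreover have "on_pattern t m (\<lambda>s\<in>{0..}. Y a s \<omega>) = pat a \<omega>" for a \<omega>
    using t by (auto simp: on_pattern_def grid_point_def)
  ultimately show ?thesis by simp
qed

lemma pat_sets:
  assumes "a \<in> groups n"
  shows "{\<omega> \<in> space M. pat a \<omega> = I} \<in> sets M"
proof -
  have "pat a \<in> M \<rightarrow>\<^sub>M count_space UNIV"
    using indep_on_pattern assms unfolding indep_vars_def by blast
  from measurable_sets[OF this, of "{I}"] show ?thesis
    by (simp add: vimage_def Int_def conj_commute)
qed

lemma pat_joint_prob:
  assumes G: "G \<subseteq> groups n"
  shows "prob {\<omega> \<in> space M. \<forall>a\<in>G. pat a \<omega> = x a} = (\<Prod>a\<in>G. prob {\<omega> \<in> space M. pat a \<omega> = x a})"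
proof (cases "G = {}")
  case False
  have "prob (\<Inter>a\<in>G. pat a -` {x a} \<inter> space M) = (\<Prod>a\<in>G. prob (pat a -` {x a} \<inter> space M))"
    by (rule indep_varsD[OF indep_on_pattern False finite_subset[OF G finite_groups] G]) simp
  moreover have "(\<Inter>a\<in>G. pat a -` {x a} \<inter> space M) = {\<omega> \<in> space M. \<forall>a\<in>G. pat a \<omega> = x a}"
    using False by auto
  moreover have "pat a -` {x a} \<inter> space M = {\<omega> \<in> space M. pat a \<omega> = x a}" for a by auto
  ultimately show ?thesis by simp
qed (simp add: prob_space)

lemma pat_markov_chain:
  "a \<in> groups n \<Longrightarrow> markov_chain M (Y a) (group_stationary (off_rate n w p a)) (group_rates (off_rate n w p a))"
  using dyn by (simp add: group_dynamics_def)

text \<open>All groups contribute to the exponential factor, whether they are seen or not; each group that is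
  seen contributes its damped rate and the mark probability of its pattern. The list \<open>as\<close> orders the
  groups that are seen, and \<open>ys\<close> contains their patterns in this order.\<close>

lemma configuration_prob_ge:
  assumes G: "G \<subseteq> groups n" and r: "\<And>a. a \<in> G \<Longrightarrow> 0 \<le> off_rate n w p a" and \<nu>: "mark_law t \<nu>"
    and as: "as \<in> distinct_lists G j" and ys: "ys \<in> lists_of (Pow {..m} - {{}}) j"
  shows "exp (- ((1 + t) * (\<Sum>a\<in>G. off_rate n w p a))) *
      ((\<Prod>a\<leftarrow>as. (1 + t) * off_rate n w p a * exp (- (2 * off_rate n w p a))) *
       (\<Prod>I\<leftarrow>ys. measure \<nu> {z. mark_pattern t m z = I}))
    \<le> prob {\<omega> \<in> space M. set as = {a \<in> G. pat a \<omega> \<noteq> {}} \<and> map (\<lambda>a. pat a \<omega>) as = ys}"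
proof -
  let ?r = "off_rate n w p"
  define c where "c a = (1 + t) * ?r a * exp (- (2 * ?r a))" for a
  define q where "q I = measure \<nu> {z. mark_pattern t m z = I}" for I
  have fin: "finite G" using finite_subset[OF G finite_groups] .
  have as': "set as \<subseteq> G" "distinct as" "length as = j" using as by (auto simp: distinct_lists_def)
  have ys': "{} \<notin> set ys" "length ys = j" using ys by (auto simp: lists_of_def)
  define x where "x a = (case map_of (zip as ys) a of None \<Rightarrow> {} | Some I \<Rightarrow> I)" for a
  have x_nth: "x (as ! i) = ys ! i" if "i < j" for i
    using map_of_zip_nth[of as ys i] as' ys' that by (simp add: x_def)
  have x_out: "x a = {}" if "a \<notin> set as" for a
  proof -
    have "a \<notin> fst ` set (zip as ys)" using that by (auto dest: set_zip_leftD)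
    then have "map_of (zip as ys) a = None" by (simp add: map_of_eq_None_iff)
    then show ?thesis by (simp add: x_def)
  qed
  have ys_map: "ys = map x as"
    using x_nth as' ys' by (intro nth_equalityI) auto
  have x_in: "x a \<noteq> {}" if "a \<in> set as" for a 
  proof
    assume "x a = {}"
    then have "{} \<in> set (map x as)" using that by (simp add: image_iff) (metis)
    then show False using ys'(1) unfolding ys_map by contradiction
  qed
  have event: "{\<omega> \<in> space M. set as = {a \<in> G. pat a \<omega> \<noteq> {}} \<and> map (\<lambda>a. pat a \<omega>) as = ys} =
      {\<omega> \<in> space M. \<forall>a\<in>G. pat a \<omega> = x a}" (is "?L = ?R")
  proof (intro set_eqI iffI)
    fix \<omega> assume "\<omega> \<in> ?L"
    then have \<omega>: "\<omega> \<in> space M" "set as = {a \<in> G. pat a \<omega> \<noteq> {}}" and "map (\<lambda>a. pat a \<omega>) as = ys"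
      by simp_all
    then have "\<forall>a\<in>set as. pat a \<omega> = x a" by (simp only: ys_map map_eq_conv)
    note \<omega> = \<omega> this
    have "pat a \<omega> = x a" if "a \<in> G" for a using \<omega>(2,3) x_out[of a] that by (cases "a \<in> set as") blast+
    then show "\<omega> \<in> ?R" using \<omega>(1) by simp
  next
    fix \<omega> assume "\<omega> \<in> ?R"
    then have \<omega>: "\<omega> \<in> space M" "\<And>a. a \<in> G \<Longrightarrow> pat a \<omega> = x a" by auto
    have "a \<in> set as \<longleftrightarrow> a \<in> G \<and> pat a \<omega> \<noteq> {}" for a
      using \<omega>(2)[of a] x_out[of a] x_in[of a] as'(1) by blast
    then have "set as = {a \<in> G. pat a \<omega> \<noteq> {}}" by blast
    moreover have "map (\<lambda>a. pat a \<omega>) as = ys" unfolding ys_map using \<omega>(2) as'(1) by auto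
    ultimately show "\<omega> \<in> ?L" using \<omega>(1) by blast
  qed
  have single: "exp (- ((1 + t) * ?r a)) * (if a \<in> set as then c a * q (x a) else 1) \<le>
      prob {\<omega> \<in> space M. pat a \<omega> = x a}" if a: "a \<in> G" for a
  proof (cases "a \<in> set as")
    case True
    show ?thesis
      using on_pattern_prob_ge[OF pat_markov_chain r t m \<nu> x_in[OF True]] a G True
      by (auto simp: c_def q_def)
  next
    case False
    show ?thesis
      using on_pattern_empty_prob_ge[OF pat_markov_chain r t m] a G False by (auto simp: x_out)
  qed
  have nonneg: "0 \<le> c a" if "a \<in> G" for a using r[OF that] t by (simp add: c_def)
  have "(\<Prod>a\<leftarrow>as. c a) * (\<Prod>I\<leftarrow>ys. q I) = (\<Prod>a\<leftarrow>as. c a * q (x a))"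
    unfolding ys_map by (induction as) (auto simp: mult_ac)
  also have "\<dots> = (\<Prod>a\<in>set as. c a * q (x a))" by (rule prod_list_distinct_eq[OF as'(2)])
  also have "\<dots> = (\<Prod>a\<in>G. if a \<in> set as then c a * q (x a) else 1)"
    using as'(1) fin by (simp add: prod.If_cases Int_absorb1 inf.absorb2)
  finally have "exp (- ((1 + t) * (\<Sum>a\<in>G. ?r a))) * ((\<Prod>a\<leftarrow>as. c a) * (\<Prod>I\<leftarrow>ys. q I)) =
      (\<Prod>a\<in>G. exp (- ((1 + t) * ?r a)) * (if a \<in> set as then c a * q (x a) else 1))"
    using fin by (simp add: prod.distrib exp_sum[symmetric] sum_distrib_left sum_negf)
  also have "\<dots> \<le> (\<Prod>a\<in>G. prob {\<omega> \<in> space M. pat a \<omega> = x a})"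
    using nonneg single by (intro prod_mono) (auto simp: q_def)
  also have "\<dots> = prob {\<omega> \<in> space M. set as = {a \<in> G. pat a \<omega> \<noteq> {}} \<and> map (\<lambda>a. pat a \<omega>) as = ys}"
    unfolding event by (rule pat_joint_prob[OF G, symmetric])
  finally show ?thesis by (simp add: c_def[abs_def] q_def)
qed

text \<open>An outcome with \<open>j\<close> seen groups is counted once for each of the \<open>j!\<close> orders of these groups, which the
  factor \<open>1 / j!\<close> compensates. Outcomes with more than \<open>J\<close> seen groups are dropped.\<close>

lemma profile_expectation_ge:
  fixes g :: "(nat \<Rightarrow> nat) \<Rightarrow> real"
  assumes G: "G \<subseteq> groups n" and r: "\<And>a. a \<in> G \<Longrightarrow> 0 \<le> off_rate n w p a" and \<nu>: "mark_law t \<nu>"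
    and g: "\<And>x. 0 \<le> g x"
    and int: "integrable M (\<lambda>\<omega>. g (\<lambda>i. \<Sum>a\<in>G. (card a - 1) * of_bool (i \<in> pat a \<omega>)))"
  shows "exp (- ((1 + t) * (\<Sum>a\<in>G. off_rate n w p a))) *
      (\<Sum>j\<le>J. 1 / fact j * (\<Sum>as\<in>distinct_lists G j.
        (\<Prod>a\<leftarrow>as. (1 + t) * off_rate n w p a * exp (- (2 * off_rate n w p a))) *
        (\<Sum>ys\<in>lists_of (Pow {..m} - {{}}) j. (\<Prod>I\<leftarrow>ys. measure \<nu> {z. mark_pattern t m z = I}) *
          g (profile (zip (map card as) ys)))))
    \<le> expectation (\<lambda>\<omega>. g (\<lambda>i. \<Sum>a\<in>G. (card a - 1) * of_bool (i \<in> pat a \<omega>)))"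
proof -
  let ?r = "off_rate n w p"
  define c where "c a = (1 + t) * ?r a * exp (- (2 * ?r a))" for a
  define q where "q I = measure \<nu> {z. mark_pattern t m z = I}" for I
  define e where "e = exp (- ((1 + t) * (\<Sum>a\<in>G. ?r a)))"
  have fin: "finite G" using finite_subset[OF G finite_groups] .
  define B where "B \<omega> = {a \<in> G. pat a \<omega> \<noteq> {}}" for \<omega>
  define d where "d \<omega> = (\<lambda>i. \<Sum>a\<in>G. (card a - 1) * of_bool (i \<in> pat a \<omega>))" for \<omega>
  define E where "E as ys = {\<omega> \<in> space M. set as = B \<omega> \<and> map (\<lambda>a. pat a \<omega>) as = ys}" for as ys
  have E_sets: "E as ys \<in> sets M" if "as \<in> distinct_lists G j" for as ys j
  proof -
    have as: "set as \<subseteq> G" using that by (simp add: distinct_lists_def)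
    have "E as ys = (if length as = length ys then
        {\<omega> \<in> space M. (\<forall>a\<in>G. a \<in> set as \<longleftrightarrow> pat a \<omega> \<noteq> {}) \<and> (\<forall>i\<in>{..<length as}. pat (as ! i) \<omega> = ys ! i)}
      else {})"
      using as by (auto simp: E_def B_def list_eq_iff_nth_eq)
    moreover have "{\<omega> \<in> space M. a \<in> set as \<longleftrightarrow> pat a \<omega> \<noteq> {}} \<in> sets M" if "a \<in> G" for a
    proof -
      have "{\<omega> \<in> space M. pat a \<omega> = {}} \<in> sets M" using pat_sets that G by blast
      moreover from this have "{\<omega> \<in> space M. \<not> pat a \<omega> = {}} \<in> sets M" by (rule sets.sets_Collect_neg)
      ultimately show ?thesis by (cases "a \<in> set as") auto
    qed
    then have "{\<omega> \<in> space M. (\<forall>a\<in>G. a \<in> set as \<longleftrightarrow> pat a \<omega> \<noteq> {})} \<in> sets M"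
      by (rule sets.sets_Collect_finite_All[OF _ fin])
    moreover have "{\<omega> \<in> space M. (\<forall>i\<in>{..<length as}. pat (as ! i) \<omega> = ys ! i)} \<in> sets M"
    proof (rule sets.sets_Collect_finite_All)
      fix i assume "i \<in> {..<length as}"
      then have "as ! i \<in> groups n" using as G nth_mem by blast
      then show "{\<omega> \<in> space M. pat (as ! i) \<omega> = ys ! i} \<in> sets M" by (rule pat_sets)
    qed simp
    ultimately show ?thesis by (auto intro: sets.sets_Collect_conj)
  qed
  let ?F = "\<lambda>as ys \<omega>. g (profile (zip (map card as) ys)) * indicator (E as ys) \<omega>"
  let ?L = "lists_of (Pow {..m} - {{}})"
  define S where "S \<omega> = (\<Sum>j\<le>J. 1 / fact j * (\<Sum>as\<in>distinct_lists G j. \<Sum>ys\<in>?L j.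
      ?F as ys \<omega>))" for \<omega>
  have S_le: "S \<omega> \<le> g (d \<omega>)" if \<omega>: "\<omega> \<in> space M" for \<omega>
  proof -
    have inner: "(\<Sum>ys\<in>?L j. ?F as ys \<omega>) \<le>
        g (d \<omega>) * of_bool (set as = B \<omega>)" if as: "as \<in> distinct_lists G j" for as j
    proof -
      let ?y = "map (\<lambda>a. pat a \<omega>) as"
      have "profile (zip (map card as) ?y) = d \<omega>" if B: "set as = B \<omega>"
      proof
        fix i
        have "profile (zip (map card as) ?y) i = (\<Sum>a\<leftarrow>as. (card a - 1) * of_bool (i \<in> pat a \<omega>))"
          unfolding profile_def by (induction as) auto
        also have "\<dots> = (\<Sum>a\<in>set as. (card a - 1) * of_bool (i \<in> pat a \<omega>))"
          using as by (simp add: distinct_lists_def sum_list_distinct_conv_sum_set)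
        also have "\<dots> = d \<omega> i"
          unfolding d_def B B_def using fin by (intro sum.mono_neutral_left) auto
        finally show "profile (zip (map card as) ?y) i = d \<omega> i" .
      qed
      then have "?F as ys \<omega> =
          (if ys = ?y then g (d \<omega>) * of_bool (set as = B \<omega>) else 0)" for ys
        using \<omega> by (auto simp: E_def indicator_def)
      then have "(\<Sum>ys\<in>?L j. ?F as ys \<omega>) =
          (\<Sum>ys\<in>?L j. if ys = ?y then g (d \<omega>) * of_bool (set as = B \<omega>) else 0)" by simp
      also have "\<dots> \<le> g (d \<omega>) * of_bool (set as = B \<omega>)"
        using finite_lists_of[of "Pow {..m} - {{}}" j] g by (simp add: sum.delta)
      finally show ?thesis .
    qed
    have finB: "finite (B \<omega>)" using fin by (simp add: B_def)
    have level: "1 / fact j * (\<Sum>as\<in>distinct_lists G j. \<Sum>ys\<in>?L j.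
        ?F as ys \<omega>) \<le> (if j = card (B \<omega>) then g (d \<omega>) else 0)" for j
    proof -
      have "(\<Sum>as\<in>distinct_lists G j. \<Sum>ys\<in>?L j.
          ?F as ys \<omega>) \<le>
          (\<Sum>as\<in>distinct_lists G j. g (d \<omega>) * of_bool (set as = B \<omega>))"
        by (intro sum_mono inner)
      also have "\<dots> = g (d \<omega>) * real (card (distinct_lists G j \<inter> {as. set as = B \<omega>}))"
        using finite_distinct_lists[OF fin] by (simp add: sum_distrib_left[symmetric] sum_of_bool_eq)
      also have "distinct_lists G j \<inter> {as. set as = B \<omega>} = (if j = card (B \<omega>) then permutations_of_set (B \<omega>) else {})"
        by (auto simp: distinct_lists_def permutations_of_set_def B_def dest: distinct_card)
      finally show ?thesis using finB by (auto simp: field_simps split: if_splits)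
    qed
    have "S \<omega> \<le> (\<Sum>j\<le>J. if j = card (B \<omega>) then g (d \<omega>) else 0)"
      unfolding S_def by (intro sum_mono level)
    also have "\<dots> \<le> g (d \<omega>)" using g by (simp add: sum.delta)
    finally show ?thesis .
  qed
  have int_term: "integrable M (\<lambda>\<omega>. ?F as ys \<omega>)"
    if "as \<in> distinct_lists G j" for as ys j
    using E_sets[OF that] by (intro integrable_mult_right integrable_real_indicator) (auto simp: emeasure_eq_measure)
  have S_int: "integrable M S"
    unfolding S_def[abs_def] using int_term by (intro Bochner_Integration.integrable_sum integrable_mult_right) auto
  have "expectation S = (\<Sum>j\<le>J. 1 / fact j * (\<Sum>as\<in>distinct_lists G j. \<Sum>ys\<in>?L j.
      g (profile (zip (map card as) ys)) * prob (E as ys)))"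
  proof -
    have "expectation S = (\<Sum>j\<le>J. expectation (\<lambda>\<omega>. 1 / fact j * (\<Sum>as\<in>distinct_lists G j. \<Sum>ys\<in>?L j.
      ?F as ys \<omega>)))"
      unfolding S_def[abs_def] using int_term
      by (intro Bochner_Integration.integral_sum integrable_mult_right Bochner_Integration.integrable_sum) auto
    also have "\<dots> = (\<Sum>j\<le>J. 1 / fact j * (\<Sum>as\<in>distinct_lists G j. \<Sum>ys\<in>?L j.
      g (profile (zip (map card as) ys)) * prob (E as ys)))"
    proof (intro sum.cong refl)
      fix j
      have "expectation (\<lambda>\<omega>. \<Sum>as\<in>distinct_lists G j. \<Sum>ys\<in>?L j.
          ?F as ys \<omega>) =
          (\<Sum>as\<in>distinct_lists G j. expectation (\<lambda>\<omega>. \<Sum>ys\<in>?L j.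
          ?F as ys \<omega>))"
        using int_term by (intro Bochner_Integration.integral_sum Bochner_Integration.integrable_sum) auto
      also have "\<dots> = (\<Sum>as\<in>distinct_lists G j. \<Sum>ys\<in>?L j.
          expectation (\<lambda>\<omega>. ?F as ys \<omega>))"
        using int_term by (intro sum.cong refl Bochner_Integration.integral_sum) auto
      also have "\<dots> = (\<Sum>as\<in>distinct_lists G j. \<Sum>ys\<in>?L j.
          g (profile (zip (map card as) ys)) * prob (E as ys))"
        using E_sets by (intro sum.cong refl) auto
      finally show "expectation (\<lambda>\<omega>. 1 / fact j * (\<Sum>as\<in>distinct_lists G j. \<Sum>ys\<in>?L j.
          ?F as ys \<omega>)) =
          1 / fact j * (\<Sum>as\<in>distinct_lists G j. \<Sum>ys\<in>?L j.
          g (profile (zip (map card as) ys)) * prob (E as ys))" by simp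
    qed
    finally show ?thesis .
  qed
  moreover have "e * (\<Sum>j\<le>J. 1 / fact j * (\<Sum>as\<in>distinct_lists G j. (\<Prod>a\<leftarrow>as. c a) *
      (\<Sum>ys\<in>?L j. (\<Prod>I\<leftarrow>ys. q I) * g (profile (zip (map card as) ys))))) =
    (\<Sum>j\<le>J. 1 / fact j * (\<Sum>as\<in>distinct_lists G j. \<Sum>ys\<in>?L j.
      g (profile (zip (map card as) ys)) * (e * ((\<Prod>a\<leftarrow>as. c a) * (\<Prod>I\<leftarrow>ys. q I)))))"
    by (simp only: sum_distrib_left mult_ac)
  moreover have "\<dots> \<le> (\<Sum>j\<le>J. 1 / fact j * (\<Sum>as\<in>distinct_lists G j. \<Sum>ys\<in>?L j.
      g (profile (zip (map card as) ys)) * prob (E as ys)))"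
  proof (intro sum_mono mult_left_mono g)
    fix j as ys assume "as \<in> distinct_lists G j" "ys \<in> ?L j"
    from configuration_prob_ge[OF G r \<nu> this]
    show "e * ((\<Prod>a\<leftarrow>as. c a) * (\<Prod>I\<leftarrow>ys. q I)) \<le> prob (E as ys)"
      by (simp add: e_def c_def[abs_def] q_def[abs_def] E_def B_def)
  qed simp
  moreover have "expectation S \<le> expectation (\<lambda>\<omega>. g (d \<omega>))"
    using int S_le by (intro integral_mono S_int) (auto simp: d_def)
  ultimately show ?thesis by (simp add: e_def c_def[abs_def] q_def[abs_def] d_def)
qed

end

section \<open>Comparison with the weights of the limit\<close>

definition poisson_weight :: "nat \<Rightarrow> real \<Rightarrow> real" where
  "poisson_weight j x = exp (- x) * x ^ j / fact j"

lemma poisson_weight_bounds: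
  assumes "0 \<le> x"
  shows "0 \<le> poisson_weight j x" "poisson_weight j x \<le> 1"
proof -
  have "0 \<le> poisson_weight j x \<and> poisson_weight j x \<le> 1"
  proof (cases "x = 0")
    case False
    then have "poisson_weight j x = pmf (poisson_pmf x) j"
      using assms by (simp add: poisson_weight_def)
    then show ?thesis by (simp add: pmf_le_1)
  qed (simp add: poisson_weight_def power_0_left)
  then show "0 \<le> poisson_weight j x" "poisson_weight j x \<le> 1" by auto
qed

lemma sum_prod_lists_of:
  fixes f :: "'a \<Rightarrow> real"
  assumes "finite A"
  shows "(\<Sum>xs\<in>lists_of A j. \<Prod>x\<leftarrow>xs. f x) = (\<Sum>x\<in>A. f x) ^ j"
proof (induction j)
  case 0
  have "lists_of A 0 = {[]}" by (auto simp: lists_of_def)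
  then show ?case by simp
next
  case (Suc j)
  have cons: "lists_of A (Suc j) = (\<lambda>(x, xs). x # xs) ` (A \<times> lists_of A j)"
    by (auto simp: lists_of_def length_Suc_conv image_iff)
  have "inj_on (\<lambda>(x, xs). x # xs) (A \<times> lists_of A j)" by (auto simp: inj_on_def)
  then have "(\<Sum>xs\<in>lists_of A (Suc j). \<Prod>x\<leftarrow>xs. f x) =
      (\<Sum>(x, xs)\<in>A \<times> lists_of A j. f x * (\<Prod>x\<leftarrow>xs. f x))"
    unfolding cons by (subst sum.reindex) (auto intro!: sum.cong)
  also have "\<dots> = (\<Sum>x\<in>A. f x) * (\<Sum>xs\<in>lists_of A j. \<Prod>x\<leftarrow>xs. f x)"
    by (simp add: sum.cartesian_product[symmetric] sum_product)
  finally show ?case using Suc by simp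
qed

lemma prod_list_map_nonneg: "(\<And>x. 0 \<le> f x) \<Longrightarrow> 0 \<le> (\<Prod>x\<leftarrow>xs. f x :: real)"
  by (induction xs) auto

lemma prod_list_scale: "(\<Prod>x\<leftarrow>xs. a * f x :: real) = a ^ length xs * (\<Prod>x\<leftarrow>xs. f x)"
  by (induction xs) auto

definition pattern_prob :: "(real \<times> real) measure \<Rightarrow> real \<Rightarrow> nat \<Rightarrow> nat set \<Rightarrow> real" where
  "pattern_prob \<nu> t m I = measure \<nu> {z. mark_pattern t m z = I}"

text \<open>The expectation of \<open>g\<close> for \<open>j\<close> children whose sizes lie in \<open>A\<close> and whose patterns lie in \<open>\<I>\<close>, as the
  finite sum that appears in the bound for the graph.\<close>

definition root_weight ::
  "nat pmf \<Rightarrow> (nat set \<Rightarrow> real) \<Rightarrow> ((nat \<Rightarrow> nat) \<Rightarrow> real) \<Rightarrow> nat set \<Rightarrow> nat set set \<Rightarrow> nat \<Rightarrow> real" where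
  "root_weight S q g A \<I> j = (\<Sum>ks\<in>lists_of A j. \<Sum>ys\<in>lists_of \<I> j.
     (\<Prod>k\<leftarrow>ks. pmf S k) * ((\<Prod>I\<leftarrow>ys. q I) * g (profile (zip ks ys))))"

lemma sum_pattern_prob:
  assumes "mark_law t \<nu>"
  shows "(\<Sum>I\<in>Pow {..m}. pattern_prob \<nu> t m I) = 1"
proof -
  interpret prob_space \<nu> using assms by (simp add: mark_law_def)
  have sets: "sets \<nu> = sets borel" using assms by (simp add: mark_law_def)
  have space: "space \<nu> = UNIV" using sets_eq_imp_space_eq[OF sets] by simp
  have meas: "mark_pattern t m -` {I} \<in> sets \<nu>" for I
    using measurable_sets[OF measurable_mark_pattern[OF sets], of "{I}" t m] space by simp
  have "(\<Sum>I\<in>Pow {..m}. pattern_prob \<nu> t m I) = measure \<nu> (\<Union>I\<in>Pow {..m}. mark_pattern t m -` {I})"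
    unfolding pattern_prob_def
    using meas by (subst finite_measure_finite_Union) (auto simp: disjoint_family_on_def vimage_def)
  also have "(\<Union>I\<in>Pow {..m}. mark_pattern t m -` {I}) = space \<nu>"
    by (auto simp: space mark_pattern_def)
  finally show ?thesis by (simp add: prob_space)
qed

lemma sum_pmf_le_1: "finite A \<Longrightarrow> (\<Sum>k\<in>A. pmf S k) \<le> 1"
  using measure_measure_pmf_finite[of A S] measure_pmf.prob_le_1[of S A] by simp

lemma root_weight_bounds:
  assumes \<nu>: "mark_law t \<nu>" and g: "\<And>x. 0 \<le> g x" "\<And>x. g x \<le> 1" and A: "finite A" and \<I>: "\<I> \<subseteq> Pow {..m}"
  defines "q \<equiv> pattern_prob \<nu> t m"
  shows "0 \<le> root_weight S q g A \<I> j" "root_weight S q g A \<I> j \<le> 1"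
proof -
  have q: "0 \<le> q I" for I by (simp add: q_def pattern_prob_def)
  have fin: "finite \<I>" using \<I> finite_subset by blast
  show "0 \<le> root_weight S q g A \<I> j"
    unfolding root_weight_def using q g by (intro sum_nonneg mult_nonneg_nonneg prod_list_map_nonneg) auto
  have "root_weight S q g A \<I> j \<le> (\<Sum>ks\<in>lists_of A j. \<Sum>ys\<in>lists_of \<I> j.
     (\<Prod>k\<leftarrow>ks. pmf S k) * ((\<Prod>I\<leftarrow>ys. q I) * 1))"
    unfolding root_weight_def using q g by (intro sum_mono mult_left_mono prod_list_map_nonneg) auto
  also have "\<dots> = (\<Sum>k\<in>A. pmf S k) ^ j * (\<Sum>I\<in>\<I>. q I) ^ j"
    using A fin by (simp add: sum_prod_lists_of[symmetric] sum_product)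
  also have "\<dots> \<le> 1 * 1"
  proof (intro mult_mono power_le_one sum_nonneg)
    show "(\<Sum>k\<in>A. pmf S k) \<le> 1" by (rule sum_pmf_le_1[OF A])
    have "(\<Sum>I\<in>\<I>. q I) \<le> (\<Sum>I\<in>Pow {..m}. q I)" using q \<I> by (intro sum_mono2) auto
    then show "(\<Sum>I\<in>\<I>. q I) \<le> 1" using sum_pattern_prob[OF \<nu>] by (simp add: q_def)
  qed (auto intro!: zero_le_power sum_nonneg q)
  finally show "root_weight S q g A \<I> j \<le> 1" by simp
qed

text \<open>The bound for the graph counts only groups that are seen on the grid, whereas a child in the limit
  may be overlooked by it. By \<open>mark_pattern_empty_prob_le\<close> this costs at most \<open>t\<^sup>2 / m\<close> per child.\<close>

lemma root_weight_seen_ge: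
  assumes \<nu>: "mark_law t \<nu>" and t: "0 < t" and m: "0 < m"
    and g: "\<And>x. 0 \<le> g x" "\<And>x. g x \<le> 1" and S: "\<And>k. k < 2 \<Longrightarrow> pmf S k = 0"
  defines "q \<equiv> pattern_prob \<nu> t m"
  shows "root_weight S q g {..K} (Pow {..m}) j - real j * (t\<^sup>2 / real m) \<le>
    root_weight S q g {2..K} (Pow {..m} - {{}}) j"
proof -
  interpret prob_space \<nu> using \<nu> by (simp add: mark_law_def)
  have q: "0 \<le> q I" for I by (simp add: q_def pattern_prob_def)
  have q0: "q {} \<le> 1" "q {} \<le> t\<^sup>2 / real m"
    using mark_pattern_empty_prob_le[OF \<nu> t m] by (simp_all add: q_def pattern_prob_def)
  let ?L = "lists_of (Pow {..m}) j" and ?L' = "lists_of (Pow {..m} - {{}}) j"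
  have sub: "?L' \<subseteq> ?L" by (auto simp: lists_of_def)
  have finL: "finite ?L" by (rule finite_lists_of) simp
  have inner: "(\<Sum>ys\<in>?L. (\<Prod>I\<leftarrow>ys. q I) * g (profile (zip ks ys))) \<le>
      (\<Sum>ys\<in>?L'. (\<Prod>I\<leftarrow>ys. q I) * g (profile (zip ks ys))) + real j * (t\<^sup>2 / real m)" for ks
  proof -
    have "(\<Sum>ys\<in>?L. (\<Prod>I\<leftarrow>ys. q I) * g (profile (zip ks ys))) -
        (\<Sum>ys\<in>?L'. (\<Prod>I\<leftarrow>ys. q I) * g (profile (zip ks ys))) =
        (\<Sum>ys\<in>?L - ?L'. (\<Prod>I\<leftarrow>ys. q I) * g (profile (zip ks ys)))"
      by (rule sum_diff[OF finL sub, symmetric])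
    also have "\<dots> \<le> (\<Sum>ys\<in>?L - ?L'. (\<Prod>I\<leftarrow>ys. q I) * 1)"
      using q g by (intro sum_mono mult_left_mono prod_list_map_nonneg) auto
    also have "\<dots> = (\<Sum>ys\<in>?L. \<Prod>I\<leftarrow>ys. q I) - (\<Sum>ys\<in>?L'. \<Prod>I\<leftarrow>ys. q I)"
      by (simp only: sum_diff[OF finL sub] mult_1_right)
    also have "\<dots> = 1 - (1 - q {}) ^ j"
    proof -
      have "(\<Sum>I\<in>Pow {..m} - {{}}. q I) = 1 - q {}"
        using sum_pattern_prob[OF \<nu>, of m] by (subst sum_diff1) (auto simp: q_def)
      then show ?thesis using sum_pattern_prob[OF \<nu>, of m] by (simp add: sum_prod_lists_of q_def)
    qed
    also have "\<dots> \<le> real j * q {}" using Bernoulli_inequality[of "- q {}" j] q0 by simp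
    also have "\<dots> \<le> real j * (t\<^sup>2 / real m)" using q0 by (intro mult_left_mono) auto
    finally show ?thesis by simp
  qed
  have "root_weight S q g {..K} (Pow {..m}) j = (\<Sum>ks\<in>lists_of {..K} j.
      (\<Prod>k\<leftarrow>ks. pmf S k) * (\<Sum>ys\<in>?L. (\<Prod>I\<leftarrow>ys. q I) * g (profile (zip ks ys))))"
    by (simp only: root_weight_def sum_distrib_left)
  also have "\<dots> = (\<Sum>ks\<in>lists_of {2..K} j.
      (\<Prod>k\<leftarrow>ks. pmf S k) * (\<Sum>ys\<in>?L. (\<Prod>I\<leftarrow>ys. q I) * g (profile (zip ks ys))))"
  proof (intro sum.mono_neutral_right finite_lists_of ballI)
    fix ks assume "ks \<in> lists_of {..K} j - lists_of {2..K} j"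
    then obtain k where "k \<in> set ks" "k < 2" by (force simp: lists_of_def)
    then have "(\<Prod>k\<leftarrow>ks. pmf S k) = 0" using S by (force simp: prod_list_zero_iff)
    then show "(\<Prod>k\<leftarrow>ks. pmf S k) * (\<Sum>ys\<in>?L. (\<Prod>I\<leftarrow>ys. q I) * g (profile (zip ks ys))) = 0" by simp
  qed (auto simp: lists_of_def)
  also have "\<dots> \<le> (\<Sum>ks\<in>lists_of {2..K} j. (\<Prod>k\<leftarrow>ks. pmf S k) *
      ((\<Sum>ys\<in>?L'. (\<Prod>I\<leftarrow>ys. q I) * g (profile (zip ks ys))) + real j * (t\<^sup>2 / real m)))"
    by (intro sum_mono mult_left_mono inner prod_list_map_nonneg) simp
  also have "\<dots> = root_weight S q g {2..K} (Pow {..m} - {{}}) j +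
      (\<Sum>ks\<in>lists_of {2..K} j. \<Prod>k\<leftarrow>ks. pmf S k) * (real j * (t\<^sup>2 / real m))"
    by (simp only: root_weight_def sum_distrib_left sum_distrib_right distrib_left sum.distrib)
  also have "\<dots> \<le> root_weight S q g {2..K} (Pow {..m} - {{}}) j + 1 * (real j * (t\<^sup>2 / real m))"
    by (intro add_left_mono mult_right_mono)
      (simp_all add: sum_prod_lists_of power_le_one sum_pmf_le_1 sum_nonneg)
  finally show ?thesis by simp
qed

text \<open>The lists of groups are collected according to the sizes of their entries. For given sizes \<open>ks\<close> the
  damped rates, multiplied by \<open>1 + t\<close>, sum up to nearly the product of the \<open>(1 + t) k p\<^sub>k w\<^sub>v\<close>, that is,
  to \<open>((1 + t) \<mu> w\<^sub>v)\<^sup>j\<close> times the probability of \<open>ks\<close> under the size-biased law \<open>S\<close>.\<close>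

lemma vertex_profile_expectation_ge:
  fixes g :: "(nat \<Rightarrow> nat) \<Rightarrow> real"
  assumes dyn: "group_dynamics n w p M Y" and t: "0 < t" and m: "0 < m"
    and w_nonneg: "\<And>i. i \<in> {1..n} \<Longrightarrow> 0 \<le> w i" and total: "0 < (\<Sum>i\<in>{1..n}. w i)"
    and v: "v \<in> {1..n}" and p: "integrable (measure_pmf p) real"
    and \<mu>: "\<mu> = measure_pmf.expectation p real" "0 < \<mu>"
    and \<delta>: "\<And>i. i \<in> {1..n} \<Longrightarrow> w i \<le> \<delta> * (\<Sum>i\<in>{1..n}. w i)" and K\<delta>: "real K * \<delta> \<le> 1"
    and S: "\<And>k. pmf S k = real k * pmf p k / \<mu>" and \<nu>: "mark_law t \<nu>"
    and g: "\<And>x. 0 \<le> g x"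
    and int: "integrable M (\<lambda>\<omega>. g (\<lambda>i. \<Sum>a\<in>vertex_groups n v. (card a - 1) * of_bool (i \<in> on_pattern t m (\<lambda>s. Y a s \<omega>))))"
  shows "(\<Sum>j\<le>J. poisson_weight j ((1 + t) * \<mu> * w v) *
      max 0 (1 - (2 * fact K + real K ^ 2 + real J * fact K) * \<delta> * (1 + w v)) ^ j *
      root_weight S (pattern_prob \<nu> t m) g {2..K} (Pow {..m} - {{}}) j)
    \<le> (\<integral>\<omega>. g (\<lambda>i. \<Sum>a\<in>vertex_groups n v. (card a - 1) * of_bool (i \<in> on_pattern t m (\<lambda>s. Y a s \<omega>))) \<partial>M)"
proof -
  let ?G = "vertex_groups n v" and ?r = "off_rate n w p" and ?q = "pattern_prob \<nu> t m"
  define Z where "Z = max 0 (1 - (2 * fact K + real K ^ 2 + real J * fact K) * \<delta> * (1 + w v))"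
  define c where "c a = ?r a * exp (- (2 * ?r a))" for a
  define H where "H ks = (\<Sum>ys\<in>lists_of (Pow {..m} - {{}}) (length ks). (\<Prod>I\<leftarrow>ys. ?q I) * g (profile (zip ks ys)))" for ks
  have r: "0 \<le> ?r a" if "a \<in> ?G" for a by (rule off_rate_nonneg[OF w_nonneg total v that])
  have c: "0 \<le> c a" if "a \<in> ?G" for a using r[OF that] by (simp add: c_def)
  have q: "0 \<le> ?q I" for I by (simp add: pattern_prob_def)
  have H: "0 \<le> H ks" for ks unfolding H_def using q g by (intro sum_nonneg mult_nonneg_nonneg prod_list_map_nonneg) auto
  have fin: "finite ?G" by (rule finite_vertex_groups)
  have wv: "0 \<le> w v" by (rule w_nonneg[OF v])
  have level: "((1 + t) * \<mu> * w v) ^ j * (Z ^ j * root_weight S ?q g {2..K} (Pow {..m} - {{}}) j) \<le>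
      (\<Sum>as\<in>distinct_lists ?G j. (\<Prod>a\<leftarrow>as. (1 + t) * c a) * H (map card as))" if j: "j \<le> J" for j
  proof -
    let ?D = "{as \<in> distinct_lists ?G j. map card as \<in> lists_of {2..K} j}"
    have finD: "finite (distinct_lists ?G j)" by (rule finite_distinct_lists[OF fin])
    have pos: "0 \<le> (\<Prod>a\<leftarrow>as. c a)" if "as \<in> distinct_lists ?G j" for as
    proof -
      have "set as \<subseteq> ?G" using that by (simp add: distinct_lists_def)
      then show ?thesis using c by (induction as) auto
    qed
    have "((1 + t) * \<mu> * w v) ^ j * (Z ^ j * root_weight S ?q g {2..K} (Pow {..m} - {{}}) j) =
        (\<Sum>ks\<in>lists_of {2..K} j. (1 + t) ^ j * ((\<Prod>k\<leftarrow>ks. real k * pmf p k * w v * Z) * H ks))"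
    proof -
      have "(\<Prod>k\<leftarrow>ks. real k * pmf p k * w v * Z) = \<mu> ^ j * w v ^ j * Z ^ j * (\<Prod>k\<leftarrow>ks. pmf S k)"
        if "ks \<in> lists_of {2..K} j" for ks
      proof -
        have "real k * pmf p k * w v * Z = (\<mu> * w v * Z) * pmf S k" for k using S \<mu> by simp
        then have "(\<Prod>k\<leftarrow>ks. real k * pmf p k * w v * Z) = (\<mu> * w v * Z) ^ length ks * (\<Prod>k\<leftarrow>ks. pmf S k)"
          by (simp only: prod_list_scale)
        then show ?thesis using that by (simp add: lists_of_def power_mult_distrib)
      qed
      moreover have "root_weight S ?q g {2..K} (Pow {..m} - {{}}) j =
          (\<Sum>ks\<in>lists_of {2..K} j. (\<Prod>k\<leftarrow>ks. pmf S k) * H ks)"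
        unfolding root_weight_def H_def
        by (intro sum.cong refl) (simp add: lists_of_def sum_distrib_left)
      ultimately show ?thesis by (simp add: sum_distrib_left power_mult_distrib mult_ac)
    qed
    also have "\<dots> \<le> (\<Sum>ks\<in>lists_of {2..K} j. (1 + t) ^ j *
        ((\<Sum>as\<in>{as \<in> ?D. map card as = ks}. \<Prod>a\<leftarrow>as. c a) * H ks))"
    proof (intro sum_mono mult_left_mono mult_right_mono H)
      fix ks assume ks: "ks \<in> lists_of {2..K} j"
      have "distinct_choices (\<lambda>k. {a \<in> ?G. card a = k}) ks = {as \<in> ?D. map card as = ks}"
      proof (intro set_eqI)
        fix as
        have "list_all2 (\<lambda>a k. a \<in> {a \<in> ?G. card a = k}) as ks \<longleftrightarrow> set as \<subseteq> ?G \<and> map card as = ks"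
          by (induction as arbitrary: ks) (auto simp: list_all2_Cons1)
        then show "as \<in> distinct_choices (\<lambda>k. {a \<in> ?G. card a = k}) ks \<longleftrightarrow> as \<in> {as \<in> ?D. map card as = ks}"
          using ks by (auto simp: distinct_choices_def distinct_lists_def lists_of_def)
      qed
      moreover have "set ks \<subseteq> {2..K}" "length ks \<le> Suc J" using ks j by (auto simp: lists_of_def)
      ultimately show "(\<Prod>k\<leftarrow>ks. real k * pmf p k * w v * Z) \<le> (\<Sum>as\<in>{as \<in> ?D. map card as = ks}. \<Prod>a\<leftarrow>as. c a)"
        using sum_distinct_groups_ge[OF w_nonneg total v \<delta> _ _ K\<delta>, of ks J p] by (simp add: Z_def c_def[abs_def])
    qed (use t in auto)
    also have "\<dots> = (\<Sum>ks\<in>lists_of {2..K} j. \<Sum>as\<in>{as \<in> ?D. map card as = ks}.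
        (1 + t) ^ j * ((\<Prod>a\<leftarrow>as. c a) * H (map card as)))"
      by (intro sum.cong refl) (simp add: sum_distrib_left sum_distrib_right)
    also have "\<dots> = (\<Sum>as\<in>?D. (1 + t) ^ j * ((\<Prod>a\<leftarrow>as. c a) * H (map card as)))"
      using finD by (intro sum.group finite_lists_of) auto
    also have "\<dots> \<le> (\<Sum>as\<in>distinct_lists ?G j. (1 + t) ^ j * ((\<Prod>a\<leftarrow>as. c a) * H (map card as)))"
      using finD pos H t by (intro sum_mono2) auto
    also have "\<dots> = (\<Sum>as\<in>distinct_lists ?G j. (\<Prod>a\<leftarrow>as. (1 + t) * c a) * H (map card as))"
      by (intro sum.cong refl) (simp add: prod_list_scale distinct_lists_def)
    finally show ?thesis .
  qed
  have Hpos: "0 \<le> (\<Sum>as\<in>distinct_lists ?G j. (\<Prod>a\<leftarrow>as. (1 + t) * c a) * H (map card as))" for j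
  proof (intro sum_nonneg mult_nonneg_nonneg H)
    fix as assume "as \<in> distinct_lists ?G j"
    then have "set as \<subseteq> ?G" by (simp add: distinct_lists_def)
    then show "0 \<le> (\<Prod>a\<leftarrow>as. (1 + t) * c a)" using c t by (induction as) auto
  qed
  have "(\<Sum>a\<in>?G. ?r a) \<le> \<mu> * w v" unfolding \<mu>(1) by (rule sum_off_rate_le[OF w_nonneg total v p])
  then have e: "exp (- ((1 + t) * \<mu> * w v)) \<le> exp (- ((1 + t) * (\<Sum>a\<in>?G. ?r a)))"
    using t by (simp add: mult.assoc)
  have "(\<Sum>j\<le>J. poisson_weight j ((1 + t) * \<mu> * w v) * Z ^ j * root_weight S ?q g {2..K} (Pow {..m} - {{}}) j) =
      exp (- ((1 + t) * \<mu> * w v)) * (\<Sum>j\<le>J. 1 / fact j *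
        (((1 + t) * \<mu> * w v) ^ j * (Z ^ j * root_weight S ?q g {2..K} (Pow {..m} - {{}}) j)))"
    by (simp add: poisson_weight_def sum_distrib_left mult_ac)
  also have "\<dots> \<le> exp (- ((1 + t) * \<mu> * w v)) * (\<Sum>j\<le>J. 1 / fact j *
      (\<Sum>as\<in>distinct_lists ?G j. (\<Prod>a\<leftarrow>as. (1 + t) * c a) * H (map card as)))"
    by (intro mult_left_mono sum_mono level) auto
  also have "\<dots> \<le> exp (- ((1 + t) * (\<Sum>a\<in>?G. ?r a))) * (\<Sum>j\<le>J. 1 / fact j *
      (\<Sum>as\<in>distinct_lists ?G j. (\<Prod>a\<leftarrow>as. (1 + t) * c a) * H (map card as)))"
    by (rule mult_right_mono[OF e], rule sum_nonneg, rule mult_nonneg_nonneg[OF _ Hpos]) simp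
  also have "\<dots> = exp (- ((1 + t) * (\<Sum>a\<in>?G. ?r a))) * (\<Sum>j\<le>J. 1 / fact j *
      (\<Sum>as\<in>distinct_lists ?G j. (\<Prod>a\<leftarrow>as. (1 + t) * ?r a * exp (- (2 * ?r a))) *
        (\<Sum>ys\<in>lists_of (Pow {..m} - {{}}) j. (\<Prod>I\<leftarrow>ys. measure \<nu> {z. mark_pattern t m z = I}) *
          g (profile (zip (map card as) ys)))))"
    by (intro arg_cong2[where f = "(*)"] sum.cong refl)
      (simp_all add: c_def[abs_def] H_def distinct_lists_def pattern_prob_def[abs_def] mult.assoc)
  also have "\<dots> \<le> (\<integral>\<omega>. g (\<lambda>i. \<Sum>a\<in>?G. (card a - 1) * of_bool (i \<in> on_pattern t m (\<lambda>s. Y a s \<omega>))) \<partial>M)"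
    by (rule profile_expectation_ge[OF dyn t m _ r \<nu> g int]) (auto simp: vertex_groups_def)
  finally show ?thesis by (simp add: Z_def)
qed

section \<open>Measurability of degree processes\<close>

lemma measurable_nat_sum:
  fixes F :: "'i \<Rightarrow> 'a \<Rightarrow> nat"
  assumes "\<And>i. i \<in> A \<Longrightarrow> F i \<in> M \<rightarrow>\<^sub>M count_space UNIV"
  shows "(\<lambda>\<omega>. \<Sum>i\<in>A. F i \<omega>) \<in> M \<rightarrow>\<^sub>M count_space UNIV"
proof -
  have "(\<lambda>\<omega>. \<Sum>i\<in>A. F i \<omega>) \<in> borel_measurable M"
    using assms by (intro borel_measurable_sum) (simp add: measurable_cong_sets[OF refl sets_borel_eq_count_space])
  then show ?thesis by (simp add: measurable_cong_sets[OF refl sets_borel_eq_count_space])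
qed

lemma sampled_path_cong:
  assumes "0 < t" "\<And>i. i \<le> m \<Longrightarrow> x i = y i"
  shows "sampled_path t m x = sampled_path t m y"
  using assms grid_index_le[OF assms(1)] by (auto simp: sampled_path_def fun_eq_iff restrict_def)

lemma measurable_sampled_process:
  assumes t: "0 < t" and C: "\<And>s. s \<in> {0..t} \<Longrightarrow> C s \<in> M \<rightarrow>\<^sub>M count_space (UNIV :: nat set)"
    and f: "continuous_map (skorokhod_topology t) euclideanreal f"
  shows "(\<lambda>\<omega>. f (sampled_path t m (\<lambda>i. real (C (grid_point t m i) \<omega>)))) \<in> borel_measurable M"
proof -
  have "(\<lambda>\<omega>. \<lambda>s\<in>{0..t}. real (C (grid_point t m (grid_index t m s)) \<omega>)) \<in> M \<rightarrow>\<^sub>M borel_sigma (skorokhod_topology t)"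
  proof (rule measurable_nat_process[OF t])
    show "C (grid_point t m (grid_index t m s)) \<in> M \<rightarrow>\<^sub>M count_space UNIV" if "s \<in> {0..t}" for s
      using that by (intro C grid_point_mem[OF t] grid_index_le[OF t]) simp
    show "(\<lambda>s\<in>{0..t}. real (C (grid_point t m (grid_index t m s)) \<omega>)) \<in> cadlag_space t" for \<omega>
      using sampled_path_cadlag[OF t, of m "\<lambda>i. real (C (grid_point t m i) \<omega>)"] by (simp add: sampled_path_def)
  qed
  from measurable_compose[OF this continuous_map_borel_sigma[OF f]]
  show ?thesis by (simp add: sampled_path_def)
qed

section \<open>The root of the limiting tree\<close>

text \<open>The degree as a sum over the children instead of the sizes. Truncated subtraction lets children of
  size \<open>0\<close> contribute nothing, in accordance with the sum over sizes from \<open>2\<close> on.\<close>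

definition root_degree :: "real \<Rightarrow> nat \<times> (nat \<Rightarrow> nat \<times> real \<times> real) \<Rightarrow> nat" where
  "root_degree s = (\<lambda>(N, c). \<Sum>i<N. (fst (c i) - 1) * of_bool (fst (snd (c i)) \<le> s \<and> s < snd (snd (c i))))"

definition root_path :: "real \<Rightarrow> nat \<times> (nat \<Rightarrow> nat \<times> real \<times> real) \<Rightarrow> real \<Rightarrow> real" where
  "root_path t \<tau> = (\<lambda>s\<in>{0..t}. real (root_degree s \<tau>))"

lemma infsum_root_groups:
  "(\<Sum>\<^sub>\<infinity>k\<in>{2..}. (real k - 1) * real (root_groups k s (N, c))) = real (root_degree s (N, c))"
proof -
  define P where "P i \<longleftrightarrow> fst (snd (c i)) \<le> s \<and> s < snd (snd (c i))" for i
  define A where "A = (\<lambda>i. fst (c i)) ` {..<N} \<inter> {2..}"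
  have fin: "finite A" by (simp add: A_def)
  have card: "real (root_groups k s (N, c)) = (\<Sum>i<N. of_bool (fst (c i) = k \<and> P i))" for k
  proof -
    have "{i. i < N \<and> fst (c i) = k \<and> s \<in> {fst (snd (c i))..<snd (snd (c i))}} =
        {..<N} \<inter> {i. fst (c i) = k \<and> P i}" by (auto simp: P_def)
    then show ?thesis by (simp add: root_groups_def sum_of_bool_eq)
  qed
  have "(\<Sum>\<^sub>\<infinity>k\<in>{2..}. (real k - 1) * real (root_groups k s (N, c))) =
      (\<Sum>\<^sub>\<infinity>k\<in>A. (real k - 1) * real (root_groups k s (N, c)))"
  proof (rule infsum_cong_neutral)
    fix k assume "k \<in> {2..} - A"
    then have "fst (c i) \<noteq> k" if "i < N" for i using that by (auto simp: A_def)
    then have "(\<Sum>i<N. of_bool (fst (c i) = k \<and> P i)) = (0::real)" by (intro sum.neutral) auto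
    then show "(real k - 1) * real (root_groups k s (N, c)) = 0" unfolding card by simp
  qed (auto simp: A_def)
  also have "\<dots> = (\<Sum>k\<in>A. (real k - 1) * (\<Sum>i<N. of_bool (fst (c i) = k \<and> P i)))"
    using fin by (simp add: card)
  also have "\<dots> = (\<Sum>i<N. \<Sum>k\<in>A. (real k - 1) * of_bool (fst (c i) = k \<and> P i))"
    unfolding sum_distrib_left by (rule sum.swap)
  also have "\<dots> = (\<Sum>i<N. real ((fst (c i) - 1) * of_bool (P i)))"
  proof (intro sum.cong refl)
    fix i assume i: "i \<in> {..<N}"
    have "(\<Sum>k\<in>A. (real k - 1) * of_bool (fst (c i) = k \<and> P i)) =
        (\<Sum>k\<in>A. if k = fst (c i) then (real k - 1) * of_bool (P i) else 0)"
      by (intro sum.cong) auto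
    also have "\<dots> = (if fst (c i) \<in> A then (real (fst (c i)) - 1) * of_bool (P i) else 0)"
      using fin by (simp add: sum.delta)
    also have "\<dots> = real ((fst (c i) - 1) * of_bool (P i))"
    proof (cases "2 \<le> fst (c i)")
      case True
      then have "fst (c i) \<in> A" using i by (auto simp: A_def)
      then show ?thesis using True by (simp add: of_nat_diff)
    next
      case False
      then have "fst (c i) \<notin> A" "fst (c i) - 1 = 0" by (auto simp: A_def)
      then show ?thesis by simp
    qed
    finally show "(\<Sum>k\<in>A. (real k - 1) * of_bool (fst (c i) = k \<and> P i)) = real ((fst (c i) - 1) * of_bool (P i))" .
  qed
  finally show ?thesis by (simp add: root_degree_def P_def)
qed

lemma root_path_cadlag: "root_path t \<tau> \<in> cadlag_space t"
  unfolding root_path_def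
proof (rule piecewise_constant_cadlag)
  obtain N c where \<tau>: "\<tau> = (N, c)" by (cases \<tau>)
  define P where "P i s \<longleftrightarrow> fst (snd (c i)) \<le> s \<and> s < snd (snd (c i))" for i s
  have D: "root_degree s \<tau> = (\<Sum>i<N. (fst (c i) - 1) * of_bool (P i s))" for s
    by (simp add: root_degree_def \<tau> P_def)
  fix s
  have "\<forall>\<^sub>F u in at_right s. P i u = P i s" for i
  proof -
    have "\<forall>\<^sub>F u in at_right s. a \<le> u \<longleftrightarrow> a \<le> s" "\<forall>\<^sub>F u in at_right s. u < a \<longleftrightarrow> s < a" for a :: real
      unfolding eventually_at_right_field
      by (cases "a \<le> s"; force intro: exI[of _ "s + 1"] exI[of _ a])+
    from this[of "fst (snd (c i))"] this[of "snd (snd (c i))"] show ?thesis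
      unfolding P_def by eventually_elim simp
  qed
  then have "\<forall>\<^sub>F u in at_right s. \<forall>i\<in>{..<N}. P i u = P i s" by (intro eventually_ball_finite) auto
  then show "\<forall>\<^sub>F u in at_right s. real (root_degree u \<tau>) = real (root_degree s \<tau>)"
    by eventually_elim (simp add: D)
  have "\<forall>\<^sub>F u in at_left s. P i u = (fst (snd (c i)) < s \<and> s \<le> snd (snd (c i)))" for i
  proof -
    have "\<forall>\<^sub>F u in at_left s. a \<le> u \<longleftrightarrow> a < s" "\<forall>\<^sub>F u in at_left s. u < a \<longleftrightarrow> s \<le> a" for a :: real
      unfolding eventually_at_left_field
      by (cases "a < s"; force intro: exI[of _ "s - 1"] exI[of _ a])+
    from this[of "fst (snd (c i))"] this[of "snd (snd (c i))"] show ?thesis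
      unfolding P_def by eventually_elim simp
  qed
  then have "\<forall>\<^sub>F u in at_left s. \<forall>i\<in>{..<N}. P i u = (fst (snd (c i)) < s \<and> s \<le> snd (snd (c i)))"
    by (intro eventually_ball_finite) auto
  then have "\<forall>\<^sub>F u in at_left s. real (root_degree u \<tau>) =
      real (\<Sum>i<N. (fst (c i) - 1) * of_bool (fst (snd (c i)) < s \<and> s \<le> snd (snd (c i))))"
    by eventually_elim (simp add: D)
  then show "\<exists>x. \<forall>\<^sub>F u in at_left s. real (root_degree u \<tau>) = x" by blast
qed

abbreviation children_law :: "nat pmf \<Rightarrow> (real \<times> real) measure \<Rightarrow> (nat \<Rightarrow> nat \<times> real \<times> real) measure" where
  "children_law S \<nu> \<equiv> \<Pi>\<^sub>M i\<in>UNIV. measure_pmf S \<Otimes>\<^sub>M \<nu>"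

context
  fixes S :: "nat pmf" and \<nu> :: "(real \<times> real) measure" and t :: real
  assumes \<nu>: "mark_law t \<nu>" and t: "0 < t"
begin

lemma prob_space_mark: "prob_space \<nu>" and sets_mark: "sets \<nu> = sets borel"
  using \<nu> by (simp_all add: mark_law_def)

lemma prob_space_child: "prob_space (measure_pmf S \<Otimes>\<^sub>M \<nu>)"
  by (intro prob_space_pair measure_pmf.prob_space_axioms prob_space_mark)

lemma product_prob_space_children: "product_prob_space (\<lambda>_. measure_pmf S \<Otimes>\<^sub>M \<nu>)"
  using prob_space_child by (simp add: product_prob_space_def product_prob_space_axioms_def product_sigma_finite_def prob_space_imp_sigma_finite)

lemma prob_space_children: "prob_space (children_law S \<nu>)"
  by (intro prob_space_PiM prob_space_child)

lemma measurable_root_degree_fixed: "(\<lambda>c. root_degree s (N, c)) \<in> children_law S \<nu> \<rightarrow>\<^sub>M count_space UNIV"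
  unfolding root_degree_def prod.case
proof (rule measurable_nat_sum)
  fix i
  let ?P = "\<lambda>z::real\<times>real. fst z \<le> s \<and> s < snd z"
  have comp: "(\<lambda>c. c i) \<in> children_law S \<nu> \<rightarrow>\<^sub>M measure_pmf S \<Otimes>\<^sub>M \<nu>"
    by (rule measurable_component_singleton) simp
  have size: "(\<lambda>c. fst (c i)) \<in> children_law S \<nu> \<rightarrow>\<^sub>M count_space UNIV"
    using measurable_compose[OF comp measurable_fst] by simp
  have "{z. ?P z} \<in> sets \<nu>" unfolding sets_mark by (rule sets_borel_pair_Collect) measurable
  then have "?P \<in> \<nu> \<rightarrow>\<^sub>M count_space UNIV"
    using sets_eq_imp_space_eq[OF sets_mark] by (intro pred_def[THEN iffD2]) simp
  from measurable_compose[OF measurable_compose[OF comp measurable_snd] this]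
  have mark: "(\<lambda>c. ?P (snd (c i))) \<in> children_law S \<nu> \<rightarrow>\<^sub>M count_space UNIV" .
  show "(\<lambda>c. (fst (c i) - 1) * of_bool (?P (snd (c i)))) \<in> children_law S \<nu> \<rightarrow>\<^sub>M count_space UNIV"
    using size mark by measurable
qed

lemma measurable_root_degree: "root_degree s \<in> root_law D S \<nu> \<rightarrow>\<^sub>M count_space UNIV"
proof -
  have "(\<lambda>\<tau>. root_degree s (fst \<tau>, snd \<tau>)) \<in> count_space UNIV \<Otimes>\<^sub>M children_law S \<nu> \<rightarrow>\<^sub>M count_space UNIV"
    by (rule measurable_pair_measure_countable1) (use measurable_root_degree_fixed in auto)
  moreover have "measurable (root_law D S \<nu>) (count_space UNIV) =
      measurable (count_space UNIV \<Otimes>\<^sub>M children_law S \<nu>) (count_space (UNIV :: nat set))"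
    unfolding root_law_def by (intro measurable_cong_sets sets_pair_measure_cong) auto
  ultimately show ?thesis by simp
qed

definition child_event :: "nat \<Rightarrow> nat \<Rightarrow> nat list \<Rightarrow> nat set list \<Rightarrow> (nat \<Rightarrow> nat \<times> real \<times> real) set" where
  "child_event m j ks ys = {c. map (\<lambda>i. fst (c i)) [0..<j] = ks \<and> map (\<lambda>i. mark_pattern t m (snd (c i))) [0..<j] = ys}"

lemma child_event_prob:
  assumes ks: "length ks = j" and ys: "length ys = j"
  shows "child_event m j ks ys \<in> sets (children_law S \<nu>)"
    and "measure (children_law S \<nu>) (child_event m j ks ys) =
      (\<Prod>k\<leftarrow>ks. pmf S k) * (\<Prod>I\<leftarrow>ys. pattern_prob \<nu> t m I)"
proof -
  interpret N: prob_space \<nu> by (rule prob_space_mark)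
  interpret C: prob_space "measure_pmf S \<Otimes>\<^sub>M \<nu>" by (rule prob_space_child)
  have space\<nu>: "space \<nu> = UNIV" using sets_eq_imp_space_eq[OF sets_mark] by simp
  define X where "X i = {ks ! i} \<times> {z. mark_pattern t m z = ys ! i}" for i
  have pat: "{z. mark_pattern t m z = I} \<in> sets \<nu>" for I
    using measurable_sets[OF measurable_mark_pattern[OF sets_mark], of "{I}" t m] space\<nu> by (simp add: vimage_def)
  have X: "X i \<in> sets (measure_pmf S \<Otimes>\<^sub>M \<nu>)" for i unfolding X_def using pat by (intro pair_measureI) auto
  have eq: "child_event m j ks ys = prod_emb UNIV (\<lambda>_. measure_pmf S \<Otimes>\<^sub>M \<nu>) {..<j} (PiE {..<j} X)"
  proof (rule set_eqI)
    fix c :: "nat \<Rightarrow> nat \<times> real \<times> real"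
    have "c \<in> child_event m j ks ys \<longleftrightarrow> (\<forall>i<j. fst (c i) = ks ! i \<and> mark_pattern t m (snd (c i)) = ys ! i)"
      using ks ys by (auto simp: child_event_def list_eq_iff_nth_eq)
    also have "\<dots> \<longleftrightarrow> (\<forall>i<j. c i \<in> X i)" by (simp add: X_def mem_Times_iff)
    also have "\<dots> \<longleftrightarrow> c \<in> prod_emb UNIV (\<lambda>_. measure_pmf S \<Otimes>\<^sub>M \<nu>) {..<j} (PiE {..<j} X)"
      by (simp add: prod_emb_iff space\<nu> space_pair_measure PiE_iff Ball_def)
    finally show "c \<in> child_event m j ks ys \<longleftrightarrow>
      c \<in> prod_emb UNIV (\<lambda>_. measure_pmf S \<Otimes>\<^sub>M \<nu>) {..<j} (PiE {..<j} X)" .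
  qed
  show "child_event m j ks ys \<in> sets (children_law S \<nu>)"
    unfolding eq using X by (intro sets_PiM_I) auto
  have "measure (children_law S \<nu>) (child_event m j ks ys) = (\<Prod>i<j. measure (measure_pmf S \<Otimes>\<^sub>M \<nu>) (X i))"
    unfolding eq
    by (rule product_prob_space.measure_PiM_emb[OF product_prob_space_children]) (use X in auto)
  also have "\<dots> = (\<Prod>i<j. pmf S (ks ! i) * pattern_prob \<nu> t m (ys ! i))"
  proof (intro prod.cong refl)
    fix i
    have "emeasure (measure_pmf S \<Otimes>\<^sub>M \<nu>) (X i) =
        emeasure (measure_pmf S) {ks ! i} * emeasure \<nu> {z. mark_pattern t m z = ys ! i}"
      unfolding X_def using pat by (intro N.emeasure_pair_measure_Times) auto
    then show "measure (measure_pmf S \<Otimes>\<^sub>M \<nu>) (X i) = pmf S (ks ! i) * pattern_prob \<nu> t m (ys ! i)"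
      by (simp add: measure_def enn2real_mult pattern_prob_def pmf.rep_eq)
  qed
  also have "\<dots> = (\<Prod>k\<leftarrow>ks. pmf S k) * (\<Prod>I\<leftarrow>ys. pattern_prob \<nu> t m I)"
  proof -
    have nth: "(\<Prod>x\<leftarrow>xs. f x) = (\<Prod>i<length xs. f (xs ! i))" for f :: "'b \<Rightarrow> real" and xs
      by (subst prod.list_conv_set_nth) (auto simp: atLeast0LessThan intro!: prod.cong)
    show ?thesis using ks ys by (simp add: prod.distrib nth)
  qed
  finally show "measure (children_law S \<nu>) (child_event m j ks ys) =
      (\<Prod>k\<leftarrow>ks. pmf S k) * (\<Prod>I\<leftarrow>ys. pattern_prob \<nu> t m I)" .
qed

lemma root_weight_eq_expectation:
  fixes g :: "(nat \<Rightarrow> nat) \<Rightarrow> real" and m K :: nat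
  defines "G \<equiv> \<lambda>j c. g (profile (map (\<lambda>i. (fst (c i), mark_pattern t m (snd (c i)))) [0..<j])) *
    of_bool (\<forall>i<j. fst (c i) \<le> K)"
  shows "G j \<in> borel_measurable (children_law S \<nu>)"
    and "(\<integral>c. G j c \<partial>children_law S \<nu>) = root_weight S (pattern_prob \<nu> t m) g {..K} (Pow {..m}) j"
proof -
  interpret prob_space "children_law S \<nu>" by (rule prob_space_children)
  let ?A = "lists_of {..K} j" and ?B = "lists_of (Pow {..m}) j"
  have fin: "finite ?A" "finite ?B" by (auto intro: finite_lists_of)
  have G: "G j c = (\<Sum>ks\<in>?A. \<Sum>ys\<in>?B. g (profile (zip ks ys)) * indicator (child_event m j ks ys) c)" for c
  proof -
    define k0 where "k0 = map (\<lambda>i. fst (c i)) [0..<j]"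
    define y0 where "y0 = map (\<lambda>i. mark_pattern t m (snd (c i))) [0..<j]"
    have y0: "y0 \<in> ?B" by (auto simp: lists_of_def y0_def mark_pattern_def)
    have k0: "k0 \<in> ?A \<longleftrightarrow> (\<forall>i<j. fst (c i) \<le> K)" by (auto simp: lists_of_def k0_def image_subset_iff)
    have z: "zip k0 y0 = map (\<lambda>i. (fst (c i), mark_pattern t m (snd (c i)))) [0..<j]"
      by (simp add: k0_def y0_def zip_map_map zip_same_conv_map)
    have "(\<Sum>ks\<in>?A. \<Sum>ys\<in>?B. g (profile (zip ks ys)) * indicator (child_event m j ks ys) c) =
        (\<Sum>ks\<in>?A. \<Sum>ys\<in>?B. if ys = y0 then (if ks = k0 then g (profile (zip k0 y0)) else 0) else 0)"
      by (intro sum.cong) (auto simp: child_event_def k0_def y0_def indicator_def)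
    also have "\<dots> = (if k0 \<in> ?A then g (profile (zip k0 y0)) else 0)"
      using fin y0 by (simp add: sum.delta)
    finally show ?thesis using k0 z by (simp add: G_def)
  qed
  have len: "length ks = j" "length ys = j" if "ks \<in> ?A" "ys \<in> ?B" for ks ys
    using that by (auto simp: lists_of_def)
  have int: "integrable (children_law S \<nu>) (\<lambda>c. g (profile (zip ks ys)) * indicator (child_event m j ks ys) c)"
    if "ks \<in> ?A" "ys \<in> ?B" for ks ys
    using child_event_prob(1)[OF len[OF that], of m]
    by (intro integrable_mult_right integrable_real_indicator) (auto simp: emeasure_eq_measure)
  show "G j \<in> borel_measurable (children_law S \<nu>)"
    unfolding G[abs_def] using int by (intro borel_measurable_sum borel_measurable_integrable) auto
  have "(\<integral>c. G j c \<partial>children_law S \<nu>) = (\<Sum>ks\<in>?A. \<integral>c. (\<Sum>ys\<in>?B.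
      g (profile (zip ks ys)) * indicator (child_event m j ks ys) c) \<partial>children_law S \<nu>)"
    unfolding G using int by (intro Bochner_Integration.integral_sum Bochner_Integration.integrable_sum) auto
  also have "\<dots> = (\<Sum>ks\<in>?A. \<Sum>ys\<in>?B. \<integral>c.
      g (profile (zip ks ys)) * indicator (child_event m j ks ys) c \<partial>children_law S \<nu>)"
    using int by (intro sum.cong refl Bochner_Integration.integral_sum) auto
  also have "\<dots> = root_weight S (pattern_prob \<nu> t m) g {..K} (Pow {..m}) j"
    unfolding root_weight_def
  proof (intro sum.cong refl)
    fix ks ys assume "ks \<in> ?A" "ys \<in> ?B"
    note child_event_prob[OF len[OF this], of m]
    then show "(\<integral>c. g (profile (zip ks ys)) * indicator (child_event m j ks ys) c \<partial>children_law S \<nu>) =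
      (\<Prod>k\<leftarrow>ks. pmf S k) * ((\<Prod>I\<leftarrow>ys. pattern_prob \<nu> t m I) * g (profile (zip ks ys)))"
      by simp
  qed
  finally show "(\<integral>c. G j c \<partial>children_law S \<nu>) = root_weight S (pattern_prob \<nu> t m) g {..K} (Pow {..m}) j" .
qed

text \<open>The bound on the sizes leaves finitely many lists of sizes, as in the bound for the graph.\<close>

definition truncated_root :: "((real \<Rightarrow> real) \<Rightarrow> real) \<Rightarrow> nat \<Rightarrow> nat \<Rightarrow> real" where
  "truncated_root f K j = (\<integral>c. f (root_path t (j, c)) * of_bool (\<forall>i<j. fst (c i) \<le> K) \<partial>children_law S \<nu>)"

lemma root_weight_tendsto:
  assumes f: "continuous_map (skorokhod_topology t) euclideanreal f"
    and f01: "\<And>x. x \<in> cadlag_space t \<Longrightarrow> 0 \<le> f x \<and> f x \<le> 1"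
  shows "(\<lambda>m. root_weight S (pattern_prob \<nu> t m) (\<lambda>x. f (sampled_path t m (\<lambda>i. real (x i)))) {..K} (Pow {..m}) j)
    \<longlonglongrightarrow> truncated_root f K j"
proof -
  interpret prob_space "children_law S \<nu>" by (rule prob_space_children)
  define H where "H m c = f (sampled_path t m (\<lambda>i. real (profile (map (\<lambda>i. (fst (c i), mark_pattern t m (snd (c i)))) [0..<j]) i))) *
    of_bool (\<forall>i<j. fst (c i) \<le> K)" for m c
  have H: "H m c = f (sampled_path t m (\<lambda>i. root_path t (j, c) (grid_point t m i))) * of_bool (\<forall>i<j. fst (c i) \<le> K)" for m c
  proof -
    have "real (profile (map (\<lambda>i. (fst (c i), mark_pattern t m (snd (c i)))) [0..<j]) i) =
        root_path t (j, c) (grid_point t m i)" if "i \<le> m" for i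
      using that grid_point_mem[OF t that]
      by (simp add: profile_def root_path_def root_degree_def mark_pattern_def o_def interv_sum_list_conv_sum_set_nat atLeast0LessThan)
    then have "sampled_path t m (\<lambda>i. real (profile (map (\<lambda>i. (fst (c i), mark_pattern t m (snd (c i)))) [0..<j]) i)) =
        sampled_path t m (\<lambda>i. root_path t (j, c) (grid_point t m i))"
      by (rule sampled_path_cong[OF t])
    then show ?thesis by (simp add: H_def)
  qed
  have meas: "H m \<in> borel_measurable (children_law S \<nu>)" for m
    using root_weight_eq_expectation(1)[of "\<lambda>x. f (sampled_path t m (\<lambda>i. real (x i)))" m j K] by (simp add: H_def[abs_def])
  have lim: "(\<lambda>m. H m c) \<longlonglongrightarrow> f (root_path t (j, c)) * of_bool (\<forall>i<j. fst (c i) \<le> K)" for c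
    unfolding H by (intro tendsto_mult_right sampled_path_limit[OF t root_path_cadlag f])
  have "(\<lambda>m. \<integral>c. H m c \<partial>children_law S \<nu>) \<longlonglongrightarrow> truncated_root f K j"
    unfolding truncated_root_def
  proof (rule integral_dominated_convergence[where w = "\<lambda>_. 1"])
    show "(\<lambda>c. f (root_path t (j, c)) * of_bool (\<forall>i<j. fst (c i) \<le> K)) \<in> borel_measurable (children_law S \<nu>)"
      by (rule borel_measurable_LIMSEQ_real[OF lim meas])
    show "AE c in children_law S \<nu>. norm (H m c) \<le> 1" for m
      using f01[OF sampled_path_cadlag[OF t]] by (auto simp: H of_bool_def)
  qed (use meas lim in auto)
  moreover have "(\<integral>c. H m c \<partial>children_law S \<nu>) = root_weight S (pattern_prob \<nu> t m) (\<lambda>x. f (sampled_path t m (\<lambda>i. real (x i)))) {..K} (Pow {..m}) j" for m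
    using root_weight_eq_expectation(2)[of "\<lambda>x. f (sampled_path t m (\<lambda>i. real (x i)))" m j K] by (simp add: H_def[abs_def])
  ultimately show ?thesis by simp
qed

lemma prob_space_root_law: "prob_space (root_law D S \<nu>)"
  unfolding root_law_def by (intro prob_space_pair measure_pmf.prob_space_axioms prob_space_children)

lemma measurable_root_path: "root_path t \<in> root_law D S \<nu> \<rightarrow>\<^sub>M borel_sigma (skorokhod_topology t)"
  unfolding root_path_def[abs_def]
  using root_path_cadlag[unfolded root_path_def]
  by (intro measurable_nat_process[OF t] measurable_root_degree) auto

lemma truncated_root_tendsto:
  assumes f: "continuous_map (skorokhod_topology t) euclideanreal f"
    and f01: "\<And>x. x \<in> cadlag_space t \<Longrightarrow> 0 \<le> f x \<and> f x \<le> 1"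
  shows "(\<lambda>K. \<Sum>j\<le>K. pmf D j * truncated_root f K j) \<longlonglongrightarrow> (\<integral>\<tau>. f (root_path t \<tau>) \<partial>root_law D S \<nu>)"
proof -
  interpret R: prob_space "root_law D S \<nu>" by (rule prob_space_root_law)
  interpret C: prob_space "children_law S \<nu>" by (rule prob_space_children)
  interpret pair_prob_space "measure_pmf D" "children_law S \<nu>" ..
  define F where "F K \<tau> = f (root_path t \<tau>) * of_bool (fst \<tau> \<le> K \<and> (\<forall>i<fst \<tau>. fst (snd \<tau> i) \<le> K))" for K \<tau>
  have f_meas: "(\<lambda>\<tau>. f (root_path t \<tau>)) \<in> borel_measurable (root_law D S \<nu>)"
    by (rule measurable_compose[OF measurable_root_path continuous_map_borel_sigma[OF f]])
  have ind: "{\<tau> \<in> space (root_law D S \<nu>). fst \<tau> \<le> K \<and> (\<forall>i<fst \<tau>. fst (snd \<tau> i) \<le> K)} \<in> sets (root_law D S \<nu>)" for K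
  proof -
    have "(\<lambda>\<tau>. fst \<tau> \<le> K \<and> (\<forall>i<fst \<tau>. fst (snd \<tau> i) \<le> K)) \<in> count_space UNIV \<Otimes>\<^sub>M children_law S \<nu> \<rightarrow>\<^sub>M count_space UNIV"
    proof (rule measurable_pair_measure_countable1)
      fix N :: nat
      have "(\<lambda>c. \<forall>i\<in>{..<N}. fst (c i) \<le> K) \<in> children_law S \<nu> \<rightarrow>\<^sub>M count_space UNIV"
      proof (rule pred_intros_finite(3))
        fix i assume "i \<in> {..<N}"
        have "(\<lambda>c. c i) \<in> children_law S \<nu> \<rightarrow>\<^sub>M measure_pmf S \<Otimes>\<^sub>M \<nu>"
          by (rule measurable_component_singleton) simp
        from measurable_compose[OF this measurable_fst]
        have "(\<lambda>c. fst (c i)) \<in> children_law S \<nu> \<rightarrow>\<^sub>M count_space UNIV" by simp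
        then show "Measurable.pred (children_law S \<nu>) (\<lambda>c. fst (c i) \<le> K)" by measurable
      qed simp
      then show "(\<lambda>c. fst (N, c) \<le> K \<and> (\<forall>i<fst (N, c). fst (snd (N, c) i) \<le> K)) \<in> children_law S \<nu> \<rightarrow>\<^sub>M count_space UNIV"
        by (cases "N \<le> K") (auto simp: Ball_def)
    qed simp
    moreover have "measurable (root_law D S \<nu>) (count_space UNIV) =
        measurable (count_space UNIV \<Otimes>\<^sub>M children_law S \<nu>) (count_space (UNIV :: bool set))"
      unfolding root_law_def by (intro measurable_cong_sets sets_pair_measure_cong) auto
    ultimately have "Measurable.pred (root_law D S \<nu>) (\<lambda>\<tau>. fst \<tau> \<le> K \<and> (\<forall>i<fst \<tau>. fst (snd \<tau> i) \<le> K))"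
      by (simp only:)
    then show ?thesis by (simp only: pred_def)
  qed
  have F_meas: "F K \<in> borel_measurable (root_law D S \<nu>)" for K
    unfolding F_def[abs_def] of_bool_def
    using f_meas ind[of K] by (intro borel_measurable_times measurable_If) (auto simp: pred_def)
  have F_bound: "\<bar>F K \<tau>\<bar> \<le> 1" for K \<tau>
    using f01[OF root_path_cadlag] by (auto simp: F_def of_bool_def)
  have F_lim: "(\<lambda>K. F K \<tau>) \<longlonglongrightarrow> f (root_path t \<tau>)" for \<tau>
  proof (rule tendsto_eventually)
    define L where "L = fst \<tau> + (\<Sum>i<fst \<tau>. fst (snd \<tau> i))"
    have "fst (snd \<tau> i) \<le> L" if "i < fst \<tau>" for i
      using member_le_sum[of i "{..<fst \<tau>}" "\<lambda>i. fst (snd \<tau> i)"] that by (simp add: L_def)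
    moreover have "fst \<tau> \<le> L" by (simp add: L_def)
    ultimately have "F K \<tau> = f (root_path t \<tau>)" if "L \<le> K" for K
      using that by (auto simp: F_def of_bool_def intro: order_trans)
    then show "\<forall>\<^sub>F K in sequentially. F K \<tau> = f (root_path t \<tau>)"
      by (rule eventually_sequentiallyI)
  qed
  have "(\<lambda>K. \<integral>\<tau>. F K \<tau> \<partial>root_law D S \<nu>) \<longlonglongrightarrow> (\<integral>\<tau>. f (root_path t \<tau>) \<partial>root_law D S \<nu>)"
    by (rule integral_dominated_convergence[where w = "\<lambda>_. 1"]) (use f_meas F_meas F_lim F_bound in auto)
  moreover have "(\<integral>\<tau>. F K \<tau> \<partial>root_law D S \<nu>) = (\<Sum>j\<le>K. pmf D j * truncated_root f K j)" for K
  proof -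
    have "integrable (root_law D S \<nu>) (F K)"
      using F_meas F_bound by (intro R.integrable_const_bound[where B = 1]) auto
    then have "(\<integral>\<tau>. F K \<tau> \<partial>root_law D S \<nu>) = (\<integral>j. \<integral>c. F K (j, c) \<partial>children_law S \<nu> \<partial>measure_pmf D)"
      unfolding root_law_def by (rule integral_fst'[symmetric])
    also have "\<dots> = (\<Sum>j\<in>{..K}. (\<integral>c. F K (j, c) \<partial>children_law S \<nu>) * pmf D j)"
    proof (rule integral_measure_pmf_real)
      fix j assume "(\<integral>c. F K (j, c) \<partial>children_law S \<nu>) \<noteq> 0"
      moreover have "(\<integral>c. F K (j, c) \<partial>children_law S \<nu>) = 0" if "\<not> j \<le> K"
        using that by (simp add: F_def)
      ultimately show "j \<in> {..K}" by auto
    qed simp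
    also have "\<dots> = (\<Sum>j\<le>K. pmf D j * truncated_root f K j)"
      by (intro sum.cong refl) (simp add: F_def truncated_root_def mult.commute)
    finally show ?thesis .
  qed
  ultimately show ?thesis by simp
qed

end

section \<open>Degree processes in the graph\<close>

definition degree_path ::
  "nat \<Rightarrow> (nat set \<Rightarrow> real \<Rightarrow> 'a \<Rightarrow> group_state) \<Rightarrow> real \<Rightarrow> nat \<Rightarrow> 'a \<Rightarrow> real \<Rightarrow> real" where
  "degree_path n Y t v \<omega> = (\<lambda>s\<in>{0..t}. real (drig_degree n Y s \<omega> v))"

lemma measurable_drig_degree:
  assumes dyn: "group_dynamics n w p M Y" and s: "0 \<le> s"
  shows "(\<lambda>\<omega>. drig_degree n Y s \<omega> v) \<in> M \<rightarrow>\<^sub>M count_space UNIV"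
  unfolding drig_degree_eq
proof (rule measurable_nat_sum)
  fix a assume "a \<in> {a \<in> groups n. v \<in> a}"
  then have [measurable]: "Y a s \<in> M \<rightarrow>\<^sub>M count_space UNIV"
    using dyn s by (simp add: group_dynamics_def markov_chain_def)
  show "(\<lambda>\<omega>. (card a - 1) * of_bool (Y a s \<omega> = ON)) \<in> M \<rightarrow>\<^sub>M count_space UNIV" by measurable
qed

lemma degree_path_cadlag:
  assumes dyn: "group_dynamics n w p M Y" and \<omega>: "\<omega> \<in> space M"
  shows "degree_path n Y t v \<omega> \<in> cadlag_space t"
  unfolding degree_path_def
proof (rule piecewise_constant_cadlag)
  let ?G = "{a \<in> groups n. v \<in> a}"
  have fin: "finite ?G" using finite_groups by simp
  fix s
  have chain: "(\<forall>s\<ge>0. \<forall>\<^sub>F u in at_right s. Y a u \<omega> = Y a s \<omega>) \<and> (\<forall>s>0. \<exists>x. \<forall>\<^sub>F u in at_left s. Y a u \<omega> = x)"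
    if "a \<in> ?G" for a
    using dyn \<omega> that by (simp add: group_dynamics_def markov_chain_def)
  show "\<forall>\<^sub>F u in at_right s. real (drig_degree n Y u \<omega> v) = real (drig_degree n Y s \<omega> v)"
    if s: "s \<in> {0..<t}"
  proof -
    have "\<forall>\<^sub>F u in at_right s. \<forall>a\<in>?G. Y a u \<omega> = Y a s \<omega>"
      using chain s by (intro eventually_ball_finite fin ballI) auto
    then show ?thesis by eventually_elim (simp add: drig_degree_eq)
  qed
  show "\<exists>x. \<forall>\<^sub>F u in at_left s. real (drig_degree n Y u \<omega> v) = x" if s: "s \<in> {0<..t}"
  proof -
    have "\<forall>a\<in>?G. \<exists>x. \<forall>\<^sub>F u in at_left s. Y a u \<omega> = x" using chain s by simp
    from bchoice[OF this] obtain x where "\<forall>a\<in>?G. \<forall>\<^sub>F u in at_left s. Y a u \<omega> = x a" by blast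
    then have "\<forall>\<^sub>F u in at_left s. \<forall>a\<in>?G. Y a u \<omega> = x a" by (intro eventually_ball_finite fin)
    then have "\<forall>\<^sub>F u in at_left s. real (drig_degree n Y u \<omega> v) =
        real (\<Sum>a\<in>?G. (card a - 1) * of_bool (x a = ON))"
      by eventually_elim (simp add: drig_degree_eq)
    then show ?thesis by blast
  qed
qed

lemma measurable_degree_path:
  assumes dyn: "group_dynamics n w p M Y" and t: "0 < t"
  shows "(\<lambda>(v, \<omega>). degree_path n Y t v \<omega>) \<in> measure_pmf V \<Otimes>\<^sub>M M \<rightarrow>\<^sub>M borel_sigma (skorokhod_topology t)"
proof -
  have "(\<lambda>z. \<lambda>s\<in>{0..t}. real (drig_degree n Y s (snd z) (fst z))) \<in>
      measure_pmf V \<Otimes>\<^sub>M M \<rightarrow>\<^sub>M borel_sigma (skorokhod_topology t)"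
  proof (rule measurable_nat_process[OF t])
    fix s :: real assume s: "s \<in> {0..t}"
    have "(\<lambda>z. drig_degree n Y s (snd z) (fst z)) \<in> count_space UNIV \<Otimes>\<^sub>M M \<rightarrow>\<^sub>M count_space UNIV"
      by (rule measurable_pair_measure_countable1) (use measurable_drig_degree[OF dyn] s in auto)
    moreover have "measurable (measure_pmf V \<Otimes>\<^sub>M M) (count_space UNIV) =
        measurable (count_space UNIV \<Otimes>\<^sub>M M) (count_space (UNIV :: nat set))"
      by (intro measurable_cong_sets sets_pair_measure_cong) auto
    ultimately show "(\<lambda>z. drig_degree n Y s (snd z) (fst z)) \<in> measure_pmf V \<Otimes>\<^sub>M M \<rightarrow>\<^sub>M count_space UNIV"
      by simp
  next
    fix z assume "z \<in> space (measure_pmf V \<Otimes>\<^sub>M M)"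
    then show "(\<lambda>s\<in>{0..t}. real (drig_degree n Y s (snd z) (fst z))) \<in> cadlag_space t"
      using degree_path_cadlag[OF dyn, of "snd z" t "fst z"] by (simp add: degree_path_def space_pair_measure mem_Times_iff)
  qed
  then show ?thesis by (simp add: degree_path_def case_prod_beta')
qed

lemma measurable_degree_path_fixed:
  assumes dyn: "group_dynamics n w p M Y" and t: "0 < t"
  shows "degree_path n Y t v \<in> M \<rightarrow>\<^sub>M borel_sigma (skorokhod_topology t)"
  unfolding degree_path_def[abs_def]
  using degree_path_cadlag[OF dyn, unfolded degree_path_def] measurable_drig_degree[OF dyn]
  by (intro measurable_nat_process[OF t]) auto

text \<open>A Poisson weight \<open>h\<close> and a root weight \<open>\<theta>\<close> lie in \<open>[0,1]\<close>, so that the relative error \<open>y\<close> per group and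
  the error \<open>d\<close> per child turn into additive errors, which survive averaging over the vertices.\<close>

lemma poisson_term_ge:
  fixes h \<theta> y R d :: real
  assumes h: "0 \<le> h" "h \<le> 1" and \<theta>: "0 \<le> \<theta>" "\<theta> \<le> 1" and y: "0 \<le> y" and d: "0 \<le> d"
    and R: "R - real j * d \<le> \<theta>" and j: "j \<le> K"
  shows "h * R - real K * d - real K * y \<le> h * max 0 (1 - y) ^ j * \<theta>"
proof -
  have power: "1 - real j * y \<le> max 0 (1 - y) ^ j"
  proof (cases "y \<le> 1")
    case True
    then show ?thesis using Bernoulli_inequality[of "- y" j] by simp
  next
    case False
    show ?thesis
    proof (cases j)
      case (Suc i)
      then have "1 * 1 \<le> real j * y" using False by (intro mult_mono) auto
      moreover have "max 0 (1 - y) = 0" using False by simp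
      ultimately show ?thesis by (simp add: Suc)
    qed simp
  qed
  have jK: "real j * d \<le> real K * d" "real j * y \<le> real K * y" using j d y by (simp_all add: mult_right_mono)
  have h\<theta>: "0 \<le> h * \<theta>" "h * \<theta> \<le> 1" using h \<theta> by (simp_all add: mult_le_one)
  have "h * R - real j * d \<le> h * R - h * (real j * d)"
    using mult_right_mono[OF h(2), of "real j * d"] d by simp
  also have "\<dots> \<le> h * \<theta>" using mult_left_mono[OF R h(1)] by (simp add: right_diff_distrib)
  finally have 1: "h * R - real j * d \<le> h * \<theta>" .
  have "h * \<theta> - real j * y \<le> h * \<theta> * (1 - real j * y)"
    using mult_right_mono[OF h\<theta>(2), of "real j * y"] y by (simp add: right_diff_distrib)
  also have "\<dots> \<le> h * \<theta> * max 0 (1 - y) ^ j" by (rule mult_left_mono[OF power h\<theta>(1)])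
  finally show ?thesis using 1 jK by (simp add: mult_ac)
qed

text \<open>The error in \<open>\<delta>\<close> of the bound on the grid does not depend on the mesh. Refining the grid with the
  graph kept fixed therefore passes from sampled paths to paths at no cost.\<close>

lemma vertex_path_expectation_ge:
  fixes f :: "(real \<Rightarrow> real) \<Rightarrow> real"
  assumes dyn: "group_dynamics n w p M Y" and t: "0 < t"
    and w_nonneg: "\<And>i. i \<in> {1..n} \<Longrightarrow> 0 \<le> w i" and total: "0 < (\<Sum>i\<in>{1..n}. w i)"
    and v: "v \<in> {1..n}" and p: "integrable (measure_pmf p) real"
    and \<mu>: "\<mu> = measure_pmf.expectation p real" "0 < \<mu>"
    and \<delta>: "\<And>i. i \<in> {1..n} \<Longrightarrow> w i \<le> \<delta> * (\<Sum>i\<in>{1..n}. w i)" and K\<delta>: "real K * \<delta> \<le> 1"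
    and S: "\<And>k. pmf S k = real k * pmf p k / \<mu>" and S2: "\<And>k. k < 2 \<Longrightarrow> pmf S k = 0" and \<nu>: "mark_law t \<nu>"
    and f: "continuous_map (skorokhod_topology t) euclideanreal f"
    and f01: "\<And>x. x \<in> cadlag_space t \<Longrightarrow> 0 \<le> f x \<and> f x \<le> 1"
  shows "(\<Sum>j\<le>K. poisson_weight j ((1 + t) * \<mu> * w v) * truncated_root S \<nu> t f K j -
      real K * ((2 * fact K + real K ^ 2 + real K * fact K) * \<delta> * (1 + w v)))
    \<le> (\<integral>\<omega>. f (degree_path n Y t v \<omega>) \<partial>M)"
proof (rule LIMSEQ_le)
  interpret prob_space M using dyn by (simp add: group_dynamics_def)
  define \<epsilon> where "\<epsilon> = (2 * fact K + real K ^ 2 + real K * fact K) * \<delta>"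
  define g where "g m x = f (sampled_path t m (\<lambda>i. real (x i)))" for m and x :: "nat \<Rightarrow> nat"
  define Q where "Q m \<omega> = f (sampled_path t m (\<lambda>i. degree_path n Y t v \<omega> (grid_point t m i)))" for m \<omega>
  have g01: "0 \<le> g m x" "g m x \<le> 1" for m x
    using f01[OF sampled_path_cadlag[OF t]] by (auto simp: g_def)
  have \<delta>0: "0 \<le> \<delta>" by (rule weight_ratio_nonneg[OF w_nonneg total v \<delta>])
  have wv: "0 \<le> w v" by (rule w_nonneg[OF v])
  have \<epsilon>: "0 \<le> \<epsilon> * (1 + w v)" using \<delta>0 wv by (simp add: \<epsilon>_def)
  have Qg: "Q m \<omega> = g m (\<lambda>i. \<Sum>a\<in>vertex_groups n v. (card a - 1) * of_bool (i \<in> on_pattern t m (\<lambda>s. Y a s \<omega>)))" for m \<omega>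
    unfolding Q_def g_def
  proof (intro arg_cong[where f = f] sampled_path_cong[OF t])
    fix i assume "i \<le> m"
    then show "degree_path n Y t v \<omega> (grid_point t m i) =
        real (\<Sum>a\<in>vertex_groups n v. (card a - 1) * of_bool (i \<in> on_pattern t m (\<lambda>s. Y a s \<omega>)))"
      using grid_point_mem[OF t] by (simp add: degree_path_def drig_degree_eq vertex_groups_def on_pattern_def)
  qed
  have Q_eq: "Q m = (\<lambda>\<omega>. g m (\<lambda>i. \<Sum>a\<in>vertex_groups n v. (card a - 1) * of_bool (i \<in> on_pattern t m (\<lambda>s. Y a s \<omega>))))" for m
    by (rule ext) (rule Qg)
  have Q_meas: "Q m \<in> borel_measurable M" for m
  proof -
    have "(\<lambda>\<omega>. f (sampled_path t m (\<lambda>i. real (drig_degree n Y (grid_point t m i) \<omega> v)))) \<in> borel_measurable M"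
      by (rule measurable_sampled_process[OF t _ f, where C = "\<lambda>s \<omega>. drig_degree n Y s \<omega> v"])
        (use measurable_drig_degree[OF dyn] in auto)
    moreover have "sampled_path t m (\<lambda>i. real (drig_degree n Y (grid_point t m i) \<omega> v)) =
        sampled_path t m (\<lambda>i. degree_path n Y t v \<omega> (grid_point t m i))" for \<omega>
      by (rule sampled_path_cong[OF t]) (use grid_point_mem[OF t] in \<open>simp add: degree_path_def\<close>)
    ultimately show ?thesis by (simp add: Q_def[abs_def])
  qed
  have Q_bound: "\<bar>Q m \<omega>\<bar> \<le> 1" for m \<omega> unfolding Qg using g01 by simp
  have Q_int: "integrable M (Q m)" for m
    using Q_meas Q_bound by (intro integrable_const_bound[where B = 1]) auto
  let ?R = "\<lambda>m j. root_weight S (pattern_prob \<nu> t m) (g m) {..K} (Pow {..m}) j"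
  let ?L = "\<lambda>m. \<Sum>j\<le>K. poisson_weight j ((1 + t) * \<mu> * w v) * ?R m j - real K * (t\<^sup>2 / real m) - real K * (\<epsilon> * (1 + w v))"
  show "\<exists>N. \<forall>m\<ge>N. ?L m \<le> (\<integral>\<omega>. Q m \<omega> \<partial>M)"
  proof (intro exI allI impI)
    fix m :: nat assume "1 \<le> m"
    then have m: "0 < m" by simp
    have "?L m \<le> (\<Sum>j\<le>K. poisson_weight j ((1 + t) * \<mu> * w v) * max 0 (1 - \<epsilon> * (1 + w v)) ^ j *
        root_weight S (pattern_prob \<nu> t m) (g m) {2..K} (Pow {..m} - {{}}) j)"
    proof (intro sum_mono poisson_term_ge \<epsilon>)
      fix j assume "j \<in> {..K}"
      then show "j \<le> K" by simp
      show "?R m j - real j * (t\<^sup>2 / real m) \<le> root_weight S (pattern_prob \<nu> t m) (g m) {2..K} (Pow {..m} - {{}}) j"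
        by (rule root_weight_seen_ge[OF \<nu> t m g01 S2])
      show "0 \<le> root_weight S (pattern_prob \<nu> t m) (g m) {2..K} (Pow {..m} - {{}}) j"
        "root_weight S (pattern_prob \<nu> t m) (g m) {2..K} (Pow {..m} - {{}}) j \<le> 1"
        by (rule root_weight_bounds[OF \<nu> g01]; force)+
      show "0 \<le> poisson_weight j ((1 + t) * \<mu> * w v)" "poisson_weight j ((1 + t) * \<mu> * w v) \<le> 1"
        using t \<mu>(2) wv by (auto intro!: poisson_weight_bounds)
    qed simp
    also have "\<dots> \<le> (\<integral>\<omega>. Q m \<omega> \<partial>M)"
      unfolding Qg \<epsilon>_def
      by (rule vertex_profile_expectation_ge[OF dyn t m w_nonneg total v p \<mu> \<delta> K\<delta> S \<nu> g01(1)])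
        (assumption | rule Q_int[of m, unfolded Q_eq])+
    finally show "?L m \<le> (\<integral>\<omega>. Q m \<omega> \<partial>M)" .
  qed
  have "?L \<longlonglongrightarrow> (\<Sum>j\<le>K. poisson_weight j ((1 + t) * \<mu> * w v) * truncated_root S \<nu> t f K j -
      real K * 0 - real K * (\<epsilon> * (1 + w v)))"
    using root_weight_tendsto[OF \<nu> t f f01] unfolding g_def
    by (intro tendsto_sum tendsto_diff tendsto_mult_left tendsto_const lim_const_over_n) auto
  then show "?L \<longlonglongrightarrow> (\<Sum>j\<le>K. poisson_weight j ((1 + t) * \<mu> * w v) * truncated_root S \<nu> t f K j -
      real K * ((2 * fact K + real K ^ 2 + real K * fact K) * \<delta> * (1 + w v)))"
    by (simp add: \<epsilon>_def)
  show "(\<lambda>m. \<integral>\<omega>. Q m \<omega> \<partial>M) \<longlonglongrightarrow> (\<integral>\<omega>. f (degree_path n Y t v \<omega>) \<partial>M)"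
  proof (rule integral_dominated_convergence[where w = "\<lambda>_. 1"])
    show "(\<lambda>\<omega>. f (degree_path n Y t v \<omega>)) \<in> borel_measurable M"
      by (rule measurable_compose[OF measurable_degree_path_fixed[OF dyn t] continuous_map_borel_sigma[OF f]])
    show "AE \<omega> in M. (\<lambda>m. Q m \<omega>) \<longlonglongrightarrow> f (degree_path n Y t v \<omega>)"
      unfolding Q_def using sampled_path_limit[OF t degree_path_cadlag[OF dyn] f] by simp
  qed (use Q_meas Q_bound in auto)
qed

lemma degree_path_integral_eq:
  assumes dyn: "group_dynamics n w p M Y" and t: "0 < t" and n: "1 \<le> n"
    and f: "continuous_map (skorokhod_topology t) euclideanreal f"
    and f01: "\<And>x. x \<in> cadlag_space t \<Longrightarrow> 0 \<le> f x \<and> f x \<le> 1"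
  shows "(\<integral>z. f (case z of (v, \<omega>) \<Rightarrow> degree_path n Y t v \<omega>) \<partial>(measure_pmf (pmf_of_set {1..n}) \<Otimes>\<^sub>M M)) =
    (\<Sum>v\<in>{1..n}. \<integral>\<omega>. f (degree_path n Y t v \<omega>) \<partial>M) / real n"
proof -
  interpret prob_space M using dyn by (simp add: group_dynamics_def)
  interpret P: pair_prob_space "measure_pmf (pmf_of_set {1..n})" M ..
  have meas: "(\<lambda>z. f (case z of (v, \<omega>) \<Rightarrow> degree_path n Y t v \<omega>)) \<in>
      borel_measurable (measure_pmf (pmf_of_set {1..n}) \<Otimes>\<^sub>M M)"
    by (rule measurable_compose[OF measurable_degree_path[OF dyn t] continuous_map_borel_sigma[OF f]])
  have "AE z in measure_pmf (pmf_of_set {1..n}) \<Otimes>\<^sub>M M. norm (f (case z of (v, \<omega>) \<Rightarrow> degree_path n Y t v \<omega>)) \<le> 1"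
  proof (rule AE_I2)
    fix z assume "z \<in> space (measure_pmf (pmf_of_set {1..n}) \<Otimes>\<^sub>M M)"
    then have "snd z \<in> space M" by (simp add: space_pair_measure mem_Times_iff)
    from f01[OF degree_path_cadlag[OF dyn this]]
    show "norm (f (case z of (v, \<omega>) \<Rightarrow> degree_path n Y t v \<omega>)) \<le> 1" by (simp add: case_prod_beta')
  qed
  then have "integrable (measure_pmf (pmf_of_set {1..n}) \<Otimes>\<^sub>M M) (\<lambda>z. f (case z of (v, \<omega>) \<Rightarrow> degree_path n Y t v \<omega>))"
    by (rule P.integrable_const_bound[OF _ meas])
  from P.integral_fst'[OF this]
  have "(\<integral>z. f (case z of (v, \<omega>) \<Rightarrow> degree_path n Y t v \<omega>) \<partial>(measure_pmf (pmf_of_set {1..n}) \<Otimes>\<^sub>M M)) =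
      measure_pmf.expectation (pmf_of_set {1..n}) (\<lambda>v. \<integral>\<omega>. f (degree_path n Y t v \<omega>) \<partial>M)" by simp
  also have "\<dots> = (\<Sum>v\<in>{1..n}. \<integral>\<omega>. f (degree_path n Y t v \<omega>) \<partial>M) / real n"
    using n by (subst integral_pmf_of_set) auto
  finally show ?thesis .
qed

section \<open>Averaging over the vertices\<close>

text \<open>Poisson weights are bounded only on the nonnegative half-line, so weak convergence is applied to
  their continuation by constants. The limit \<open>W\<close> is nonnegative because bounded functions that vanish on
  the nonnegative half-line have mean \<open>0\<close> before the limit.\<close>

lemma poisson_mixture_tendsto:
  fixes w :: "nat \<Rightarrow> nat \<Rightarrow> real" and W :: "'w \<Rightarrow> real"
  assumes w_nonneg: "\<And>n i. i \<in> {1..n} \<Longrightarrow> 0 \<le> w n i"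
    and MW: "prob_space MW" and W[measurable]: "W \<in> borel_measurable MW"
    and weak: "weak_conv_m (\<lambda>n. distr (measure_pmf (pmf_of_set {1..n})) borel (w n)) (distr MW borel W)"
    and c: "0 \<le> c"
  shows "(\<lambda>n. (\<Sum>i\<in>{1..n}. poisson_weight j (c * w n i)) / real n) \<longlonglongrightarrow> (\<integral>x. poisson_weight j (c * W x) \<partial>MW)"
proof -
  interpret prob_space MW by (rule MW)
  have real_n: "real_distribution (distr (measure_pmf (pmf_of_set {1..n})) borel (w n))" for n
    by (rule prob_space.real_distribution_distr[OF measure_pmf.prob_space_axioms]) simp
  have real_W: "real_distribution (distr MW borel W)" by (rule real_distribution_distr[OF W])
  have conv: "(\<lambda>n. (\<Sum>i\<in>{1..n}. \<phi> (w n i)) / real n) \<longlonglongrightarrow> (\<integral>x. \<phi> (W x) \<partial>MW)"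
    if cont: "continuous_on UNIV \<phi>" and bound: "\<And>x. \<bar>\<phi> x\<bar> \<le> 1" for \<phi> :: "real \<Rightarrow> real"
  proof -
    have [measurable]: "\<phi> \<in> borel_measurable borel" by (rule borel_measurable_continuous_onI[OF cont])
    have "(\<lambda>n. \<integral>x. \<phi> x \<partial>distr (measure_pmf (pmf_of_set {1..n})) borel (w n)) \<longlonglongrightarrow> (\<integral>x. \<phi> x \<partial>distr MW borel W)"
      by (rule weak_conv_imp_integral_bdd_continuous_conv[OF real_n real_W weak, of \<phi> 1])
        (use cont bound in \<open>auto simp: continuous_on_eq_continuous_at\<close>)
    then have "(\<lambda>n. measure_pmf.expectation (pmf_of_set {1..n}) (\<lambda>i. \<phi> (w n i))) \<longlonglongrightarrow> (\<integral>x. \<phi> (W x) \<partial>MW)"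
      by (simp add: integral_distr)
    moreover have "\<forall>\<^sub>F n in sequentially. measure_pmf.expectation (pmf_of_set {1..n}) (\<lambda>i. \<phi> (w n i)) =
        (\<Sum>i\<in>{1..n}. \<phi> (w n i)) / real n"
      using eventually_ge_at_top[of 1] by eventually_elim (subst integral_pmf_of_set, auto)
    ultimately show ?thesis by (rule Lim_transform_eventually)
  qed
  have W_nonneg: "AE x in MW. 0 \<le> W x"
  proof -
    define \<psi> where "\<psi> x = min 1 (max 0 (- x))" for x :: real
    have "(\<lambda>n. (\<Sum>i\<in>{1..n}. \<psi> (w n i)) / real n) \<longlonglongrightarrow> (\<integral>x. \<psi> (W x) \<partial>MW)"
      by (rule conv) (auto simp: \<psi>_def intro!: continuous_intros)
    moreover have "(\<lambda>n. (\<Sum>i\<in>{1..n}. \<psi> (w n i)) / real n) = (\<lambda>_. 0)"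
      using w_nonneg by (simp add: \<psi>_def sum.neutral fun_eq_iff)
    ultimately have zero: "(\<integral>x. \<psi> (W x) \<partial>MW) = 0" by (metis LIMSEQ_unique tendsto_const)
    have [measurable]: "\<psi> \<in> borel_measurable borel"
      by (rule borel_measurable_continuous_onI) (auto simp: \<psi>_def intro!: continuous_intros)
    have "integrable MW (\<lambda>x. \<psi> (W x))"
      by (rule integrable_const_bound[where B = 1]) (auto simp: \<psi>_def)
    then have "AE x in MW. \<psi> (W x) = 0"
      using zero by (subst (asm) integral_nonneg_eq_0_iff_AE) (auto simp: \<psi>_def)
    then show ?thesis by eventually_elim (auto simp: \<psi>_def min_def max_def split: if_splits)
  qed
  define \<phi> where "\<phi> x = poisson_weight j (c * max 0 x)" for x
  have "(\<lambda>n. (\<Sum>i\<in>{1..n}. \<phi> (w n i)) / real n) \<longlonglongrightarrow> (\<integral>x. \<phi> (W x) \<partial>MW)"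
  proof (rule conv)
    show "continuous_on UNIV \<phi>" unfolding \<phi>_def[abs_def] poisson_weight_def by (intro continuous_intros) auto
    show "\<bar>\<phi> x\<bar> \<le> 1" for x using poisson_weight_bounds[of "c * max 0 x" j] c by (simp add: \<phi>_def)
  qed
  moreover have "(\<Sum>i\<in>{1..n}. \<phi> (w n i)) = (\<Sum>i\<in>{1..n}. poisson_weight j (c * w n i))" for n
    using w_nonneg by (intro sum.cong) (auto simp: \<phi>_def max_def)
  moreover have "(\<integral>x. \<phi> (W x) \<partial>MW) = (\<integral>x. poisson_weight j (c * W x) \<partial>MW)"
  proof (rule integral_cong_AE)
    show "(\<lambda>x. \<phi> (W x)) \<in> borel_measurable MW" "(\<lambda>x. poisson_weight j (c * W x)) \<in> borel_measurable MW"
      unfolding \<phi>_def poisson_weight_def by measurable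
    show "AE x in MW. \<phi> (W x) = poisson_weight j (c * W x)"
      using W_nonneg by eventually_elim (simp add: \<phi>_def max_def)
  qed
  ultimately show ?thesis by simp
qed

text \<open>A single weight is at most the root of the sum of squares, which is of order \<open>sqrt n\<close>, whereas the
  total weight is of order \<open>n\<close>.\<close>

lemma max_weight_ratio_tendsto:
  fixes w :: "nat \<Rightarrow> nat \<Rightarrow> real"
  assumes mean: "(\<lambda>n. (\<Sum>i\<in>{1..n}. w n i) / real n) \<longlonglongrightarrow> e1" and e1: "0 < e1"
    and square: "(\<lambda>n. (\<Sum>i\<in>{1..n}. (w n i)\<^sup>2) / real n) \<longlonglongrightarrow> e2"
  shows "(\<lambda>n. sqrt (\<Sum>i\<in>{1..n}. (w n i)\<^sup>2) / (\<Sum>i\<in>{1..n}. w n i)) \<longlonglongrightarrow> 0"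
proof -
  have lim: "(\<lambda>n. sqrt ((\<Sum>i\<in>{1..n}. (w n i)\<^sup>2) / real n) / ((\<Sum>i\<in>{1..n}. w n i) / real n) * (1 / sqrt (real n)))
      \<longlonglongrightarrow> sqrt e2 / e1 * 0"
  proof (intro tendsto_mult tendsto_divide tendsto_real_sqrt mean square)
    show "(\<lambda>n. 1 / sqrt (real n)) \<longlonglongrightarrow> 0"
      by (rule tendsto_divide_0[OF tendsto_const])
        (intro filterlim_at_top_imp_at_infinity filterlim_compose[OF sqrt_at_top filterlim_real_sequentially])
  qed (use e1 in simp)
  have cancel: "sqrt (a / real n) / (b / real n) * (1 / sqrt (real n)) = sqrt a / b" if "0 < n" for a b and n :: nat
  proof -
    define s where "s = sqrt (real n)"
    have s: "real n = s * s" "s \<noteq> 0" using that by (simp_all add: s_def)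
    have root: "sqrt (a / real n) = sqrt a / s" by (simp add: real_sqrt_divide s_def)
    show ?thesis
      unfolding root unfolding s_def[symmetric] unfolding s(1)
      using s(2) by (cases "b = 0") (simp_all add: field_simps)
  qed
  have "\<forall>\<^sub>F n in sequentially.
      sqrt ((\<Sum>i\<in>{1..n}. (w n i)\<^sup>2) / real n) / ((\<Sum>i\<in>{1..n}. w n i) / real n) * (1 / sqrt (real n)) =
      sqrt (\<Sum>i\<in>{1..n}. (w n i)\<^sup>2) / (\<Sum>i\<in>{1..n}. w n i)"
    using eventually_gt_at_top[of 0] by eventually_elim (rule cancel)
  from Lim_transform_eventually[OF lim this] show ?thesis by simp
qed

lemma le_sqrt_sum_squares:
  fixes w :: "'a \<Rightarrow> real"
  assumes "finite A" "i \<in> A"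
  shows "w i \<le> sqrt (\<Sum>i\<in>A. (w i)\<^sup>2)"
  using member_le_sum[OF assms(2), of "\<lambda>i. (w i)\<^sup>2"] assms(1) by (intro real_le_rsqrt) auto

theorem corollary1p7:
  fixes w :: "nat \<Rightarrow> nat \<Rightarrow> real"
    and p :: "nat pmf"
    and \<mu> t :: real
    and MW :: "'w measure" and W :: "'w \<Rightarrow> real"
    and M :: "nat \<Rightarrow> 'a measure" and Y :: "nat \<Rightarrow> nat set \<Rightarrow> real \<Rightarrow> 'a \<Rightarrow> group_state"
    and D S :: "nat pmf" and \<nu> :: "(real \<times> real) measure"
  assumes w_nonneg: "\<And>n i. i \<in> {1..n} \<Longrightarrow> 0 \<le> w n i"
    and w_total: "\<And>n. 1 \<le> n \<Longrightarrow> 0 < (\<Sum>i\<in>{1..n}. w n i)"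
    and p_support: "set_pmf p \<subseteq> {2..}"
    and p_first_moment: "integrable (measure_pmf p) real"
    and p_second_moment: "integrable (measure_pmf p) (\<lambda>k. (real k)\<^sup>2)"
    and \<mu>_def: "\<mu> = measure_pmf.expectation p real"
    and MW: "prob_space MW"
    and W_measurable: "W \<in> borel_measurable MW"
    and W_first_moment: "integrable MW W" "0 < (\<integral>x. W x \<partial>MW)"
    and W_second_moment: "integrable MW (\<lambda>x. (W x)\<^sup>2)"
    and W_weak: "weak_conv_m (\<lambda>n. distr (measure_pmf (pmf_of_set {1..n})) borel (w n)) (distr MW borel W)"
    and W_mean: "(\<lambda>n. measure_pmf.expectation (pmf_of_set {1..n}) (w n)) \<longlonglongrightarrow> (\<integral>x. W x \<partial>MW)"
    and W_square: "(\<lambda>n. measure_pmf.expectation (pmf_of_set {1..n}) (\<lambda>i. (w n i)\<^sup>2)) \<longlonglongrightarrow> (\<integral>x. (W x)\<^sup>2 \<partial>MW)"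
    and t: "0 < t"
    and dynamics: "\<And>n. 1 \<le> n \<Longrightarrow> group_dynamics n (w n) p (M n) (Y n)"
    and D: "\<And>j. pmf D j = (\<integral>x. exp (- ((1 + t) * \<mu> * W x)) * ((1 + t) * \<mu> * W x) ^ j / fact j \<partial>MW)"
    and S: "\<And>k. pmf S k = real k * pmf p k / \<mu>"
    and \<nu>: "mark_law t \<nu>"
  shows "converges_in_distribution (skorokhod_topology t)
    (\<lambda>n. measure_pmf (pmf_of_set {1..n}) \<Otimes>\<^sub>M M n)
    (\<lambda>n (v, \<omega>). \<lambda>s\<in>{0..t}. real (drig_degree n (Y n) s \<omega> v))
    (root_law D S \<nu>)
    (\<lambda>\<tau>. \<lambda>s\<in>{0..t}. \<Sum>\<^sub>\<infinity>k\<in>{2..}. (real k - 1) * real (root_groups k s \<tau>))"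
proof -
  let ?T = "skorokhod_topology t"
  define P where "P n = measure_pmf (pmf_of_set {1..n}) \<Otimes>\<^sub>M M n" for n
  define X where "X n = (\<lambda>(v, \<omega>). degree_path n (Y n) t v \<omega>)" for n
  have Z_eq: "(\<lambda>\<tau>. \<lambda>s\<in>{0..t}. \<Sum>\<^sub>\<infinity>k\<in>{2..}. (real k - 1) * real (root_groups k s \<tau>)) = root_path t"
    by (rule ext) (auto simp: root_path_def infsum_root_groups)
  have X_eq: "(\<lambda>n (v, \<omega>). \<lambda>s\<in>{0..t}. real (drig_degree n (Y n) s \<omega> v)) = X"
    by (simp add: X_def degree_path_def fun_eq_iff)
  have "measure_pmf.expectation p (\<lambda>_. 2) \<le> measure_pmf.expectation p real"
    using p_support p_first_moment by (intro integral_mono_AE) (auto simp: AE_measure_pmf_iff)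
  then have \<mu>: "0 < \<mu>" by (simp add: \<mu>_def)
  have S2: "pmf S k = 0" if "k < 2" for k
  proof -
    have "k \<notin> set_pmf p" using p_support that by auto
    then show ?thesis by (simp add: S set_pmf_iff)
  qed
  have average: "measure_pmf.expectation (pmf_of_set {1..n}) g = (\<Sum>i\<in>{1..n}. g i) / real n"
    if "1 \<le> n" for n and g :: "nat \<Rightarrow> real"
    using that by (subst integral_pmf_of_set) auto
  have mean: "(\<lambda>n. (\<Sum>i\<in>{1..n}. w n i) / real n) \<longlonglongrightarrow> (\<integral>x. W x \<partial>MW)"
    by (rule Lim_transform_eventually[OF W_mean eventually_mono[OF eventually_ge_at_top[of 1] average]])
  have square: "(\<lambda>n. (\<Sum>i\<in>{1..n}. (w n i)\<^sup>2) / real n) \<longlonglongrightarrow> (\<integral>x. (W x)\<^sup>2 \<partial>MW)"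
    by (rule Lim_transform_eventually[OF W_square eventually_mono[OF eventually_ge_at_top[of 1] average]])
  define \<delta> where "\<delta> n = sqrt (\<Sum>i\<in>{1..n}. (w n i)\<^sup>2) / (\<Sum>i\<in>{1..n}. w n i)" for n
  have \<delta>_lim: "\<delta> \<longlonglongrightarrow> 0"
    unfolding \<delta>_def using mean W_first_moment(2) square by (rule max_weight_ratio_tendsto)
  have \<delta>: "w n i \<le> \<delta> n * (\<Sum>i\<in>{1..n}. w n i)" if "1 \<le> n" "i \<in> {1..n}" for n i
    using le_sqrt_sum_squares[of "{1..n}" i "w n"] that w_total[of n] by (simp add: \<delta>_def)
  have prob_P: "prob_space (P n)" if "1 \<le> n" for n
    using dynamics[OF that] unfolding P_def
    by (intro prob_space_pair measure_pmf.prob_space_axioms) (simp add: group_dynamics_def)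
  have X_meas: "X n \<in> P n \<rightarrow>\<^sub>M borel_sigma ?T" if "1 \<le> n" for n
    unfolding X_def P_def by (rule measurable_degree_path[OF dynamics[OF that] t])
  have X_cadlag: "X n z \<in> cadlag_space t" if "1 \<le> n" "z \<in> space (P n)" for n z
    using degree_path_cadlag[OF dynamics[OF that(1)], of "snd z" t "fst z"] that(2)
    by (auto simp: X_def P_def space_pair_measure mem_Times_iff case_prod_beta')
  interpret R: prob_space "root_law D S \<nu>" by (rule prob_space_root_law[OF \<nu> t])
  have Z_meas: "root_path t \<in> root_law D S \<nu> \<rightarrow>\<^sub>M borel_sigma ?T" by (rule measurable_root_path[OF \<nu> t])

  let ?Z = "\<lambda>f. \<integral>\<tau>. f (root_path t \<tau>) \<partial>root_law D S \<nu>" and ?E = "\<lambda>f n. \<integral>z. f (X n z) \<partial>P n"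

  \<comment> \<open>The limit is truncated first, at a level \<open>K\<close> that depends on the tolerated error; then \<open>n\<close> grows for this fixed \<open>K\<close>.\<close>
  have lower: "\<forall>\<^sub>F n in sequentially. ?Z f - e < ?E f n"
    if f: "continuous_map ?T euclideanreal f" and f01: "\<And>x. x \<in> cadlag_space t \<Longrightarrow> 0 \<le> f x \<and> f x \<le> 1"
      and e: "0 < e" for f e
  proof -
    have "\<forall>\<^sub>F K in sequentially. ?Z f - e < (\<Sum>j\<le>K. pmf D j * truncated_root S \<nu> t f K j)"
      by (rule order_tendstoD(1)[OF truncated_root_tendsto[OF \<nu> t f f01]]) (use e in auto)
    then obtain K where K: "?Z f - e < (\<Sum>j\<le>K. pmf D j * truncated_root S \<nu> t f K j)"
      using eventually_happens'[OF sequentially_bot] by blast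
    define A where "A = 2 * fact K + real K ^ 2 + real K * fact K"
    define B where "B n = (\<Sum>j\<le>K. (\<Sum>v\<in>{1..n}. poisson_weight j ((1 + t) * \<mu> * w n v)) / real n *
        truncated_root S \<nu> t f K j - real K * (A * \<delta> n * (1 + (\<Sum>v\<in>{1..n}. w n v) / real n)))" for n
    have "B \<longlonglongrightarrow> (\<Sum>j\<le>K. pmf D j * truncated_root S \<nu> t f K j - real K * (A * 0 * (1 + (\<integral>x. W x \<partial>MW))))"
      unfolding B_def[abs_def]
    proof (intro tendsto_sum tendsto_diff tendsto_mult tendsto_add tendsto_const mean \<delta>_lim)
      fix j
      have "pmf D j = (\<integral>x. poisson_weight j ((1 + t) * \<mu> * W x) \<partial>MW)" by (simp add: D poisson_weight_def)
      then show "(\<lambda>n. (\<Sum>v\<in>{1..n}. poisson_weight j ((1 + t) * \<mu> * w n v)) / real n) \<longlonglongrightarrow> pmf D j"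
        using poisson_mixture_tendsto[OF w_nonneg MW W_measurable W_weak, of "(1 + t) * \<mu>" j] t \<mu> by simp
    qed
    then have "\<forall>\<^sub>F n in sequentially. ?Z f - e < B n"
      by (rule order_tendstoD(1)) (use K in simp)
    moreover have "(\<lambda>n. real K * \<delta> n) \<longlonglongrightarrow> real K * 0" by (intro tendsto_intros \<delta>_lim)
    then have "\<forall>\<^sub>F n in sequentially. real K * \<delta> n < 1" by (rule order_tendstoD(2)) simp
    ultimately show ?thesis using eventually_ge_at_top[of 1]
    proof eventually_elim
      case (elim n)
      let ?h = "\<lambda>v j. poisson_weight j ((1 + t) * \<mu> * w n v)" and ?T = "truncated_root S \<nu> t f K"
      have "(\<Sum>v\<in>{1..n}. \<Sum>j\<le>K. ?h v j * ?T j - real K * (A * \<delta> n * (1 + w n v))) \<le>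
          (\<Sum>v\<in>{1..n}. \<integral>\<omega>. f (degree_path n (Y n) t v \<omega>) \<partial>M n)"
        unfolding A_def
        using elim by (intro sum_mono vertex_path_expectation_ge[OF dynamics t w_nonneg w_total _ p_first_moment \<mu>_def \<mu> \<delta> _ S S2 \<nu> f f01]) auto
      also have "(\<Sum>v\<in>{1..n}. \<Sum>j\<le>K. ?h v j * ?T j - real K * (A * \<delta> n * (1 + w n v))) = real n * B n"
      proof -
        have "(\<Sum>v\<in>{1..n}. ?h v j * ?T j - real K * (A * \<delta> n * (1 + w n v))) =
            real n * ((\<Sum>v\<in>{1..n}. ?h v j) / real n * ?T j - real K * (A * \<delta> n * (1 + (\<Sum>v\<in>{1..n}. w n v) / real n)))" for j
        proof -
          have "(\<Sum>v\<in>{1..n}. ?h v j * ?T j - real K * (A * \<delta> n * (1 + w n v))) =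
              (\<Sum>v\<in>{1..n}. ?h v j) * ?T j - real K * (A * \<delta> n * (real n + (\<Sum>v\<in>{1..n}. w n v)))"
            by (simp add: sum_subtractf sum_distrib_right[symmetric] sum_distrib_left[symmetric] sum.distrib)
          also have "\<dots> = real n * ((\<Sum>v\<in>{1..n}. ?h v j) / real n * ?T j - real K * (A * \<delta> n * (1 + (\<Sum>v\<in>{1..n}. w n v) / real n)))"
            using elim(3) by (simp add: field_simps)
          finally show ?thesis .
        qed
        then show ?thesis by (subst sum.swap) (simp add: B_def sum_distrib_left)
      qed
      finally have "B n \<le> (\<Sum>v\<in>{1..n}. \<integral>\<omega>. f (degree_path n (Y n) t v \<omega>) \<partial>M n) / real n"
        using elim(3) by (simp add: field_simps)
      also have "\<dots> = ?E f n"
        unfolding X_def P_def by (rule degree_path_integral_eq[OF dynamics[OF elim(3)] t elim(3) f f01, symmetric])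
      finally show ?case using elim(1) by simp
    qed
  qed

  have unit: "(\<lambda>n. ?E f n) \<longlonglongrightarrow> ?Z f"
    if f: "continuous_map ?T euclideanreal f" and f01: "\<And>x. x \<in> cadlag_space t \<Longrightarrow> 0 \<le> f x \<and> f x \<le> 1" for f
  proof (rule tendstoI)
    fix e :: real assume e: "0 < e"
    have f': "continuous_map ?T euclideanreal (\<lambda>x. 1 - f x)" by (intro continuous_intros f)
    have compl: "(\<integral>z. 1 - f (x z) \<partial>Q) = 1 - (\<integral>z. f (x z) \<partial>Q)"
      if "prob_space Q" "x \<in> Q \<rightarrow>\<^sub>M borel_sigma ?T" "\<And>z. z \<in> space Q \<Longrightarrow> x z \<in> cadlag_space t" for Q :: "'z measure" and x
    proof -
      interpret Q: prob_space Q by fact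
      have "integrable Q (\<lambda>z. f (x z))"
        using measurable_compose[OF that(2) continuous_map_borel_sigma[OF f]] f01[OF that(3)]
        by (intro Q.integrable_const_bound[where B = 1]) auto
      then show ?thesis by (simp add: Q.prob_space)
    qed
    have "\<forall>\<^sub>F n in sequentially. ?Z f - e < ?E f n"
      by (rule lower[OF f f01 e])
    moreover have "\<forall>\<^sub>F n in sequentially. ?Z (\<lambda>x. 1 - f x) - e < ?E (\<lambda>x. 1 - f x) n"
      by (rule lower[OF f' _ e]) (use f01 in auto)
    ultimately show "\<forall>\<^sub>F n in sequentially. dist (?E f n) (?Z f) < e"
      using eventually_ge_at_top[of 1]
    proof eventually_elim
      case (elim n)
      have "?E (\<lambda>x. 1 - f x) n = 1 - ?E f n"
        by (rule compl[OF prob_P X_meas X_cadlag]) (use elim in auto)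
      moreover have "?Z (\<lambda>x. 1 - f x) = 1 - ?Z f"
        by (rule compl[OF R.prob_space_axioms Z_meas root_path_cadlag])
      ultimately show ?case using elim(1,2) by (simp add: dist_real_def abs_less_iff)
    qed
  qed

  have "(\<lambda>n. ?E f n) \<longlonglongrightarrow> ?Z f"
    if f: "continuous_map ?T euclideanreal f" and bdd: "bounded (f ` topspace ?T)" for f
  proof -
    obtain b where b: "0 < b" "\<And>x. x \<in> cadlag_space t \<Longrightarrow> \<bar>f x\<bar> \<le> b"
      using bdd by (auto simp: bounded_pos topspace_skorokhod)
    \<comment> \<open>an affine image of \<open>f\<close> with values between \<open>0\<close> and \<open>1\<close>\<close>
    define g where "g x = 1 / (2 * b) * f x + 1 / 2" for x
    have g: "continuous_map ?T euclideanreal g" unfolding g_def by (intro continuous_intros f)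
    have g01: "0 \<le> g x \<and> g x \<le> 1" if "x \<in> cadlag_space t" for x
      using b(2)[OF that] b(1) by (simp add: g_def field_simps abs_le_iff)
    have unscale: "(\<integral>z. f (x z) \<partial>Q) = 2 * b * (\<integral>z. g (x z) \<partial>Q) - b"
      if "prob_space Q" "x \<in> Q \<rightarrow>\<^sub>M borel_sigma ?T" "\<And>z. z \<in> space Q \<Longrightarrow> x z \<in> cadlag_space t" for Q :: "'z measure" and x
    proof -
      interpret Q: prob_space Q by fact
      have "integrable Q (\<lambda>z. f (x z))"
        using measurable_compose[OF that(2) continuous_map_borel_sigma[OF f]] b(2)[OF that(3)]
        by (intro Q.integrable_const_bound[where B = b]) auto
      then have "(\<integral>z. g (x z) \<partial>Q) = 1 / (2 * b) * (\<integral>z. f (x z) \<partial>Q) + 1 / 2"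
        unfolding g_def by (simp add: Q.prob_space)
      then show ?thesis using b(1) by (simp add: field_simps)
    qed
    have "(\<lambda>n. 2 * b * ?E g n - b) \<longlonglongrightarrow> 2 * b * ?Z g - b"
      by (intro tendsto_intros unit[OF g g01])
    moreover have "\<forall>\<^sub>F n in sequentially. 2 * b * ?E g n - b = ?E f n"
      using eventually_ge_at_top[of 1]
      by eventually_elim (rule unscale[symmetric, OF prob_P X_meas X_cadlag])
    moreover have "?Z f = 2 * b * ?Z g - b"
      by (rule unscale[OF R.prob_space_axioms Z_meas root_path_cadlag])
    ultimately show ?thesis by (simp add: Lim_transform_eventually)
  qed
  moreover have "\<forall>\<^sub>F n in sequentially. prob_space (P n) \<and> X n \<in> P n \<rightarrow>\<^sub>M borel_sigma ?T"
    using eventually_ge_at_top[of 1] by eventually_elim (use prob_P X_meas in blast)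
  ultimately show ?thesis
    unfolding X_eq Z_eq converges_in_distribution_def P_def[symmetric]
    using R.prob_space_axioms Z_meas by blast
qed

end
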